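(* (Quasi-elliptic case.) Let $\lambda>n\ge1$, $H=E(n)$, $z_0=\frac1{\sqrt{2n}}(1,\dots,1)\in\mathbb{B}^n$, and let $R$ be the restriction operator $(Rf)(t,x)=e^{-2\pi i\lambda x}f\big(\frac{t_1}{\sqrt{2n}},\dots,\frac{t_n}{\sqrt{2n}}\big)$ from $\mathcal{H}^2_\lambda(\mathbb{B}^n)$ to $L^2_{\chi_\lambda}(E(n)\cdot z_0)$. Put $\phi(t)=\big(1-\frac1{2n}\sum_{i=1}^nt_i\big)^{-\lambda}$ for $t\in\mathbb{T}^n$. Then $R$ is bounded, $\phi\in L^1(\mathbb{T}^n)$, and for all $f\in L^2_{\chi_\lambda}(E(n)\cdot z_0)$ $$RR^*f(t,x)=e^{-2\pi i\lambda x}(\widetilde f*\phi)(t).$$ The Fourier coefficients of $\phi$ are, for $\alpha\in\mathbb{Z}^n$, $$\widehat\phi(\alpha)=\begin{cases}(2n)^{-|\alpha|}\,\dfrac{\Gamma(\lambda+|\alpha|)}{\Gamma(\lambda)}\,\dfrac1{\alpha_1!\cdots\alpha_n!}&\alpha_1,\dots,\alpha_n\ge0,\\[2mm]0&\text{otherwise.}\end{cases}$$ Consequently the closure $\mathcal{B}_\lambda$ of the range of $R$ is $\{f\in L^2_{\chi_\lambda}(E(n)\cdot z_0):\widehat{\widetilde f}(\alpha)=0\text{ whenever }\widehat\phi(\alpha)=0\}$, and $\sqrt{RR^*}f(t,x)=e^{-2\pi i\lambda x}(\widetilde f*\omega)(t)$, where $\omega$ is the distribution on $\mathbb{T}^n$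 with $\widehat\omega=\sqrt{\widehat\phi}$.
   Context: $\mathbb{B}^n$ is the unit ball of $\mathbb{C}^n$; $d\mu_\lambda=c_\lambda(1-|z|^2)^{\lambda-n-1}dv$ is a probability measure ($dv$ Lebesgue); $\mathcal{H}^2_\lambda(\mathbb{B}^n)$ is the space of holomorphic functions in $L^2(\mathbb{B}^n,\mu_\lambda)$, with reproducing kernel $(1-z^t\bar w)^{-\lambda}$. $\mathbb{T}$ is the unit circle. $E(n)=\{\mathrm{diag}(at_1,\dots,at_n,a): a,t_i\in\mathbb{T},\ a^{n+1}t_1\cdots t_n=1\}\subset\mathrm{SU}(n,1)$ acts on $\mathbb{B}^n$ by $z\mapsto(t_1z_1,\dots,t_nz_n)$. Its inverse image in the universal cover of $\mathrm{SU}(n,1)$ is $\widetilde{E(n)}=\{(t,x)\in\mathbb{T}^n\times\mathbb{R}: e^{2\pi i(n+1)x}t_1\cdots t_n=1\}$ (componentwise product), with $a=e^{2\pi ix}$; the stabilizer of $z_0$ is $\widetilde{E(n)}_{z_0}=\{(1,\dots,1,\frac{m}{n+1}): m\in\mathbb{Z}\}$ and the quotient is $\mathbb{T}^n$ via $(t,x)\mapsto t$. $L^2_{\chi_\lambda}(E(n)\cdot z_0)$ is the space of measurable $f:\widetilde{E(n)}\to\mathbb{C}$ with $f(t,x+\frac{m}{n+1})=e^{-2\pi i\lambda m/(n+1)}f(t,x)$ and $|f|\in L^2(\mathbb{T}^n)$ (probability Haar measure), with norm $\big(\int_{\mathbb{T}^n}|f|^2\big)^{1/2}$. $\widetilde f(t)=e^{2\pi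 i\lambda x}f(t,x)$, a well-defined function in $L^2(\mathbb{T}^n)$. $\widehat g(\alpha)=\int_{\mathbb{T}^n}g(t)\overline{t^\alpha}dt$; $|\alpha|=\sum\alpha_i$; $*$ is convolution on $\mathbb{T}^n$, extended to distributions by $\widehat{g*\omega}=\widehat g\,\widehat\omega$. $R^*$ is the Hilbert space adjoint. Powers use the principal branch. *)

theory Defs
  imports "HOL-Analysis.Analysis"
begin

text \<open>Throughout, the dimension n is \<open>CARD('n)\<close>, so n is at least 1.\<close>

section \<open>Spaces of functions with an inner product\<close>

text \<open>
  Elements of an \<open>L\<^sup>2\<close> space are represented by functions; two representatives are
  identified when their difference has norm zero (\<open>same_in\<close>).  Inner products are
  linear in the first argument.
\<close>

record 'a ip_space =
  vecs :: "('a \<Rightarrow> complex) set"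
  ip :: "('a \<Rightarrow> complex) \<Rightarrow> ('a \<Rightarrow> complex) \<Rightarrow> complex"

definition nrm :: "'a ip_space \<Rightarrow> ('a \<Rightarrow> complex) \<Rightarrow> real" where
  "nrm H f = sqrt (Re (ip H f f))"

definition same_in :: "'a ip_space \<Rightarrow> ('a \<Rightarrow> complex) \<Rightarrow> ('a \<Rightarrow> complex) \<Rightarrow> bool" where
  "same_in H f g \<longleftrightarrow> nrm H (\<lambda>p. f p - g p) = 0"

definition bounded_op ::
  "'a ip_space \<Rightarrow> 'b ip_space \<Rightarrow> (('a \<Rightarrow> complex) \<Rightarrow> 'b \<Rightarrow> complex) \<Rightarrow> bool" where
  "bounded_op H K T \<longleftrightarrow>
     (\<forall>f\<in>vecs H. T f \<in> vecs K) \<and>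
     (\<forall>f\<in>vecs H. \<forall>g\<in>vecs H. \<forall>a b.
        same_in K (T (\<lambda>p. a * f p + b * g p)) (\<lambda>q. a * T f q + b * T g q)) \<and>
     (\<exists>C. \<forall>f\<in>vecs H. nrm K (T f) \<le> C * nrm H f)"

definition hilbert_adjoint ::
  "'a ip_space \<Rightarrow> 'b ip_space \<Rightarrow> (('a \<Rightarrow> complex) \<Rightarrow> 'b \<Rightarrow> complex)
     \<Rightarrow> ('b \<Rightarrow> complex) \<Rightarrow> 'a \<Rightarrow> complex" where
  "hilbert_adjoint H K T =
     (SOME S. \<forall>g\<in>vecs K. S g \<in> vecs H \<and> (\<forall>f\<in>vecs H. ip K (T f) g = ip H f (S g)))"

definition op_sqrt ::
  "'a ip_space \<Rightarrow> (('a \<Rightarrow> complex) \<Rightarrow> 'a \<Rightarrow> complex) \<Rightarrow> ('a \<Rightarrow> complex) \<Rightarrow> 'a \<Rightarrow> complex" where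
  "op_sqrt H T =
     (SOME S. bounded_op H H S \<and>
        (\<forall>f\<in>vecs H. ip H (S f) f \<in> \<real> \<and> 0 \<le> Re (ip H (S f) f)) \<and>
        (\<forall>f\<in>vecs H. same_in H (S (S f)) (T f)))"

definition closure_in :: "'a ip_space \<Rightarrow> ('a \<Rightarrow> complex) set \<Rightarrow> ('a \<Rightarrow> complex) set" where
  "closure_in H A = {f \<in> vecs H. \<forall>e>0. \<exists>g\<in>A. nrm H (\<lambda>p. f p - g p) < e}"

section \<open>The weighted Bergman space of the unit ball\<close>

definition holomorphic_vec_on :: "(complex^'n \<Rightarrow> complex) \<Rightarrow> (complex^'n) set \<Rightarrow> bool"
    (infix "holomorphic'_vec'_on" 50) where
  "f holomorphic_vec_on S \<longleftrightarrow>
     (\<forall>z\<in>S. \<exists>D. (f has_derivative D) (at z) \<and> (\<forall>c v. D (c *s v) = c * D v))"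

definition weight :: "real \<Rightarrow> complex^'n \<Rightarrow> real" where
  "weight lam z = (1 - (norm z)\<^sup>2) powr (lam - real CARD('n) - 1)"

text \<open>The constant \<open>c\<^sub>\<lambda>\<close> is the reciprocal of the total mass of the weight.\<close>

definition mu :: "real \<Rightarrow> (complex^'n) measure" where
  "mu lam =
     density (restrict_space lborel (ball 0 1))
       (\<lambda>z. ennreal (weight lam z / (LINT w:ball (0 :: complex^'n) 1|lborel. weight lam w)))"

definition bergman :: "real \<Rightarrow> (complex^'n) ip_space" where
  "bergman lam =
     \<lparr> vecs = {f. f holomorphic_vec_on ball 0 1 \<and> integrable (mu lam) (\<lambda>z. (cmod (f z))\<^sup>2)},
       ip = (\<lambda>f g. LINT z|mu lam. f z * cnj (g z)) \<rparr>"

section \<open>The torus\<close>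

definition torus :: "(complex^'n) set" where
  "torus = {t. \<forall>i. cmod (t $ i) = 1}"

definition torus_exp :: "real^'n \<Rightarrow> complex^'n" where
  "torus_exp \<theta> = (\<chi> i. cis (2 * pi * \<theta> $ i))"

text \<open>Normalised Haar measure: the image of Lebesgue measure on the unit cube.\<close>

definition haar :: "(complex^'n) measure" where
  "haar = distr (restrict_space lborel (cbox 0 1)) (restrict_space borel torus) torus_exp"

definition monomial :: "int^'n \<Rightarrow> complex^'n \<Rightarrow> complex" where
  "monomial \<alpha> t = (\<Prod>i\<in>UNIV. t $ i powi (\<alpha> $ i))"

definition fourier :: "(complex^'n \<Rightarrow> complex) \<Rightarrow> int^'n \<Rightarrow> complex" where
  "fourier g \<alpha> = (LINT t|haar. g t * cnj (monomial \<alpha> t))"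

definition conv :: "(complex^'n \<Rightarrow> complex) \<Rightarrow> (complex^'n \<Rightarrow> complex) \<Rightarrow> complex^'n \<Rightarrow> complex" where
  "conv g h t = (LINT s|haar. g s * h (\<chi> i. t $ i / s $ i))"

section \<open>Distributions on the torus\<close>

definition partial_deriv :: "'n \<Rightarrow> (real^'n \<Rightarrow> complex) \<Rightarrow> real^'n \<Rightarrow> complex" where
  "partial_deriv i F \<theta> = vector_derivative (\<lambda>s. F (\<theta> + s *\<^sub>R axis i 1)) (at 0)"

text \<open>
  Smooth functions on the torus, their derivatives being taken in the angular coordinates.
  Values off the torus are irrelevant.
\<close>

definition torus_deriv :: "'n list \<Rightarrow> (complex^'n \<Rightarrow> complex) \<Rightarrow> real^'n \<Rightarrow> complex" where
  "torus_deriv is \<psi> = foldr partial_deriv is (\<lambda>\<theta>. \<psi> (torus_exp \<theta>))"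

definition test_functions :: "(complex^'n \<Rightarrow> complex) set" where
  "test_functions = {\<psi>. \<forall>is \<theta>. torus_deriv is \<psi> differentiable (at \<theta>)}"

definition Ck_norm :: "nat \<Rightarrow> (complex^'n \<Rightarrow> complex) \<Rightarrow> real" where
  "Ck_norm k \<psi> = (SUP (is, \<theta>)\<in>{is. length is \<le> k} \<times> UNIV. cmod (torus_deriv is \<psi> \<theta>))"

text \<open>
  Continuous linear functionals on the smooth functions.  Continuity forces the value to
  depend only on the restriction of the test function to the torus.
\<close>

definition distribution :: "((complex^'n \<Rightarrow> complex) \<Rightarrow> complex) \<Rightarrow> bool" where
  "distribution u \<longleftrightarrow>
     (\<forall>\<psi>\<in>test_functions. \<forall>\<eta>\<in>test_functions. \<forall>a b.
        u (\<lambda>t. a * \<psi> t + b * \<eta> t) = a * u \<psi> + b * u \<eta>) \<and>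
     (\<exists>C k. \<forall>\<psi>\<in>test_functions. cmod (u \<psi>) \<le> C * Ck_norm k \<psi>)"

definition dist_fourier :: "((complex^'n \<Rightarrow> complex) \<Rightarrow> complex) \<Rightarrow> int^'n \<Rightarrow> complex" where
  "dist_fourier u \<alpha> = u (\<lambda>t. cnj (monomial \<alpha> t))"

definition regular_dist :: "(complex^'n \<Rightarrow> complex) \<Rightarrow> (complex^'n \<Rightarrow> complex) \<Rightarrow> complex" where
  "regular_dist h \<psi> = (LINT t|haar. h t * \<psi> t)"

text \<open>The distribution \<open>u\<close> is the convolution of the function \<open>g\<close> with the distribution \<open>\<omega>\<close>.\<close>

definition is_conv_dist ::
  "(complex^'n \<Rightarrow> complex) \<Rightarrow> ((complex^'n \<Rightarrow> complex) \<Rightarrow> complex)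
     \<Rightarrow> ((complex^'n \<Rightarrow> complex) \<Rightarrow> complex) \<Rightarrow> bool" where
  "is_conv_dist g \<omega> u \<longleftrightarrow>
     distribution u \<and> (\<forall>\<alpha>. dist_fourier u \<alpha> = fourier g \<alpha> * dist_fourier \<omega> \<alpha>)"

section \<open>The quasi-elliptic group and the restriction operator\<close>

definition Etilde :: "((complex^'n) \<times> real) set" where
  "Etilde = {(t, x). t \<in> torus \<and>
     cis (2 * pi * (real CARD('n) + 1) * x) * (\<Prod>i\<in>UNIV. t $ i) = 1}"

text \<open>
  The function on the torus induced by a function on \<open>Etilde\<close> that is invariant under the
  stabilizer, i.e. for which \<open>F (t, x)\<close> does not depend on \<open>x\<close>.
\<close>

definition descend :: "((complex^'n) \<times> real \<Rightarrow> 'b) \<Rightarrow> complex^'n \<Rightarrow> 'b" where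
  "descend F t = (THE w. \<forall>x. (t, x) \<in> Etilde \<longrightarrow> F (t, x) = w)"

definition L2chi :: "real \<Rightarrow> ((complex^'n) \<times> real) ip_space" where
  "L2chi lam =
     \<lparr> vecs = {f. f \<in> borel_measurable (restrict_space borel Etilde) \<and>
               (\<forall>(t, x)\<in>Etilde. \<forall>m::int.
                  f (t, x + m / (real CARD('n) + 1)) =
                  cis (- 2 * pi * lam * m / (real CARD('n) + 1)) * f (t, x)) \<and>
               integrable haar (\<lambda>t. (descend (\<lambda>p. cmod (f p)) t)\<^sup>2)},
       ip = (\<lambda>f g. LINT t|haar. descend (\<lambda>p. f p * cnj (g p)) t) \<rparr>"

definition tilde :: "real \<Rightarrow> ((complex^'n) \<times> real \<Rightarrow> complex) \<Rightarrow> complex^'n \<Rightarrow> complex" where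
  "tilde lam f = descend (\<lambda>(t, x). cis (2 * pi * lam * x) * f (t, x))"

definition restr :: "real \<Rightarrow> (complex^'n \<Rightarrow> complex) \<Rightarrow> (complex^'n) \<times> real \<Rightarrow> complex" where
  "restr lam f = (\<lambda>(t, x).
     cis (- 2 * pi * lam * x) * f (\<chi> i. t $ i / of_real (sqrt (2 * real CARD('n)))))"

definition restr_adj :: "real \<Rightarrow> ((complex^'n) \<times> real \<Rightarrow> complex) \<Rightarrow> complex^'n \<Rightarrow> complex" where
  "restr_adj lam = hilbert_adjoint (bergman lam) (L2chi lam) (restr lam)"

definition phi :: "real \<Rightarrow> complex^'n \<Rightarrow> complex" where
  "phi lam t = (1 - (\<Sum>i\<in>UNIV. t $ i) / of_nat (2 * CARD('n))) powr of_real (- lam)"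

text \<open>The functions induced on the torus are well defined.\<close>

lemma Etilde_fibre_nonempty:
  fixes t :: "complex^'n"
  assumes "t \<in> torus"
  shows "\<exists>x. (t, x) \<in> Etilde"
proof -
  define p where "p = (\<Prod>i\<in>UNIV. t $ i)"
  have p: "cmod p = 1"
    using assms unfolding p_def torus_def prod_norm [symmetric] by simp
  define x where "x = - Arg p / (2 * pi * (real CARD('n) + 1))"
  have "2 * pi * (real CARD('n) + 1) * x = - Arg p"
  proof -
    have "2 * pi * (real CARD('n) + 1) \<noteq> 0" by (simp add: add_nonneg_eq_0_iff)
    then show ?thesis unfolding x_def by simp
  qed
  moreover have "cis (- Arg p) * p = 1"
  proof -
    have "p = cis (Arg p)" using rcis_cmod_Arg [of p] p by (simp add: rcis_def)
    then have "cis (- Arg p) * p = cis (- Arg p) * cis (Arg p)" by simp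
    then show ?thesis by (simp add: cis_mult)
  qed
  ultimately have "(t, x) \<in> Etilde"
    using assms unfolding Etilde_def p_def [symmetric] mem_Collect_eq prod.case by metis
  then show ?thesis ..
qed

lemma descend_eq:
  assumes "(t, x) \<in> Etilde" and "\<And>y. (t, y) \<in> Etilde \<Longrightarrow> F (t, y) = F (t, x)"
  shows "descend F t = F (t, x)"
  unfolding descend_def
proof (rule the_equality)
  show "\<forall>y. (t, y) \<in> Etilde \<longrightarrow> F (t, y) = F (t, x)" using assms(2) by blast
  show "w = F (t, x)" if "\<forall>y. (t, y) \<in> Etilde \<longrightarrow> F (t, y) = w" for w
    using that assms(1) by metis
qed

lemma Etilde_fibre:
  fixes t :: "complex^'n"
  assumes "(t, x) \<in> Etilde" "(t, y) \<in> Etilde"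
  shows "\<exists>m::int. y = x + m / (real CARD('n) + 1)"
proof -
  define N where "N = real CARD('n) + 1"
  have N: "N > 0" by (simp add: N_def add_nonneg_pos)
  have ne: "(\<Prod>i\<in>UNIV. t $ i) \<noteq> 0"
  proof
    assume "(\<Prod>i\<in>UNIV. t $ i) = 0"
    with assms(1) show False unfolding Etilde_def mem_Collect_eq prod.case
      by (metis mult_zero_right zero_neq_one)
  qed
  have "cis (2 * pi * N * y) * (\<Prod>i\<in>UNIV. t $ i) = cis (2 * pi * N * x) * (\<Prod>i\<in>UNIV. t $ i)"
    using assms unfolding Etilde_def N_def by simp
  then have "cis (2 * pi * N * y) = cis (2 * pi * N * x)"
    using ne by simp
  then have "cos (2 * pi * N * y) = cos (2 * pi * N * x)"
      "sin (2 * pi * N * y) = sin (2 * pi * N * x)"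
    by (simp_all add: complex_eq_iff)
  then obtain m :: int where m: "2 * pi * N * y = 2 * pi * N * x + 2 * pi * m"
    using sin_cos_eq_iff by blast
  have "2 * pi * (N * y) = 2 * pi * (N * x + m)"
    using m by (simp only: distrib_left mult.assoc)
  then have "N * y = N * x + m" by simp
  then have "y = x + m / N" using N by (simp add: field_simps)
  then show ?thesis unfolding N_def by blast
qed

lemma tilde_eq:
  fixes f :: "(complex^'n) \<times> real \<Rightarrow> complex"
  assumes f: "f \<in> vecs (L2chi lam)" and tx: "(t, x) \<in> Etilde"
  shows "tilde lam f t = cis (2 * pi * lam * x) * f (t, x)"
proof -
  let ?F = "\<lambda>(t, x). cis (2 * pi * lam * x) * f (t, x)"
  have "?F (t, y) = ?F (t, x)" if ty: "(t, y) \<in> Etilde" for y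
  proof -
    obtain m :: int where m: "y = x + m / (real CARD('n) + 1)"
      using Etilde_fibre [OF tx ty] by blast
    have "f (t, y) = cis (- 2 * pi * lam * m / (real CARD('n) + 1)) * f (t, x)"
    proof -
      have "\<forall>(t, x)\<in>Etilde. \<forall>m::int. f (t, x + m / (real CARD('n) + 1)) =
          cis (- 2 * pi * lam * m / (real CARD('n) + 1)) * f (t, x)"
        using f unfolding L2chi_def ip_space.simps mem_Collect_eq by blast
      from bspec [OF this tx] show ?thesis unfolding m prod.case by blast
    qed
    moreover have "cis (2 * pi * lam * y) * cis (- 2 * pi * lam * m / (real CARD('n) + 1)) =
        cis (2 * pi * lam * x)"
      unfolding cis_mult m by (simp add: distrib_left)
    ultimately show ?thesis by (simp only: prod.case mult.assoc [symmetric])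
  qed
  from descend_eq [of t x ?F, OF tx this] show ?thesis by (simp add: tilde_def)
qed

end

theory Submission
  imports Defs "HOL-Complex_Analysis.Cauchy_Integral_Formula"
begin

text \<open>
  By scaling, the integral against the radial weight over the ball of a function that is homogeneous of degree \<open>k\<close>
  in \<open>z\<close> and in its conjugate is a quotient of Gamma factors times its Gaussian integral.
  Applied to the homogeneous parts of a holomorphic function, this yields the reproducing kernel
  \<open>(1 - \<langle>z,w\<rangle>)\<^bsup>-\<lambda>\<^esup>\<close> of the weighted Bergman space from the reproducing property of
  \<open>e\<^bsup>\<langle>z,w\<rangle>\<^esup>\<close> in the Fock space, which is the mean value property in disguise. At the points
  \<open>t z\<^sub>0\<close> the kernel is \<open>\<phi>(t/s)\<close>, so \<open>R R\<^sup>*\<close> is convolution with \<open>\<phi>\<close>, a Fourier multiplier with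
  coefficients \<open>c\<^sub>\<alpha> \<ge> 0\<close> given by the binomial series. If \<open>S\<close> is any positive operator with
  \<open>S\<^sup>2 = R R\<^sup>*\<close>, then \<open>S\<^sup>2 v = c v\<close> forces \<open>S v = \<surd>c v\<close>, so \<open>S\<close> is the multiplier with
  coefficients \<open>\<surd>c\<^sub>\<alpha>\<close>. Functions in the range of \<open>R\<close> have frequencies in the positive cone only;
  conversely the monomials of the cone are restrictions of holomorphic monomials, and trigonometric
  polynomials are dense.
\<close>

section \<open>Lebesgue measure and homogeneous functions\<close>

text \<open>The adjoint and the square root are Hilbert choices (\<open>SOME\<close>), and vectors
  are functions rather than classes. So every claim about the two must follow from the defining
  property alone, which first has to be shown satisfiable: \<open>kernel_integral\<close> and
  \<open>sqrt_op\<close> are the witnesses. The formula for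
  \<open>restr lam (restr_adj lam f)\<close> nevertheless holds at every point of
  \<open>Etilde\<close>, because any adjoint has holomorphic values, and these are determined
  pointwise by the reproducing formula. The route to that formula avoids polar coordinates,
  orthonormal bases and power series in several variables: restriction to complex lines yields the
  homogeneous parts, and one translation of the Gaussian yields all moments. The position of z_0
  makes the rest uniform. Its orbit lies on the sphere of radius sqrt (1/2), so 1 - <z,w> keeps real
  part at least 1 - sqrt (1/2) for z in the ball and w on the orbit: off the branch cut, with a
  bounded kernel. Even after dilation by 3/2 the base of \<phi> stays away from 0, so the
  coefficients decay geometrically, and so do their square roots: \<omega> can be taken to be an
  absolutely convergent Fourier series.\<close>

lemma nn_integral_lborel_translate:
  fixes g :: "'a::euclidean_space \<Rightarrow> ennreal"
  assumes [measurable]: "g \<in> borel_measurable borel"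
  shows "(\<integral>\<^sup>+x. g (c + x) \<partial>lborel) = (\<integral>\<^sup>+x. g x \<partial>lborel)"
  by (subst (2) lborel_distr_plus [of c, symmetric]) (simp add: nn_integral_distr)

lemma nn_integral_lborel_scale:
  fixes g :: "'a::euclidean_space \<Rightarrow> ennreal"
  assumes [measurable]: "g \<in> borel_measurable borel" and "c > 0"
  shows "(\<integral>\<^sup>+x. g x \<partial>lborel) = ennreal (c ^ DIM('a)) * (\<integral>\<^sup>+x. g (c *\<^sub>R x) \<partial>lborel)"
  using \<open>c > 0\<close>
  by (subst lborel_affine [of c 0])
     (simp_all add: nn_integral_density nn_integral_distr nn_integral_cmult)

lemma nn_integral_cmult_lborel_scale:
  fixes g :: "'a::euclidean_space \<Rightarrow> ennreal"
  assumes [measurable]: "g \<in> borel_measurable borel" and c: "c > 0"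
  shows "e * (\<integral>\<^sup>+x. g x \<partial>lborel) = (\<integral>\<^sup>+x. (e * ennreal (c ^ DIM('a))) * g (c *\<^sub>R x) \<partial>lborel)"
  by (subst nn_integral_lborel_scale [OF _ c]) (simp_all add: nn_integral_cmult mult.assoc)

text \<open>
  The unit ball \<open>B\<close> is preserved by \<open>T\<close>, so both sides, multiplied by the volume of \<open>B\<close>, are
  obtained from the integral of \<open>1\<^sub>B(x) g(T y)\<close> over all pairs \<open>(x, y)\<close> by translations.
\<close>

lemma nn_integral_lborel_orthogonal:
  fixes g :: "'a::euclidean_space \<Rightarrow> ennreal" and T :: "'a \<Rightarrow> 'a"
  assumes T: "orthogonal_transformation T" and [measurable]: "g \<in> borel_measurable borel"
  shows "(\<integral>\<^sup>+x. g (T x) \<partial>lborel) = (\<integral>\<^sup>+x. g x \<partial>lborel)"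
proof -
  let ?B = "ball (0::'a) 1"
  let ?V = "emeasure lborel ?B"
  have [measurable]: "?B \<in> sets borel" by simp
  have lin: "linear T" and nT: "norm (T x) = norm x" for x
    using T by (auto simp: orthogonal_transformation)
  have "continuous_on UNIV T"
    using lin by (simp add: linear_conv_bounded_linear linear_continuous_on)
  then have [measurable]: "T \<in> borel_measurable borel" by (rule borel_measurable_continuous_onI)
  obtain T' where TT': "T (T' x) = x" for x
    using orthogonal_transformation_surj [OF T] by (metis surj_f_inv_f)
  have "?V * (\<integral>\<^sup>+y. g (T y) \<partial>lborel) = (\<integral>\<^sup>+x. \<integral>\<^sup>+y. indicator ?B x * g (T y) \<partial>lborel \<partial>lborel)"
  proof -
    have "(\<integral>\<^sup>+x. indicator ?B x * (\<integral>\<^sup>+y. g (T y) \<partial>lborel) \<partial>lborel) =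
        (\<integral>\<^sup>+x. indicator ?B x \<partial>lborel) * (\<integral>\<^sup>+y. g (T y) \<partial>lborel)"
      by (rule nn_integral_multc) measurable
    also have "(\<integral>\<^sup>+x. indicator ?B x \<partial>lborel) = ?V" by (rule nn_integral_indicator) simp
    finally have "?V * (\<integral>\<^sup>+y. g (T y) \<partial>lborel) =
        (\<integral>\<^sup>+x. indicator ?B x * (\<integral>\<^sup>+y. g (T y) \<partial>lborel) \<partial>lborel)" ..
    also have "\<dots> = (\<integral>\<^sup>+x. \<integral>\<^sup>+y. indicator ?B x * g (T y) \<partial>lborel \<partial>lborel)"
      by (intro nn_integral_cong nn_integral_cmult [symmetric]) measurable
    finally show ?thesis .
  qed
  also have "\<dots> = (\<integral>\<^sup>+x. \<integral>\<^sup>+y. indicator ?B x * g (x + T y) \<partial>lborel \<partial>lborel)"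
  proof (rule nn_integral_cong)
    fix x
    have "(\<integral>\<^sup>+y. g (T y) \<partial>lborel) = (\<integral>\<^sup>+y. g (T (T' x + y)) \<partial>lborel)"
      by (subst nn_integral_lborel_translate) simp_all
    also have "\<dots> = (\<integral>\<^sup>+y. g (x + T y) \<partial>lborel)"
      by (simp add: linear_add [OF lin] TT')
    finally show "(\<integral>\<^sup>+y. indicator ?B x * g (T y) \<partial>lborel) = (\<integral>\<^sup>+y. indicator ?B x * g (x + T y) \<partial>lborel)"
      by (simp add: nn_integral_cmult)
  qed
  also have "\<dots> = (\<integral>\<^sup>+y. \<integral>\<^sup>+x. indicator ?B x * g (x + T y) \<partial>lborel \<partial>lborel)"
    by (rule lborel_pair.Fubini') measurable
  also have "\<dots> = (\<integral>\<^sup>+y. \<integral>\<^sup>+x. indicator ?B (x - T y) * g x \<partial>lborel \<partial>lborel)"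
  proof (rule nn_integral_cong)
    fix y
    show "(\<integral>\<^sup>+x. indicator ?B x * g (x + T y) \<partial>lborel) = (\<integral>\<^sup>+x. indicator ?B (x - T y) * g x \<partial>lborel)"
      by (subst nn_integral_lborel_translate [of "\<lambda>x. indicator ?B (x - T y) * g x" "T y", symmetric])
         (simp_all add: add.commute)
  qed
  also have "\<dots> = (\<integral>\<^sup>+x. \<integral>\<^sup>+y. indicator ?B (x - T y) * g x \<partial>lborel \<partial>lborel)"
    by (rule lborel_pair.Fubini') measurable
  also have "\<dots> = (\<integral>\<^sup>+x. ?V * g x \<partial>lborel)"
  proof (rule nn_integral_cong)
    fix x
    have "x - T y = - T (- T' x + y)" for y by (simp add: linear_add [OF lin] linear_neg [OF lin] linear_diff [OF lin] TT')
    then have "indicator ?B (x - T y) = (indicator ?B (- T' x + y) :: ennreal)" for y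
      by (simp add: indicator_def nT)
    then have "(\<integral>\<^sup>+y. indicator ?B (x - T y) * g x \<partial>lborel) =
        (\<integral>\<^sup>+y. indicator ?B (- T' x + y) * g x \<partial>lborel)" by simp
    also have "\<dots> = (\<integral>\<^sup>+y. indicator ?B y * g x \<partial>lborel)"
      by (subst nn_integral_lborel_translate) simp_all
    also have "\<dots> = ?V * g x" by (simp add: nn_integral_multc)
    finally show "(\<integral>\<^sup>+y. indicator ?B (x - T y) * g x \<partial>lborel) = ?V * g x" .
  qed
  also have "\<dots> = ?V * (\<integral>\<^sup>+x. g x \<partial>lborel)" by (simp add: nn_integral_cmult)
  finally have eq: "?V * (\<integral>\<^sup>+y. g (T y) \<partial>lborel) = ?V * (\<integral>\<^sup>+x. g x \<partial>lborel)" .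
  \<comment> \<open>Cancelling in \<open>ennreal\<close> requires the volume to be finite as well as
    nonzero.\<close>
  have fin: "?V < \<infinity>" by (rule emeasure_lborel_ball_finite)
  have "measure lborel ?B > 0" by (rule content_ball_pos) simp
  then have pos: "?V \<noteq> 0" by (auto simp: measure_def)
  show ?thesis using eq fin pos by (auto simp: ennreal_mult_cancel_left)
qed

lemma lborel_distr_orthogonal:
  assumes T: "orthogonal_transformation (T :: 'a::euclidean_space \<Rightarrow> 'a)"
  shows "distr lborel borel T = lborel"
proof (rule measure_eqI)
  have "continuous_on UNIV T"
    using orthogonal_transformation_linear [OF T]
    by (simp add: linear_conv_bounded_linear linear_continuous_on)
  then have [measurable]: "T \<in> borel_measurable borel" by (rule borel_measurable_continuous_onI)
  fix A assume "A \<in> sets (distr lborel borel T)"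
  then have [measurable]: "A \<in> sets borel" by simp
  have "emeasure (distr lborel borel T) A = (\<integral>\<^sup>+x. indicator A (T x) \<partial>lborel)"
    by (subst nn_integral_distr [of T lborel borel "indicator A", symmetric]) simp_all
  also have "\<dots> = emeasure lborel A"
    by (subst nn_integral_lborel_orthogonal [OF T]) simp_all
  finally show "emeasure (distr lborel borel T) A = emeasure lborel A" .
qed simp

lemma norm_smult_vec: "norm (c *s (z :: complex^'n)) = cmod c * norm z"
  by (simp add: norm_vec_def L2_set_def norm_mult power_mult_distrib sum_distrib_left [symmetric]
      real_sqrt_mult)

lemma orthogonal_transformation_smult:
  assumes "cmod c = 1"
  shows "orthogonal_transformation (\<lambda>z :: complex^'n. c *s z)"
  unfolding orthogonal_transformation using assms
  by (auto simp: norm_smult_vec intro!: linearI simp: vec_eq_iff algebra_simps)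

text \<open>Substitute \<open>z = u/\<surd>s\<close> under the integral defining the left Gamma factor.\<close>

lemma nn_integral_homogeneous_ball:
  fixes h :: "complex^'n \<Rightarrow> real"
  assumes [measurable]: "h \<in> borel_measurable borel" and a: "a > 0"
    and hom: "\<And>r z. r > 0 \<Longrightarrow> h (r *\<^sub>R z) = r ^ (2 * k) * h z"
  shows "ennreal (Gamma (a + real CARD('n) + real k)) *
      (\<integral>\<^sup>+z. ennreal (h z * (1 - (norm z)\<^sup>2) powr (a - 1)) * indicator (ball 0 1) z \<partial>lborel) =
    ennreal (Gamma a) * (\<integral>\<^sup>+z. ennreal (h z * exp (- (norm z)\<^sup>2)) \<partial>lborel)"
proof -
  let ?n = "real CARD('n)"
  define m where "m = a + ?n + real k"
  have [measurable]: "ball (0::complex^'n) 1 \<in> sets borel" by simp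
  have DIMc: "DIM(complex^'n) = 2 * CARD('n)" by simp
  have m: "m > 0" using a by (simp add: m_def add_pos_nonneg)
  have gam: "ennreal (Gamma c) = (\<integral>\<^sup>+s. ennreal (s powr (c - 1) * exp (- s)) * indicator {0<..} s \<partial>lborel)"
    if "c > 0" for c :: real
  proof -
    have "ennreal (indicator {0..} s * s powr (c - 1) / exp s) =
        ennreal (s powr (c - 1) * exp (- s)) * indicator {0<..} s" for s
      by (cases "s = 0") (auto simp: indicator_def exp_minus divide_inverse)
    then show ?thesis using Gamma_conv_nn_integral_real [OF that] by simp
  qed
  let ?W = "\<lambda>z::complex^'n. ennreal (h z * (1 - (norm z)\<^sup>2) powr (a - 1)) * indicator (ball 0 1) z"
  let ?E = "\<lambda>s::real. ennreal (s powr (m - 1) * exp (- s)) * indicator {0<..} s"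
  let ?F = "\<lambda>s::real. \<lambda>u::complex^'n. ennreal (h u) * (ennreal ((s - (norm u)\<^sup>2) powr (a - 1) * exp (- s)) *
        indicator {0<..} (s - (norm u)\<^sup>2))"
  have W: "?W \<in> borel_measurable borel" by measurable
  have "ennreal (Gamma m) * (\<integral>\<^sup>+z. ?W z \<partial>lborel) = (\<integral>\<^sup>+s. ?E s * (\<integral>\<^sup>+z. ?W z \<partial>lborel) \<partial>lborel)"
    unfolding gam [OF m] by (rule nn_integral_multc [symmetric]) measurable
  also have "\<dots> = (\<integral>\<^sup>+s. \<integral>\<^sup>+u. ?F s u \<partial>lborel \<partial>lborel)"
  proof (rule nn_integral_cong)
    fix s :: real
    show "?E s * (\<integral>\<^sup>+z. ?W z \<partial>lborel) = (\<integral>\<^sup>+u. ?F s u \<partial>lborel)"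
    proof (cases "s > 0")
      case False
      then have "\<not> s - (norm u)\<^sup>2 > 0" for u :: "complex^'n"
        using zero_le_power2 [of "norm u"] by linarith
      then have "?F s u = 0" for u by simp
      then have "(\<integral>\<^sup>+u. ?F s u \<partial>lborel) = 0" by (simp only: nn_integral_const mult_zero_left)
      then show ?thesis using False by simp
    next
      case True
      \<comment> \<open>The dilation contributes c^(2n) = s^(-n), the real dimension being 2n, and
        the homogeneity of \<open>h\<close> contributes c^(2k) = s^(-k).\<close>
      define c where "c = s powr (-1/2)"
      have c: "c > 0" using True by (simp add: c_def)
      have c2: "c\<^sup>2 = 1 / s" using True
        by (simp add: c_def powr_minus_divide power_divide powr_half_sqrt)
      have ceq: "c ^ (2 * j) = s powr (- real j)" for j
        using True by (simp add: power_mult c2 power_divide powr_minus_divide powr_realpow)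
      have "?E s * (\<integral>\<^sup>+z. ?W z \<partial>lborel) =
          (\<integral>\<^sup>+u. (?E s * ennreal (c ^ (2 * CARD('n)))) * ?W (c *\<^sub>R u) \<partial>lborel)"
        by (rule nn_integral_cmult_lborel_scale [OF W c, unfolded DIMc])
      also have "\<dots> = (\<integral>\<^sup>+u. ?F s u \<partial>lborel)"
      proof (rule nn_integral_cong)
        fix u :: "complex^'n"
        have nc: "(norm (c *\<^sub>R u))\<^sup>2 = (norm u)\<^sup>2 / s"
          using c2 by (simp add: power_mult_distrib)
        have ball: "c *\<^sub>R u \<in> ball 0 1 \<longleftrightarrow> s - (norm u)\<^sup>2 > 0"
        proof -
          have "c *\<^sub>R u \<in> ball 0 1 \<longleftrightarrow> (norm (c *\<^sub>R u))\<^sup>2 < 1"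
            by (simp only: mem_ball_0 abs_square_less_1 abs_norm_cancel)
          then show ?thesis unfolding nc using True by (simp add: divide_less_eq)
        qed
        show "?E s * ennreal (c ^ (2 * CARD('n))) * ?W (c *\<^sub>R u) = ?F s u"
        proof (cases "s - (norm u)\<^sup>2 > 0")
          case False
          then show ?thesis using ball by (simp add: indicator_def)
        next
          case pos: True
          have "(1 - (norm u)\<^sup>2 / s) = (s - (norm u)\<^sup>2) / s" using True by (simp add: field_simps)
          then have w: "(1 - (norm u)\<^sup>2 / s) powr (a - 1) = (s - (norm u)\<^sup>2) powr (a - 1) * s powr (1 - a)"
            using True pos by (simp add: powr_divide powr_minus_divide [of s "a - 1", simplified])
          \<comment> \<open>The exponents (m - 1) - n - k + (1 - a) add up to 0, which dictates m =
            a + n + k.\<close>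
          have p: "s powr (m - 1) * s powr (- ?n) * s powr (- real k) * s powr (1 - a) = 1"
            using True by (simp add: powr_add [symmetric] m_def)
          have "?E s * ennreal (c ^ (2 * CARD('n))) * ?W (c *\<^sub>R u) =
            ennreal (s powr (m - 1) * exp (- s)) * ennreal (s powr (- ?n)) *
              ennreal (s powr (- real k) * h u * ((s - (norm u)\<^sup>2) powr (a - 1) * s powr (1 - a)))"
            using True pos ball nc w hom [OF c, of u] ceq by (simp add: indicator_def)
          also have "\<dots> = ennreal (s powr (m - 1) * exp (- s) * s powr (- ?n) *
              (s powr (- real k) * h u * ((s - (norm u)\<^sup>2) powr (a - 1) * s powr (1 - a))))"
            by (simp add: ennreal_mult' [symmetric] mult_nonneg_nonneg)
          also have "s powr (m - 1) * exp (- s) * s powr (- ?n) *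
              (s powr (- real k) * h u * ((s - (norm u)\<^sup>2) powr (a - 1) * s powr (1 - a))) =
              (s powr (m - 1) * s powr (- ?n) * s powr (- real k) * s powr (1 - a)) *
              (((s - (norm u)\<^sup>2) powr (a - 1) * exp (- s)) * h u)"
            by (simp only: mult_ac)
          also have "ennreal \<dots> = ?F s u"
          proof -
            have X: "(s - (norm u)\<^sup>2) powr (a - 1) * exp (- s) \<ge> 0" by simp
            have "indicator {0<..} (s - (norm u)\<^sup>2) = (1::ennreal)" using pos by simp
            then show ?thesis unfolding p mult_1_left ennreal_mult' [OF X]
              by (simp only: mult_1_left mult_1_right mult.commute)
          qed
          finally show ?thesis .
        qed
      qed
      finally show ?thesis .
    qed
  qed
  also have "\<dots> = (\<integral>\<^sup>+u. \<integral>\<^sup>+s. ?F s u \<partial>lborel \<partial>lborel)"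
    by (rule lborel_pair.Fubini') measurable
  also have "\<dots> = (\<integral>\<^sup>+u. ennreal (Gamma a) * ennreal (h u * exp (- (norm u)\<^sup>2)) \<partial>lborel)"
  proof (rule nn_integral_cong)
    fix u :: "complex^'n"
    let ?q = "(norm u)\<^sup>2"
    \<comment> \<open>Shifting s by |u|^2 splits e^(-s) into the Gaussian in \<open>u\<close> and
      the integrand of Gamma(a).\<close>
    have "(\<integral>\<^sup>+s. ?F s u \<partial>lborel) = (\<integral>\<^sup>+s. ?F (?q + s) u \<partial>lborel)"
      by (rule nn_integral_lborel_translate [symmetric]) measurable
    also have "\<dots> = (\<integral>\<^sup>+s. ennreal (h u) * ennreal (exp (- ?q)) *
        (ennreal (s powr (a - 1) * exp (- s)) * indicator {0<..} s) \<partial>lborel)"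
    proof (rule nn_integral_cong)
      fix s
      have "s powr (a - 1) * exp (- (?q + s)) = exp (- ?q) * (s powr (a - 1) * exp (- s))"
        unfolding minus_add_distrib exp_add by (simp only: mult_ac)
      then have "ennreal (s powr (a - 1) * exp (- (?q + s))) =
          ennreal (exp (- ?q)) * ennreal (s powr (a - 1) * exp (- s))"
        by (simp only: ennreal_mult' exp_ge_zero)
      then show "?F (?q + s) u = ennreal (h u) * ennreal (exp (- ?q)) *
        (ennreal (s powr (a - 1) * exp (- s)) * indicator {0<..} s)"
        by (simp only: add_diff_cancel_left' mult.assoc)
    qed
    also have "\<dots> = ennreal (h u) * ennreal (exp (- ?q)) * ennreal (Gamma a)"
      unfolding gam [OF a] by (rule nn_integral_cmult) measurable
    also have "\<dots> = ennreal (Gamma a) * ennreal (h u * exp (- ?q))"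
      by (subst ennreal_mult'') (auto simp: mult_ac)
    finally show "(\<integral>\<^sup>+s. ?F s u \<partial>lborel) = ennreal (Gamma a) * ennreal (h u * exp (- ?q))" .
  qed
  also have "\<dots> = ennreal (Gamma a) * (\<integral>\<^sup>+u. ennreal (h u * exp (- (norm u)\<^sup>2)) \<partial>lborel)"
    by (rule nn_integral_cmult) measurable
  finally show ?thesis by (simp only: m_def)
qed

text \<open>The scaling identity is used twice. At exponent 1 the weight is constant on the ball and
  the weighted integral is at most its volume, so the Gaussian moment \<open>J\<close> is finite; at
  exponent \<open>a\<close> the finiteness of \<open>J\<close> passes back to the weighted
  integral.\<close>

lemma integrable_norm_power_ball:
  assumes a: "a > 0"
  shows "integrable lborel (\<lambda>z::complex^'n. norm z ^ (2 * k) * (1 - (norm z)\<^sup>2) powr (a - 1) *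
      indicator (ball 0 1) z)"
    and "integrable lborel (\<lambda>z::complex^'n. norm z ^ (2 * k) * exp (- (norm z)\<^sup>2))"
proof -
  let ?n = "real CARD('n)"
  have [measurable]: "ball (0::complex^'n) 1 \<in> sets borel" by simp
  define J where "J = (\<integral>\<^sup>+z. ennreal (norm (z::complex^'n) ^ (2 * k) * exp (- (norm z)\<^sup>2)) \<partial>lborel)"
  have eq: "ennreal (Gamma (c + ?n + real k)) *
      (\<integral>\<^sup>+z. ennreal (norm (z::complex^'n) ^ (2 * k) * (1 - (norm z)\<^sup>2) powr (c - 1)) *
        indicator (ball 0 1) z \<partial>lborel) = ennreal (Gamma c) * J" if "c > 0" for c
    unfolding J_def by (rule nn_integral_homogeneous_ball [OF _ that]) (auto simp: power_mult_distrib)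
  have "(\<integral>\<^sup>+z. ennreal (norm (z::complex^'n) ^ (2 * k) * (1 - (norm z)\<^sup>2) powr (1 - 1)) *
        indicator (ball 0 1) z \<partial>lborel) \<le> (\<integral>\<^sup>+z. indicator (ball 0 1) (z::complex^'n) \<partial>lborel)"
    by (intro nn_integral_mono) (auto simp: indicator_def power_le_one)
  also have "\<dots> < \<infinity>" using emeasure_lborel_ball_finite [of "0::complex^'n" 1] by simp
  finally have fin: "(\<integral>\<^sup>+z. ennreal (norm (z::complex^'n) ^ (2 * k) * (1 - (norm z)\<^sup>2) powr (1 - 1)) *
        indicator (ball 0 1) z \<partial>lborel) < \<infinity>" .
  have "ennreal (Gamma (1 + ?n + real k)) * (\<integral>\<^sup>+z. ennreal (norm (z::complex^'n) ^ (2 * k) * (1 - (norm z)\<^sup>2) powr (1 - 1)) *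
        indicator (ball 0 1) z \<partial>lborel) < \<infinity>"
    using fin unfolding infinity_ennreal_def ennreal_mult_less_top by (intro disjI2 conjI) (auto simp del: powr_zero_eq_one)
  then have "J < \<infinity>"
    unfolding eq [OF zero_less_one] by simp
  then show "integrable lborel (\<lambda>z::complex^'n. norm z ^ (2 * k) * exp (- (norm z)\<^sup>2))"
    unfolding J_def by (intro integrableI_bounded) auto
  have "Gamma (a + ?n + real k) > 0" using a by (intro Gamma_real_pos) (simp add: add_pos_nonneg)
  then have "(\<integral>\<^sup>+z. ennreal (norm (z::complex^'n) ^ (2 * k) * (1 - (norm z)\<^sup>2) powr (a - 1)) *
        indicator (ball 0 1) z \<partial>lborel) < \<infinity>"
  proof -
    have "ennreal (Gamma a) * J < top"
      using \<open>J < \<infinity>\<close> unfolding infinity_ennreal_def ennreal_mult_less_top by simp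
    moreover have "ennreal (Gamma (a + ?n + real k)) \<noteq> 0"
      using \<open>Gamma (a + ?n + real k) > 0\<close> by (metis ennreal_eq_0_iff not_le)
    ultimately show ?thesis
      unfolding eq [OF a, symmetric] infinity_ennreal_def ennreal_mult_less_top by auto
  qed
  moreover have "ennreal (norm (norm z ^ (2 * k) * (1 - (norm z)\<^sup>2) powr (a - 1) * indicator (ball 0 1) z)) =
      ennreal (norm z ^ (2 * k) * (1 - (norm z)\<^sup>2) powr (a - 1)) * indicator (ball 0 1) z"
    for z :: "complex^'n" by (simp add: indicator_def)
  ultimately show "integrable lborel (\<lambda>z::complex^'n. norm z ^ (2 * k) * (1 - (norm z)\<^sup>2) powr (a - 1) *
      indicator (ball 0 1) z)"
    by (intro integrableI_bounded) auto
qed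

text \<open>\<open>ennreal\<close> cuts negative values off to 0, so the nonnegative identity for
  \<open>h\<close> handles its positive part and the one for \<open>- h\<close> its negative part;
  both functions are homogeneous of the same degree.\<close>

lemma integral_homogeneous_ball_real:
  fixes h :: "complex^'n \<Rightarrow> real"
  assumes [measurable]: "h \<in> borel_measurable borel" and a: "a > 0"
    and hom: "\<And>r z. r > 0 \<Longrightarrow> h (r *\<^sub>R z) = r ^ (2 * k) * h z"
    and bound: "\<And>z. \<bar>h z\<bar> \<le> C * norm z ^ (2 * k)"
  shows "integrable lborel (\<lambda>z. h z * exp (- (norm z)\<^sup>2))"
    and "integrable lborel (\<lambda>z. h z * ((1 - (norm z)\<^sup>2) powr (a - 1) * indicator (ball 0 1) z))"
    and "Gamma (a + real CARD('n) + real k) *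
        (LINT z|lborel. h z * ((1 - (norm z)\<^sup>2) powr (a - 1) * indicator (ball 0 1) z)) =
      Gamma a * (LINT z|lborel. h z * exp (- (norm z)\<^sup>2))"
proof -
  let ?n = "real CARD('n)"
  have [measurable]: "ball (0::complex^'n) 1 \<in> sets borel" by simp
  have bnd: "\<bar>h z\<bar> \<le> \<bar>C\<bar> * norm z ^ (2 * k)" for z
    using bound [of z] by (smt (verit) mult_right_mono zero_le_power norm_ge_zero)
  show i1: "integrable lborel (\<lambda>z. h z * exp (- (norm z)\<^sup>2))"
    by (rule Bochner_Integration.integrable_bound [OF integrable_mult_right [of C, OF integrable_norm_power_ball(2) [OF a, where k = k]]])
       (use bnd in \<open>auto simp: abs_mult mult.assoc [symmetric] intro!: mult_right_mono AE_I2\<close>)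
  let ?w = "\<lambda>z::complex^'n. (1 - (norm z)\<^sup>2) powr (a - 1) * indicator (ball 0 1) z"
  show i2: "integrable lborel (\<lambda>z. h z * ?w z)"
    by (rule Bochner_Integration.integrable_bound [OF integrable_mult_right [of C, OF integrable_norm_power_ball(1) [OF a, where k = k]]])
       (use bnd in \<open>auto simp: abs_mult mult.assoc [symmetric] intro!: mult_right_mono AE_I2\<close>)
  have G: "Gamma (a + ?n + real k) > 0" "Gamma a > 0"
    using a by (auto intro!: Gamma_real_pos simp: add_pos_nonneg)
  have nn: "Gamma (a + ?n + real k) * enn2real (\<integral>\<^sup>+z. ennreal (g z * ?w z) \<partial>lborel) =
      Gamma a * enn2real (\<integral>\<^sup>+z. ennreal (g z * exp (- (norm z)\<^sup>2)) \<partial>lborel)"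
    if [measurable]: "g \<in> borel_measurable borel" and g: "\<And>r z. r > 0 \<Longrightarrow> g (r *\<^sub>R z) = r ^ (2 * k) * g z" for g
  proof -
    have "ennreal (g z * ?w z) = ennreal (g z * (1 - (norm z)\<^sup>2) powr (a - 1)) * indicator (ball 0 1) z" for z
      by (simp add: indicator_def)
    then have "ennreal (Gamma (a + ?n + real k)) * (\<integral>\<^sup>+z. ennreal (g z * ?w z) \<partial>lborel) =
        ennreal (Gamma a) * (\<integral>\<^sup>+z. ennreal (g z * exp (- (norm z)\<^sup>2)) \<partial>lborel)"
      using nn_integral_homogeneous_ball [OF that(1) a g] by simp
    from arg_cong [OF this, of enn2real] show ?thesis
      using G by (simp add: enn2real_mult)
  qed
  have "Gamma (a + ?n + real k) * enn2real (\<integral>\<^sup>+z. ennreal (- h z * ?w z) \<partial>lborel) =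
      Gamma a * enn2real (\<integral>\<^sup>+z. ennreal (- h z * exp (- (norm z)\<^sup>2)) \<partial>lborel)"
    by (rule nn) (auto simp: hom)
  with nn [of h, OF _ hom] show "Gamma (a + ?n + real k) * (LINT z|lborel. h z * ?w z) =
      Gamma a * (LINT z|lborel. h z * exp (- (norm z)\<^sup>2))"
    unfolding real_lebesgue_integral_def [OF i1] real_lebesgue_integral_def [OF i2]
    by (simp add: right_diff_distrib)
qed

lemma integral_homogeneous_ball:
  fixes h :: "complex^'n \<Rightarrow> complex"
  assumes [measurable]: "h \<in> borel_measurable borel" and a: "a > 0"
    and hom: "\<And>r z. r > 0 \<Longrightarrow> h (r *\<^sub>R z) = of_real (r ^ (2 * k)) * h z"
    and bound: "\<And>z. cmod (h z) \<le> C * norm z ^ (2 * k)"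
  shows "integrable lborel (\<lambda>z. h z * of_real (exp (- (norm z)\<^sup>2)))"
    and "integrable lborel (\<lambda>z. h z * of_real ((1 - (norm z)\<^sup>2) powr (a - 1) * indicator (ball 0 1) z))"
    and "of_real (Gamma (a + real CARD('n) + real k)) *
        (LINT z|lborel. h z * of_real ((1 - (norm z)\<^sup>2) powr (a - 1) * indicator (ball 0 1) z)) =
      of_real (Gamma a) * (LINT z|lborel. h z * of_real (exp (- (norm z)\<^sup>2)))"
proof -
  let ?w = "\<lambda>z::complex^'n. (1 - (norm z)\<^sup>2) powr (a - 1) * indicator (ball 0 1) z"
  have re: "r > 0 \<Longrightarrow> Re (h (r *\<^sub>R z)) = r ^ (2 * k) * Re (h z)"
    and im: "r > 0 \<Longrightarrow> Im (h (r *\<^sub>R z)) = r ^ (2 * k) * Im (h z)" for r z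
    by (simp_all add: hom del: of_real_power)
  have bre: "\<bar>Re (h z)\<bar> \<le> C * norm z ^ (2 * k)" and bim: "\<bar>Im (h z)\<bar> \<le> C * norm z ^ (2 * k)" for z
    using bound [of z] abs_Re_le_cmod [of "h z"] abs_Im_le_cmod [of "h z"] by linarith+
  have [measurable]: "(\<lambda>z. Re (h z)) \<in> borel_measurable borel" "(\<lambda>z. Im (h z)) \<in> borel_measurable borel"
    by measurable
  note R = integral_homogeneous_ball_real [of "\<lambda>z. Re (h z)", OF _ a re bre, simplified]
  note I = integral_homogeneous_ball_real [of "\<lambda>z. Im (h z)", OF _ a im bim, simplified]
  have dec: "h z * of_real x = of_real (Re (h z) * x) + \<i> * of_real (Im (h z) * x)" for z x
    by (simp add: complex_eq_iff)
  show "integrable lborel (\<lambda>z. h z * of_real (exp (- (norm z)\<^sup>2)))"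
    unfolding dec using R(1) I(1) by (intro Bochner_Integration.integrable_add integrable_mult_right integrable_of_real) auto
  show "integrable lborel (\<lambda>z. h z * of_real (?w z))"
    unfolding dec using R(2) I(2) by (intro Bochner_Integration.integrable_add integrable_mult_right integrable_of_real) auto
  have "(LINT z|lborel. h z * of_real (?w z)) = of_real (LINT z|lborel. Re (h z) * ?w z) + \<i> * of_real (LINT z|lborel. Im (h z) * ?w z)"
    unfolding dec using R(2) I(2)
    by (subst Bochner_Integration.integral_add) (auto simp del: of_real_mult)
  moreover have "(LINT z|lborel. h z * of_real (exp (- (norm z)\<^sup>2))) = of_real (LINT z|lborel. Re (h z) * exp (- (norm z)\<^sup>2)) + \<i> * of_real (LINT z|lborel. Im (h z) * exp (- (norm z)\<^sup>2))"
    unfolding dec using R(1) I(1)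
    by (subst Bochner_Integration.integral_add) (auto simp del: of_real_mult)
  ultimately show "of_real (Gamma (a + real CARD('n) + real k)) * (LINT z|lborel. h z * of_real (?w z)) =
      of_real (Gamma a) * (LINT z|lborel. h z * of_real (exp (- (norm z)\<^sup>2)))"
    using R(3) I(3)
    by (simp add: complex_eq_iff)
qed

text \<open>Completing the square gives c |z| - |z|^2 <= c^2/2 - |z|^2/2, and the remaining half
  Gaussian is the full one rescaled by sqrt 2.\<close>

lemma integrable_exp_norm_gauss:
  "integrable lborel (\<lambda>z::complex^'n. exp (c * norm z) * exp (- (norm z)\<^sup>2))"
proof -
  have fin: "(\<integral>\<^sup>+z. ennreal (exp (- (norm (z::complex^'n))\<^sup>2)) \<partial>lborel) < \<infinity>"
    using integrable_norm_power_ball(2) [of 1 0, where 'n='n] by (simp add: integrable_iff_bounded)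
  have "(\<integral>\<^sup>+z. ennreal (exp (- (norm (z::complex^'n))\<^sup>2 / 2)) \<partial>lborel) =
      ennreal (sqrt 2 ^ DIM(complex^'n)) * (\<integral>\<^sup>+z. ennreal (exp (- (norm (sqrt 2 *\<^sub>R (z::complex^'n)))\<^sup>2 / 2)) \<partial>lborel)"
    by (rule nn_integral_lborel_scale) auto
  also have "\<dots> = ennreal (sqrt 2 ^ DIM(complex^'n)) * (\<integral>\<^sup>+z. ennreal (exp (- (norm (z::complex^'n))\<^sup>2)) \<partial>lborel)"
    by (simp add: power_mult_distrib)
  also have "\<dots> < \<infinity>" using fin by (simp add: ennreal_mult_less_top)
  finally have "integrable lborel (\<lambda>z::complex^'n. exp (- (norm z)\<^sup>2 / 2))"
    by (intro integrableI_bounded) auto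
  then have "integrable lborel (\<lambda>z::complex^'n. exp (c\<^sup>2 / 2) * exp (- (norm z)\<^sup>2 / 2))"
    by (rule integrable_mult_right)
  then show ?thesis
  proof (rule Bochner_Integration.integrable_bound)
    show "AE z::complex^'n in lborel. norm (exp (c * norm z) * exp (- (norm z)\<^sup>2)) \<le>
        norm (exp (c\<^sup>2 / 2) * exp (- (norm z)\<^sup>2 / 2))"
    proof (rule AE_I2)
      fix z :: "complex^'n"
      have "(c - norm z)\<^sup>2 \<ge> 0" by simp
      then have "c * norm z - (norm z)\<^sup>2 \<le> c\<^sup>2 / 2 - (norm z)\<^sup>2 / 2" by (simp add: power2_diff)
      then show "norm (exp (c * norm z) * exp (- (norm z)\<^sup>2)) \<le> norm (exp (c\<^sup>2 / 2) * exp (- (norm z)\<^sup>2 / 2))"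
        by (simp add: exp_add [symmetric])
    qed
  qed measurable
qed

lemma
  fixes g :: "'a::euclidean_space \<Rightarrow> complex" and T :: "'a \<Rightarrow> 'a"
  assumes T: "orthogonal_transformation T" and g: "integrable lborel g"
  shows integrable_lborel_orthogonal: "integrable lborel (\<lambda>z. g (T z))"
    and integral_lborel_orthogonal: "(LINT z|lborel. g (T z)) = (LINT z|lborel. g z)"
proof -
  have "continuous_on UNIV T"
    using orthogonal_transformation_linear [OF T]
    by (simp add: linear_conv_bounded_linear linear_continuous_on)
  then have [measurable]: "T \<in> borel_measurable borel" by (rule borel_measurable_continuous_onI)
  have [measurable]: "g \<in> borel_measurable borel" using g by (auto dest: borel_measurable_integrable)
  show "integrable lborel (\<lambda>z. g (T z))"
    using g integrable_distr_eq [of T lborel borel g] by (simp add: lborel_distr_orthogonal [OF T])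
  show "(LINT z|lborel. g (T z)) = (LINT z|lborel. g z)"
    using integral_distr [of T lborel borel g] by (simp add: lborel_distr_orthogonal [OF T])
qed

section \<open>Averages over the circle\<close>

text \<open>As a finite measure of mass 1 it enters Fubini together with \<open>lborel\<close>, and
  integrating along \<open>cis (2 * pi * x)\<close> gives circle averages without a normalising
  factor.\<close>

definition unit_interval :: "real measure" where
  "unit_interval = density lborel (indicator {0..1})"

lemma sets_unit_interval [measurable_cong, simp]: "sets unit_interval = sets borel"
  and space_unit_interval [simp]: "space unit_interval = UNIV"
  by (simp_all add: unit_interval_def)

lemma emeasure_unit_interval_space [simp]: "emeasure unit_interval UNIV = 1"
  by (simp add: unit_interval_def emeasure_density)

interpretation unit_interval: finite_measure unit_interval
  by standard simp

interpretation unit_interval_lborel: pair_sigma_finite unit_interval "lborel :: 'a::euclidean_space measure"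
  by standard

interpretation unit_interval2: pair_sigma_finite unit_interval unit_interval
  by standard

lemma integral_unit_interval:
  fixes g :: "real \<Rightarrow> complex"
  assumes "continuous_on UNIV g"
  shows "(LINT x|unit_interval. g x) = integral {0..1} g"
proof -
  have [measurable]: "g \<in> borel_measurable borel" using assms by (rule borel_measurable_continuous_onI)
  have "(LINT x|unit_interval. g x) = (LINT x:{0..1}|lborel. g x)"
    unfolding unit_interval_def set_lebesgue_integral_def ennreal_indicator [symmetric]
    by (subst integral_density) auto
  also have "\<dots> = integral {0..1} g"
    by (rule set_borel_integral_eq_integral)
       (use assms in \<open>auto intro!: borel_integrable_atLeastAtMost' intro: continuous_on_subset\<close>)
  finally show ?thesis .
qed

text \<open>Each rotation is orthogonal and preserves the integral, so averaging over the angle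
  changes nothing; Fubini then moves the average inside, where mean value arguments can act on the
  integrand.\<close>

lemma integral_rotation_average:
  fixes g :: "complex^'n \<Rightarrow> complex"
  assumes g: "integrable lborel g"
  shows "(LINT z|lborel. g z) = (LINT z|lborel. LINT x|unit_interval. g (cis (2 * pi * x) *s z))"
proof -
  have [measurable]: "g \<in> borel_measurable borel" using g by (auto dest: borel_measurable_integrable)
  have T: "orthogonal_transformation (\<lambda>z::complex^'n. cis t *s z)" for t
    by (rule orthogonal_transformation_smult) simp
  have "continuous_on UNIV (\<lambda>(x, z::complex^'n). cis (2 * pi * x) *s z)"
    unfolding case_prod_beta vector_scalar_mult_def
    by (intro continuous_intros continuous_on_vec_lambda)
  then have "(\<lambda>(x, z::complex^'n). cis (2 * pi * x) *s z) \<in> borel_measurable (borel \<Otimes>\<^sub>M borel)"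
    unfolding borel_prod by (rule borel_measurable_continuous_onI)
  from measurable_compose [OF this, of g borel]
  have mg: "(\<lambda>(x, z). g (cis (2 * pi * x) *s z)) \<in> borel_measurable (borel \<Otimes>\<^sub>M borel)"
    by (simp add: case_prod_beta')
  have "integrable (unit_interval \<Otimes>\<^sub>M lborel) (\<lambda>(x, z). g (cis (2 * pi * x) *s z))"
  proof (rule unit_interval_lborel.Fubini_integrable)
    show "integrable unit_interval (\<lambda>x. LINT z|lborel. norm (case (x, z) of (x, z) \<Rightarrow> g (cis (2 * pi * x) *s z)))"
      using integral_lborel_orthogonal [OF T, of "\<lambda>z. of_real (cmod (g z))"] g by simp
  qed (use mg integrable_lborel_orthogonal [OF T g] in auto)
  from unit_interval_lborel.Fubini_integral [OF this]
  have "(LINT z|lborel. LINT x|unit_interval. g (cis (2 * pi * x) *s z)) =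
      (LINT x|unit_interval. LINT z|lborel. g (cis (2 * pi * x) *s z))" .
  also have "\<dots> = (LINT z|lborel. g z)"
    using integral_lborel_orthogonal [OF T g] by (simp add: measure_def)
  finally show ?thesis ..
qed

lemma continuous_on_circle:
  assumes "continuous_on (ball (0::complex) \<rho>) g" "\<rho> > 1"
  shows "continuous_on UNIV (\<lambda>x. g (cis (2 * pi * x)))"
  by (rule continuous_on_compose2 [OF assms(1)]) (use assms(2) in \<open>auto intro!: continuous_intros\<close>)

text \<open>Cauchy's formula for the k-th derivative: on the unit circle, division by z^(k+1)
  together with dz = 2 pi i z dx leaves the conjugate power as integrand.\<close>

lemma circle_coefficient:
  assumes g: "g holomorphic_on ball 0 \<rho>" and \<rho>: "\<rho> > 1"
  shows "(LINT x|unit_interval. g (cis (2 * pi * x)) * cnj (cis (2 * pi * x)) ^ k) =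
    (deriv ^^ k) g 0 / fact k"
proof -
  have "cball 0 1 \<subseteq> ball (0::complex) \<rho>" "ball 0 1 \<subseteq> ball (0::complex) \<rho>" using \<rho> by auto
  then have "continuous_on (cball 0 1) g" "g holomorphic_on ball 0 1"
    using g holomorphic_on_subset holomorphic_on_imp_continuous_on by blast+
  from Cauchy_has_contour_integral_higher_derivative_circlepath [OF this, of 0 k]
  have "((\<lambda>x. g (cis (2 * pi * x)) / cis (2 * pi * x) ^ Suc k * (2 * pi * \<i> * cis (2 * pi * x))) has_integral
      (2 * pi * \<i> / fact k * (deriv ^^ k) g 0)) {0..1}"
    unfolding has_contour_integral vector_derivative_circlepath unfolding circlepath
    by (simp add: cis_conv_exp mult_ac)
  moreover define c where "c = 2 * pi * \<i>"
  ultimately have c: "((\<lambda>x. c * (g (cis (2 * pi * x)) * cnj (cis (2 * pi * x)) ^ k)) has_integral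
      c * ((deriv ^^ k) g 0 / fact k)) {0..1}"
    by (simp add: cis_cnj field_simps cis_inverse [symmetric] del: cis_inverse)
  have "((\<lambda>x. g (cis (2 * pi * x)) * cnj (cis (2 * pi * x)) ^ k) has_integral
      (deriv ^^ k) g 0 / fact k) {0..1}"
  proof -
    have "c \<noteq> 0" by (simp add: c_def)
    then have "inverse c * (c * x) = x" for x by simp
    then show ?thesis
      using has_integral_mult_right [OF c, of "inverse c"] by (simp only:)
  qed
  moreover have "continuous_on UNIV (\<lambda>x. g (cis (2 * pi * x)) * cnj (cis (2 * pi * x)) ^ k)"
    by (intro continuous_intros continuous_on_circle [OF holomorphic_on_imp_continuous_on [OF g] \<rho>])
  ultimately show ?thesis
    by (simp add: integral_unit_interval integral_unique)
qed

lemma norm_integral_unit_interval_le: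
  fixes g :: "real \<Rightarrow> complex"
  assumes "M \<ge> 0" "\<And>x. cmod (g x) \<le> M"
  shows "cmod (LINT x|unit_interval. g x) \<le> M"
proof (cases "integrable unit_interval g")
  case True
  have "cmod (LINT x|unit_interval. g x) \<le> (LINT x|unit_interval. M)"
    by (rule Bochner_Integration.integral_norm_bound_integral) (use assms True in auto)
  then show ?thesis by (simp add: measure_def)
qed (simp add: not_integrable_integral_eq assms(1))

lemma circle_mean:
  assumes "g holomorphic_on ball 0 \<rho>" "\<rho> > 1"
  shows "(LINT x|unit_interval. g (cis (2 * pi * x))) = g 0"
  using circle_coefficient [OF assms, of 0] by simp

lemma higher_deriv_exp_mult: "(deriv ^^ k) (\<lambda>z. exp (a * z)) = (\<lambda>z. a ^ k * exp (a * z))"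
proof (induction k)
  case (Suc k)
  have "deriv (\<lambda>z. a ^ k * exp (a * z)) z = a ^ Suc k * exp (a * z)" for z
    by (rule DERIV_imp_deriv) (auto intro!: derivative_eq_intros)
  then show ?case by (simp add: Suc.IH fun_eq_iff)
qed simp

text \<open>The conjugate of the Taylor coefficient formula for exp (cnj a z): the factor e^(2 pi i
  k x) selects the k-th term of an exponential in e^(-2 pi i x).\<close>

lemma circle_coefficient_exp:
  "(LINT x|unit_interval. cis (2 * pi * x) ^ k * exp (cnj (cis (2 * pi * x)) * a)) = a ^ k / fact k"
proof -
  have "(LINT x|unit_interval. exp (cnj a * cis (2 * pi * x)) * cnj (cis (2 * pi * x)) ^ k) = cnj a ^ k / fact k"
    by (subst circle_coefficient [of _ 2]) (auto intro!: holomorphic_intros simp: higher_deriv_exp_mult)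
  then have "cnj (LINT x|unit_interval. exp (cnj a * cis (2 * pi * x)) * cnj (cis (2 * pi * x)) ^ k) = a ^ k / fact k"
    by simp
  then have "(LINT x|unit_interval. cnj (exp (cnj a * cis (2 * pi * x)) * cnj (cis (2 * pi * x)) ^ k)) = a ^ k / fact k"
    by (simp only: Bochner_Integration.integral_cnj)
  then show ?thesis by (simp add: exp_cnj mult_ac)
qed

section \<open>Homogeneous parts and the Fock space\<close>

text \<open>The complex form behind the kernel, linear in the first argument; \<open>inner\<close>
  on \<open>complex^'n\<close> is only its real part.\<close>

definition herm :: "complex^'n \<Rightarrow> complex^'n \<Rightarrow> complex" where
  "herm w z = (\<Sum>i\<in>UNIV. w $ i * cnj (z $ i))"

lemma herm_simps:
  "herm w (c *s z) = cnj c * herm w z" "herm (c *s w) z = c * herm w z"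
  "herm (w + w') z = herm w z + herm w' z" "herm w (z + z') = herm w z + herm w z'"
  "cnj (herm w z) = herm z w"
  by (simp_all add: herm_def sum_distrib_left sum.distrib algebra_simps)

lemma herm_self: "herm z z = of_real ((norm z)\<^sup>2)"
  by (simp add: herm_def norm_vec_def L2_set_def sum_nonneg complex_norm_square [symmetric])

lemma norm_herm_le: "cmod (herm w z) \<le> norm w * norm z"
proof -
  have "cmod (herm w z) \<le> (\<Sum>i\<in>UNIV. \<bar>cmod (w $ i)\<bar> * \<bar>cmod (z $ i)\<bar>)"
    unfolding herm_def by (rule order.trans [OF norm_sum]) (simp add: norm_mult)
  also have "\<dots> \<le> norm w * norm z" unfolding norm_vec_def by (rule L2_set_mult_ineq)
  finally show ?thesis .
qed

lemma continuous_on_herm [continuous_intros]: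
  assumes "continuous_on S f" "continuous_on S g"
  shows "continuous_on S (\<lambda>x. herm (f x) (g x))"
  unfolding herm_def by (intro continuous_intros assms)

lemma borel_measurable_herm [measurable]: "herm w \<in> borel_measurable borel"
  by (intro borel_measurable_continuous_onI continuous_intros)

lemma scaleR_eq_smult: "r *\<^sub>R (z::complex^'n) = complex_of_real r *s z"
  by (simp add: vec_eq_iff complex_eq_iff)

lemma smult_axioms_vec:
  "c *s (d *s z) = (c * d) *s (z::complex^'n)" "c *s (z + z') = c *s z + c *s (z'::complex^'n)"
  by (simp_all add: vec_eq_iff algebra_simps)

lemma continuous_on_smult [continuous_intros]:
  fixes g :: "_ \<Rightarrow> complex^'n"
  assumes "continuous_on S f" "continuous_on S g"
  shows "continuous_on S (\<lambda>x. f x *s g x)"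
  unfolding vector_scalar_mult_def by (intro continuous_intros assms continuous_on_vec_lambda)

lemma holomorphic_vec_on_imp_continuous_on: "f holomorphic_vec_on S \<Longrightarrow> continuous_on S f"
  unfolding holomorphic_vec_on_def
  by (metis continuous_at_imp_continuous_on has_derivative_continuous)

text \<open>The complex linearity demanded by \<open>holomorphic_vec_on\<close> turns the real
  derivative along the line into a complex one, since D (h b) = h D b.\<close>

lemma holomorphic_on_line:
  fixes f :: "complex^'n \<Rightarrow> complex"
  assumes f: "f holomorphic_vec_on S" and T: "\<And>\<zeta>. \<zeta> \<in> T \<Longrightarrow> a + \<zeta> *s b \<in> S"
  shows "(\<lambda>\<zeta>. f (a + \<zeta> *s b)) holomorphic_on T"
  unfolding holomorphic_on_def
proof
  fix \<zeta> assume "\<zeta> \<in> T"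
  then obtain D' where D: "(f has_derivative D') (at (a + \<zeta> *s b))" and lin: "\<And>c v. D' (c *s v) = c * D' v"
    using f T unfolding holomorphic_vec_on_def by metis
  have "bounded_linear (\<lambda>x::complex. x *s b)"
    by (rule linear_conv_bounded_linear [THEN iffD1], rule linearI)
       (auto simp: vec_eq_iff algebra_simps)
  then have "((\<lambda>x::complex. x *s b) has_derivative (\<lambda>h. h *s b)) (at \<zeta>)"
    by (rule bounded_linear.has_derivative [OF _ has_derivative_ident, simplified])
  then have "((\<lambda>x. a + x *s b) has_derivative (\<lambda>h. h *s b)) (at \<zeta>)"
    by (auto intro!: derivative_eq_intros)
  from diff_chain_at [OF this D] have "((\<lambda>x. f (a + x *s b)) has_derivative (\<lambda>h. D' b * h)) (at \<zeta>)"
    by (simp add: o_def lin mult.commute)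
  then have "((\<lambda>x. f (a + x *s b)) has_field_derivative D' b) (at \<zeta>)"
    by (simp add: has_field_derivative_def)
  then show "(\<lambda>\<zeta>. f (a + \<zeta> *s b)) field_differentiable at \<zeta> within T"
    unfolding field_differentiable_def using has_field_derivative_at_within by blast
qed

lemma holomorphic_on_ray:
  fixes f :: "complex^'n \<Rightarrow> complex"
  assumes f: "f holomorphic_vec_on ball 0 1" and "\<rho> * norm z \<le> 1"
  shows "(\<lambda>\<zeta>. f (\<zeta> *s z)) holomorphic_on ball 0 \<rho>"
proof -
  have "0 + \<zeta> *s z \<in> ball 0 1" if "\<zeta> \<in> ball 0 \<rho>" for \<zeta>
  proof (cases "z = 0")
    case False
    then have "cmod \<zeta> * norm z < \<rho> * norm z" using that by auto
    then show ?thesis using assms(2) by (simp add: norm_smult_vec)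
  qed simp
  from holomorphic_on_line [OF f this, of "ball 0 \<rho>"] show ?thesis by simp
qed

text \<open>
  The homogeneous component of degree \<open>k\<close> of the Taylor expansion at the origin, as a function
  on the whole space.
\<close>

definition hom_part :: "(complex^'n \<Rightarrow> complex) \<Rightarrow> nat \<Rightarrow> complex^'n \<Rightarrow> complex" where
  "hom_part f k z = (deriv ^^ k) (\<lambda>\<zeta>. f (\<zeta> *s z)) 0 / fact k"

context
  fixes f :: "complex^'n \<Rightarrow> complex"
  assumes f: "f holomorphic_vec_on ball 0 1"
begin

lemma hom_part_smult: "hom_part f k (c *s z) = c ^ k * hom_part f k z"
proof -
  \<comment> \<open>\<open>\<rho>\<close> keeps \<zeta> z inside the ball, and
    \<open>\<sigma>\<close> makes multiplication by \<open>c\<close> map its disc into that of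
    \<open>\<rho>\<close>; the summands 1 cover z = 0 and c = 0.\<close>
  define \<rho> where "\<rho> = inverse (1 + norm z)"
  define \<sigma> where "\<sigma> = \<rho> / (1 + cmod c)"
  have pos: "\<rho> > 0" "\<sigma> > 0" by (auto simp: \<rho>_def \<sigma>_def add_pos_nonneg)
  have h: "(\<lambda>\<zeta>. f (\<zeta> *s z)) holomorphic_on ball 0 \<rho>"
    by (rule holomorphic_on_ray [OF f]) (simp add: \<rho>_def divide_simps add_pos_nonneg)
  have "(deriv ^^ k) (\<lambda>\<zeta>. f ((c * \<zeta>) *s z)) 0 = c ^ k * (deriv ^^ k) (\<lambda>\<zeta>. f (\<zeta> *s z)) (c * 0)"
  proof (rule higher_deriv_compose_linear [OF h, of "ball 0 \<sigma>"])
    fix w :: complex assume "w \<in> ball 0 \<sigma>"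
    then have "cmod w < \<rho> / (1 + cmod c)" by (simp add: \<sigma>_def)
    then have "cmod w * (1 + cmod c) < \<rho>" by (simp add: less_divide_eq add_pos_nonneg)
    then show "c * w \<in> ball 0 \<rho>" by (simp add: norm_mult algebra_simps) (smt (verit) norm_ge_zero)
  qed (use pos in auto)
  then show ?thesis by (simp add: hom_part_def smult_axioms_vec mult.commute)
qed

lemma hom_part_circle:
  assumes z: "norm z < 1"
  shows "hom_part f k z = (LINT x|unit_interval. f (cis (2 * pi * x) *s z) * cnj (cis (2 * pi * x)) ^ k)"
proof -
  \<comment> \<open>For |z| < 1 this radius exceeds 1 while \<rho> |z| <= 1, so the ray is
    holomorphic on a neighbourhood of the closed unit disc.\<close>
  define \<rho> where "\<rho> = 2 / (1 + norm z)"
  have "\<rho> > 1" "\<rho> * norm z \<le> 1" using z by (auto simp: \<rho>_def divide_simps add_pos_nonneg)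
  then show ?thesis unfolding hom_part_def
    using circle_coefficient [OF holomorphic_on_ray [OF f], of \<rho> z k] by simp
qed

text \<open>The one-variable Taylor series of \<zeta> -> f (\<zeta> z), evaluated at \<zeta> =
  1.\<close>

lemma hom_part_sums:
  assumes z: "norm z < 1"
  shows "(\<lambda>k. hom_part f k z) sums f z"
proof -
  define \<rho> where "\<rho> = 2 / (1 + norm z)"
  have "\<rho> > 1" "\<rho> * norm z \<le> 1" using z by (auto simp: \<rho>_def divide_simps add_pos_nonneg)
  from holomorphic_power_series [OF holomorphic_on_ray [OF f this(2)], of 1] this(1)
  show ?thesis by (simp add: hom_part_def)
qed

lemma bounded_on_cball:
  assumes "r < 1"
  obtains M where "M \<ge> 0" "\<And>z. norm z \<le> r \<Longrightarrow> cmod (f z) \<le> M"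
proof -
  have "continuous_on (cball 0 r) f"
    by (rule continuous_on_subset [OF holomorphic_vec_on_imp_continuous_on [OF f]]) (use assms in auto)
  then have "bounded (f ` cball 0 r)"
    by (intro compact_imp_bounded compact_continuous_image) auto
  then obtain M where "\<And>z. z \<in> cball 0 r \<Longrightarrow> cmod (f z) \<le> M"
    unfolding bounded_iff by blast
  then have "norm z \<le> r \<Longrightarrow> cmod (f z) \<le> max M 0" for z
    by (simp add: max.coboundedI1)
  then show thesis by (intro that [of "max M 0"]) auto
qed

text \<open>A bound for \<open>f\<close> on the ball of radius 1/2 passes to the circle average
  there, and homogeneity spreads it to the whole space at the cost of 2^k.\<close>

lemma hom_part_bound:
  obtains C where "C \<ge> 0" "\<And>z. cmod (hom_part f k z) \<le> C * norm z ^ k"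
proof -
  obtain M where M: "M \<ge> 0" "\<And>z. norm z \<le> 1/2 \<Longrightarrow> cmod (f z) \<le> M"
    using bounded_on_cball [of "1/2"] by auto
  have half: "cmod (hom_part f k z) \<le> M" if "norm z \<le> 1/2" for z
  proof -
    have z1: "norm z < 1" using that by simp
    show ?thesis
      unfolding hom_part_circle [OF z1]
      by (rule norm_integral_unit_interval_le) (use that M in \<open>auto simp: norm_mult norm_power norm_smult_vec\<close>)
  qed
  have "cmod (hom_part f k z) \<le> (M * 2 ^ k) * norm z ^ k" for z
  proof (cases "z = 0")
    \<comment> \<open>At the origin the bound has to respect 0^0 = 1: degree 0 needs the bound M,
      positive degrees give 0 by homogeneity with factor 0.\<close>
    case True
    have "cmod (hom_part f k (0 *s z)) = 0 ^ k * cmod (hom_part f k z)"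
      by (subst hom_part_smult) (simp add: norm_mult norm_power)
    also have "\<dots> \<le> 0 ^ k * M" using half [of z] True by (intro mult_left_mono) auto
    finally show ?thesis using True M(1) by (cases k) auto
  next
    case False
    define u where "u = complex_of_real (1 / (2 * norm z)) *s z"
    have "norm u \<le> 1/2" using False by (simp add: u_def norm_smult_vec norm_divide norm_mult)
    have "complex_of_real (2 * norm z) *s u = z" using False by (simp add: u_def smult_axioms_vec vec_eq_iff)
    then have "hom_part f k z = complex_of_real (2 * norm z) ^ k * hom_part f k u"
      using hom_part_smult [of k "complex_of_real (2 * norm z)" u] by (simp only:)
    then have "cmod (hom_part f k z) = (2 * norm z) ^ k * cmod (hom_part f k u)"
      by (simp add: norm_mult norm_power)
    also have "\<dots> \<le> (2 * norm z) ^ k * M" by (intro mult_left_mono half \<open>norm u \<le> 1/2\<close>) auto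
    finally show ?thesis by (simp add: power_mult_distrib mult_ac)
  qed
  then show thesis using M(1) by (intro that [of "M * 2 ^ k"]) auto
qed

lemma borel_measurable_zero_extension [measurable]:
  "(\<lambda>z. indicator (ball 0 1) z *\<^sub>R f z) \<in> borel_measurable borel"
  using borel_measurable_continuous_on_indicator [OF _ holomorphic_vec_on_imp_continuous_on [OF f]] by simp

text \<open>The definition by a derivative at 0 says nothing about measurability in z. The circle
  average does, being a parameter integral, but it requires |z| < 1; hence z is shrunk to z / (1 +
  |z|) and homogeneity restores the size.\<close>

lemma hom_part_measurable [measurable]: "hom_part f k \<in> borel_measurable borel"
proof -
  let ?f = "\<lambda>z. indicator (ball 0 1) z *\<^sub>R f z"
  define s where "s z = complex_of_real (1 / (1 + norm z)) *s z" for z :: "complex^'n"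
  have ns: "norm (s z) < 1" for z
    by (simp add: s_def norm_smult_vec norm_divide add_pos_nonneg divide_less_eq)
       (smt (verit) norm_ge_zero norm_of_real of_real_1 of_real_add)
  have "hom_part f k z = complex_of_real (1 + norm z) ^ k *
      (LINT x|unit_interval. ?f (cis (2 * pi * x) *s s z) * cnj (cis (2 * pi * x)) ^ k)" for z
  proof -
    have "1 + norm z \<noteq> 0" by (smt (verit) norm_ge_zero)
    then have "complex_of_real (1 + norm z) *s s z = z"
      by (simp add: s_def smult_axioms_vec vec_eq_iff del: of_real_add)
    then have "hom_part f k z = complex_of_real (1 + norm z) ^ k * hom_part f k (s z)"
      using hom_part_smult [of k "complex_of_real (1 + norm z)" "s z"] by (simp only:)
    also have "hom_part f k (s z) = (LINT x|unit_interval. ?f (cis (2 * pi * x) *s s z) * cnj (cis (2 * pi * x)) ^ k)"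
      unfolding hom_part_circle [OF ns] by (intro Bochner_Integration.integral_cong) (auto simp: norm_smult_vec ns)
    finally show ?thesis .
  qed
  then have eq: "hom_part f k = (\<lambda>z. complex_of_real (1 + norm z) ^ k *
      (LINT x|unit_interval. ?f (cis (2 * pi * x) *s s z) * cnj (cis (2 * pi * x)) ^ k))" by auto
  have "continuous_on UNIV (\<lambda>(z, x). cis (2 * pi * x) *s s z)"
    unfolding case_prod_beta s_def by (intro continuous_intros) (smt (verit) norm_ge_zero)
  then have "(\<lambda>(z, x). cis (2 * pi * x) *s s z) \<in> borel_measurable (borel \<Otimes>\<^sub>M borel)"
    unfolding borel_prod by (rule borel_measurable_continuous_onI)
  from measurable_compose [OF this borel_measurable_zero_extension]
  have [measurable]: "(\<lambda>(z, x). ?f (cis (2 * pi * x) *s s z)) \<in> borel_measurable (borel \<Otimes>\<^sub>M unit_interval)"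
    by (simp add: case_prod_beta' measurable_cong_sets [OF sets_pair_measure_cong [OF refl sets_unit_interval] refl])
  have [measurable]: "(\<lambda>x. cnj (cis (2 * pi * x)) ^ k) \<in> borel_measurable unit_interval"
    by (simp add: measurable_cong_sets [OF sets_unit_interval refl] borel_measurable_continuous_onI continuous_intros)
  show ?thesis unfolding eq
    by (intro borel_measurable_times borel_measurable_power unit_interval.borel_measurable_lebesgue_integral) measurable
qed

end

section \<open>Mean values along complex lines and moments against the Gaussian\<close>

lemma unit_interval_Fubini:
  fixes F :: "real \<Rightarrow> real \<Rightarrow> complex"
  assumes [measurable]: "(\<lambda>(x, y). F x y) \<in> borel_measurable (borel \<Otimes>\<^sub>M borel)"
    and bound: "\<And>x y. cmod (F x y) \<le> C"
  shows "(LINT x|unit_interval. LINT y|unit_interval. F x y) = (LINT y|unit_interval. LINT x|unit_interval. F x y)"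
proof -
  interpret finite_measure "unit_interval \<Otimes>\<^sub>M unit_interval"
    by (rule finite_measure_pair_measure) unfold_locales
  have "(\<lambda>(x, y). F x y) \<in> borel_measurable (unit_interval \<Otimes>\<^sub>M unit_interval)"
    by (simp add: measurable_cong_sets [OF sets_pair_measure_cong [OF sets_unit_interval sets_unit_interval] refl])
  then have "integrable (unit_interval \<Otimes>\<^sub>M unit_interval) (\<lambda>(x, y). F x y)"
    using bound by (intro integrable_const_bound [of _ C]) auto
  from unit_interval2.Fubini_integral [OF this] show ?thesis ..
qed

lemma power_le_exp:
  obtains D :: real where "D \<ge> 0" "\<And>x. x \<ge> 0 \<Longrightarrow> x ^ k \<le> D * exp x"
proof (cases "k = 0")
  case True
  then show thesis by (intro that [of 1]) auto
next
  case False
  \<comment> \<open>This is x/k <= exp (x/k) raised to the power k.\<close>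
  have "x ^ k \<le> real k ^ k * exp x" if "x \<ge> 0" for x :: real
  proof -
    have "x / real k \<le> exp (x / real k)" using exp_ge_add_one_self [of "x / real k"] by linarith
    then have "(x / real k) ^ k \<le> exp (x / real k) ^ k" using that by (intro power_mono) auto
    also have "\<dots> = exp x" using False by (simp add: exp_of_nat_mult [symmetric])
    finally show ?thesis using False by (simp add: power_divide field_simps)
  qed
  then show thesis by (intro that [of "real k ^ k"]) auto
qed

lemma integrable_exp_bound_gauss:
  fixes g :: "complex^'n \<Rightarrow> complex"
  assumes [measurable]: "g \<in> borel_measurable borel" and bound: "\<And>z. cmod (g z) \<le> C * exp (c * norm z)"
  shows "integrable lborel (\<lambda>z. g z * of_real (exp (- (norm z)\<^sup>2)))"
proof (rule Bochner_Integration.integrable_bound [OF integrable_mult_right [of C, OF integrable_exp_norm_gauss [of c]]])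
  show "AE z in lborel. norm (g z * of_real (exp (- (norm z)\<^sup>2))) \<le>
      norm (C * (exp (c * norm z) * exp (- (norm z)\<^sup>2)))"
  proof (rule AE_I2)
    fix z
    have "norm (g z * of_real (exp (- (norm z)\<^sup>2))) \<le> (C * exp (c * norm z)) * exp (- (norm z)\<^sup>2)"
      using bound [of z] by (simp add: norm_mult mult_right_mono)
    then show "norm (g z * of_real (exp (- (norm z)\<^sup>2))) \<le>
      norm (C * (exp (c * norm z) * exp (- (norm z)\<^sup>2)))" by (simp add: mult.assoc)
  qed
qed measurable

context
  fixes f :: "complex^'n \<Rightarrow> complex"
  assumes f: "f holomorphic_vec_on ball 0 1"
begin

text \<open>The mean value property of \<zeta> -> hom_part f k (w + \<zeta> u) exp (- \<zeta> q).
  Holomorphy is available for \<open>f\<close> in the ball, not yet for \<open>hom_part\<close>; so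
  \<open>hom_part\<close> is scaled down by \<rho>, written as a circle average of \<open>f\<close>,
  and after exchanging the averages the mean value property is applied to \<open>f\<close> along a
  line.\<close>

lemma hom_part_line_mean:
  "(LINT x|unit_interval. hom_part f k (w + cis (2 * pi * x) *s u) * exp (- (cis (2 * pi * x) * q))) =
    hom_part f k w"
proof -
  let ?f = "\<lambda>z. indicator (ball 0 1) z *\<^sub>R f z"
  let ?c = "\<lambda>x. cis (2 * pi * x)"
  \<comment> \<open>With this factor the points \<rho> (w + \<zeta> u) lie in the ball for |\<zeta>|
    slightly above 1.\<close>
  define \<rho> where "\<rho> = inverse (1 + norm w + norm u)"
  have \<rho>: "\<rho> > 0" by (simp add: \<rho>_def add_pos_nonneg)
  define r where "r = \<rho> * (norm w + norm u)"
  have r1: "r < 1" by (simp add: r_def \<rho>_def divide_simps add_pos_nonneg)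
  define v where "v x = complex_of_real \<rho> *s (w + ?c x *s u)" for x
  have nv: "norm (v x) \<le> r" for x
    unfolding v_def r_def norm_smult_vec [of "complex_of_real \<rho>"]
    using \<rho> norm_triangle_ineq [of w "?c x *s u"] by (simp add: norm_smult_vec [of "?c x"])
  then have nv1: "norm (v x) < 1" for x using r1 by (meson le_less_trans)
  obtain M where M: "M \<ge> 0" "\<And>z. norm z \<le> r \<Longrightarrow> cmod (f z) \<le> M"
    using bounded_on_cball [OF f r1] by blast
  let ?F = "\<lambda>x y. ?f (?c y *s v x) * cnj (?c y) ^ k * exp (- (?c x * q))"
  have "continuous_on UNIV (\<lambda>(x, y). ?c y *s v x)"
    unfolding case_prod_beta v_def by (intro continuous_intros)
  then have "(\<lambda>(x, y). ?c y *s v x) \<in> borel_measurable (borel \<Otimes>\<^sub>M borel)"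
    unfolding borel_prod by (rule borel_measurable_continuous_onI)
  from measurable_compose [OF this borel_measurable_zero_extension [OF f]]
  have [measurable]: "(\<lambda>(x, y). ?f (?c y *s v x)) \<in> borel_measurable (borel \<Otimes>\<^sub>M borel)"
    by (simp add: case_prod_beta')
  have "continuous_on UNIV (\<lambda>(x, y). cnj (?c y) ^ k * exp (- (?c x * q)))"
    unfolding case_prod_beta by (intro continuous_intros)
  then have "(\<lambda>(x, y). cnj (?c y) ^ k * exp (- (?c x * q))) \<in> borel_measurable (borel \<Otimes>\<^sub>M borel)"
    unfolding borel_prod by (rule borel_measurable_continuous_onI)
  then have "(\<lambda>p. (case p of (x, y) \<Rightarrow> ?f (?c y *s v x)) * (case p of (x, y) \<Rightarrow> cnj (?c y) ^ k * exp (- (?c x * q))))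
      \<in> borel_measurable (borel \<Otimes>\<^sub>M borel)"
    by measurable
  then have meas: "(\<lambda>(x, y). ?F x y) \<in> borel_measurable (borel \<Otimes>\<^sub>M borel)"
    by (simp add: case_prod_beta' mult.assoc)
  have eb: "cmod (exp (- (?c x * q))) \<le> exp (cmod q)" for x
    using complex_Re_le_cmod [of "- (?c x * q)"] by (simp add: norm_mult)
  have bound: "cmod (?F x y) \<le> M * exp (cmod q)" for x y
    unfolding norm_mult norm_power using M nv [of x] eb [of x]
    by (auto intro!: mult_mono simp: norm_smult_vec indicator_def)
  have "complex_of_real \<rho> ^ k * (LINT x|unit_interval. hom_part f k (w + ?c x *s u) * exp (- (?c x * q))) =
      (LINT x|unit_interval. hom_part f k (v x) * exp (- (?c x * q)))"
    unfolding v_def hom_part_smult [OF f, of k "complex_of_real \<rho>"] mult.assoc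
    by (rule integral_mult_right_zero [symmetric])
  also have "\<dots> = (LINT x|unit_interval. LINT y|unit_interval. ?F x y)"
    by (simp add: hom_part_circle [OF f nv1] nv1 norm_smult_vec)
  also have "\<dots> = (LINT y|unit_interval. LINT x|unit_interval. ?F x y)"
    by (rule unit_interval_Fubini [OF meas bound])
  also have "\<dots> = (LINT y|unit_interval. f (?c y *s (complex_of_real \<rho> *s w)) * cnj (?c y) ^ k)"
  proof (rule Bochner_Integration.integral_cong)
    fix y
    define a where "a = ?c y *s (complex_of_real \<rho> *s w)"
    define b where "b = ?c y *s (complex_of_real \<rho> *s u)"
    \<comment> \<open>\<open>R\<close> is above 1, yet R |u| = |u| + |u| / (1 + |u|) < |u| + 1, so
      the larger disc still maps into the ball.\<close>
    define R where "R = 1 + 1 / (1 + norm u)"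
    have R: "R > 1" by (simp add: R_def add_pos_nonneg)
    have "1 + norm u > 0" by (smt (verit) norm_ge_zero)
    then have "R * norm u < 1 + norm u" by (simp add: R_def field_simps)
    then have Ru: "norm w + R * norm u < 1 + norm w + norm u" by simp
    have inB: "a + \<zeta> *s b \<in> ball 0 1" if "\<zeta> \<in> ball 0 R" for \<zeta>
    proof -
      have "norm (a + \<zeta> *s b) \<le> \<rho> * (norm w + cmod \<zeta> * norm u)"
      proof -
        have "norm a = \<rho> * norm w" "norm b = \<rho> * norm u"
          unfolding a_def b_def norm_smult_vec using \<rho> by simp_all
        then show ?thesis
          using norm_triangle_ineq [of a "\<zeta> *s b"] by (simp add: norm_smult_vec distrib_left mult_ac)
      qed
      also have "\<dots> \<le> \<rho> * (norm w + R * norm u)"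
        using that \<rho> by (intro mult_left_mono add_left_mono mult_right_mono) auto
      also have "\<dots> < \<rho> * (1 + norm w + norm u)" using Ru \<rho> by simp
      also have "\<dots> = 1" unfolding \<rho>_def by (rule left_inverse) (smt (verit) norm_ge_zero)
      finally show ?thesis by simp
    qed
    have "(\<lambda>\<zeta>. f (a + \<zeta> *s b) * exp (- (\<zeta> * q))) holomorphic_on ball 0 R"
      by (intro holomorphic_intros holomorphic_on_line [OF f inB])
    from circle_mean [OF this R]
    have m: "(LINT x|unit_interval. f (a + ?c x *s b) * exp (- (?c x * q))) = f a" by simp
    have "?c y *s v x = a + ?c x *s b" for x
      by (simp add: v_def a_def b_def smult_axioms_vec mult_ac)
    then have "?f (?c y *s v x) = f (a + ?c x *s b)" for x
      using inB [of "?c x"] R by simp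
    then have "(LINT x|unit_interval. ?F x y) =
        (LINT x|unit_interval. (f (a + ?c x *s b) * exp (- (?c x * q))) * cnj (?c y) ^ k)"
      by (simp only: mult_ac)
    also have "\<dots> = f a * cnj (?c y) ^ k" using m by simp
    finally show "(LINT x|unit_interval. ?F x y) = f (?c y *s (complex_of_real \<rho> *s w)) * cnj (?c y) ^ k"
      by (simp add: a_def)
  qed simp
  also have "\<dots> = hom_part f k (complex_of_real \<rho> *s w)"
  proof (rule hom_part_circle [OF f, symmetric])
    have "\<rho> * norm w \<le> r" using \<rho> by (simp add: r_def)
    then show "norm (complex_of_real \<rho> *s w) < 1" using r1 \<rho> by (simp add: norm_smult_vec)
  qed
  also have "\<dots> = complex_of_real \<rho> ^ k * hom_part f k w" by (rule hom_part_smult [OF f])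
  finally show ?thesis using \<rho> by simp
qed

lemma hom_part_exp_bound:
  obtains C where "\<And>z. cmod (hom_part f k z) \<le> C * exp (norm z)" "C \<ge> 0"
proof -
  obtain C where C: "C \<ge> 0" "\<And>z. cmod (hom_part f k z) \<le> C * norm z ^ k"
    using hom_part_bound [OF f] by blast
  obtain D :: real where D: "D \<ge> 0" "\<And>x. x \<ge> 0 \<Longrightarrow> x ^ k \<le> D * exp x" using power_le_exp by blast
  have "cmod (hom_part f k z) \<le> (C * D) * exp (norm z)" for z
    using C(2) [of z] mult_left_mono [OF D(2) [OF norm_ge_zero [of z]] C(1)] by (simp add: mult.assoc)
  then show thesis using C(1) D(1) by (intro that [of "C * D"]) auto
qed

text \<open>
  The reproducing property of the Fock space: the translation \<open>z = w + u\<close> turns the integrand into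
  \<open>hom_part f k (w + u) e\<^bsup>-\<langle>u,w\<rangle>\<^esup> e\<^bsup>-|u|\<^sup>2\<^esup>\<close>, and then the mean value property applies on each circle in \<open>u\<close>.
\<close>

lemma fock_reproducing:
  "(LINT z|lborel. hom_part f k z * exp (herm w z) * of_real (exp (- (norm z)\<^sup>2))) =
    hom_part f k w * (LINT z::complex^'n|lborel. of_real (exp (- (norm z)\<^sup>2)))"
  and fock_integrable:
  "integrable lborel (\<lambda>z. hom_part f k z * exp (herm w z) * of_real (exp (- (norm z)\<^sup>2)))"
proof -
  let ?c = "\<lambda>x. cis (2 * pi * x)"
  obtain C where C: "\<And>z. cmod (hom_part f k z) \<le> C * exp (norm z)" "C \<ge> 0"
    using hom_part_exp_bound by blast
  have [measurable]: "hom_part f k \<in> borel_measurable borel" by (rule hom_part_measurable [OF f])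
  have eb: "cmod (exp q) \<le> exp (cmod q)" for q
    using complex_Re_le_cmod [of q] by simp
  show "integrable lborel (\<lambda>z. hom_part f k z * exp (herm w z) * of_real (exp (- (norm z)\<^sup>2)))"
  proof (rule integrable_exp_bound_gauss [of _ C "1 + norm w"])
    fix z
    have "cmod (hom_part f k z * exp (herm w z)) \<le> (C * exp (norm z)) * exp (norm w * norm z)"
      unfolding norm_mult using C eb [of "herm w z"] norm_herm_le [of w z]
      by (intro mult_mono) (auto intro: order.trans)
    then show "cmod (hom_part f k z * exp (herm w z)) \<le> C * exp ((1 + norm w) * norm z)"
      by (simp add: distrib_right exp_add mult.assoc)
  qed measurable
  let ?G = "\<lambda>u. hom_part f k (w + u) * exp (- herm u w) * of_real (exp (- (norm u)\<^sup>2))"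
  have Gm [measurable]: "(\<lambda>u. herm u w) \<in> borel_measurable borel"
    by (intro borel_measurable_continuous_onI continuous_intros)
  have Gi: "integrable lborel ?G"
  proof (rule integrable_exp_bound_gauss [of _ "C * exp (norm w)" "1 + norm w"])
    fix u
    have "C * exp (norm (w + u)) \<le> C * (exp (norm w) * exp (norm u))"
      using C(2) norm_triangle_ineq [of w u] by (intro mult_left_mono) (auto simp: exp_add [symmetric])
    then have "cmod (hom_part f k (w + u)) \<le> C * (exp (norm w) * exp (norm u))"
      using C(1) [of "w + u"] by linarith
    then have "cmod (hom_part f k (w + u) * exp (- herm u w)) \<le> (C * (exp (norm w) * exp (norm u))) * exp (norm w * norm u)"
      unfolding norm_mult using C(2) eb [of "- herm u w"] norm_herm_le [of u w]
      by (intro mult_mono) (auto intro: order.trans simp: mult.commute)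
    then show "cmod (hom_part f k (w + u) * exp (- herm u w)) \<le> C * exp (norm w) * exp ((1 + norm w) * norm u)"
      by (simp add: distrib_right exp_add mult.assoc)
  qed measurable
  have "(LINT z|lborel. hom_part f k z * exp (herm w z) * of_real (exp (- (norm z)\<^sup>2))) =
      (LINT u|lborel. hom_part f k (w + u) * exp (herm w (w + u)) * of_real (exp (- (norm (w + u))\<^sup>2)))"
    by (subst lborel_distr_plus [of w, symmetric], subst integral_distr) auto
  also have "\<dots> = (LINT u|lborel. ?G u)"
  proof (rule Bochner_Integration.integral_cong)
    fix u
    \<comment> \<open>The terms <w,w> and <w,u> cancel. What is left besides the Gaussian is -<u,w>,
      which is linear in u, so the integrand is holomorphic on each circle in u.\<close>
    have "herm w (w + u) - of_real ((norm (w + u))\<^sup>2) = - herm u w - of_real ((norm u)\<^sup>2)"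
      unfolding herm_self [symmetric] by (simp add: herm_simps)
    then have "exp (herm w (w + u) - of_real ((norm (w + u))\<^sup>2)) = exp (- herm u w - of_real ((norm u)\<^sup>2))"
      by simp
    then show "hom_part f k (w + u) * exp (herm w (w + u)) * of_real (exp (- (norm (w + u))\<^sup>2)) = ?G u"
      by (simp add: exp_diff exp_of_real exp_minus of_real_inverse divide_inverse mult.assoc del: of_real_power of_real_exp flip: of_real_exp)
  qed simp
  also have "\<dots> = (LINT u|lborel. LINT x|unit_interval. ?G (?c x *s u))"
    by (rule integral_rotation_average [OF Gi])
  also have "\<dots> = (LINT u::complex^'n|lborel. hom_part f k w * of_real (exp (- (norm u)\<^sup>2)))"
  proof (rule Bochner_Integration.integral_cong)
    fix u :: "complex^'n"
    have "(LINT x|unit_interval. ?G (?c x *s u)) =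
      (LINT x|unit_interval. (hom_part f k (w + ?c x *s u) * exp (- (?c x * herm u w))) * of_real (exp (- (norm u)\<^sup>2)))"
      by (simp add: herm_simps norm_smult_vec)
    also have "\<dots> = hom_part f k w * of_real (exp (- (norm u)\<^sup>2))"
      by (subst integral_mult_left_zero) (simp add: hom_part_line_mean)
    finally show "(LINT x|unit_interval. ?G (?c x *s u)) = hom_part f k w * of_real (exp (- (norm u)\<^sup>2))" .
  qed simp
  also have "\<dots> = hom_part f k w * (LINT z::complex^'n|lborel. of_real (exp (- (norm z)\<^sup>2)))"
    by (rule integral_mult_right_zero)
  finally show "(LINT z|lborel. hom_part f k z * exp (herm w z) * of_real (exp (- (norm z)\<^sup>2))) =
    hom_part f k w * (LINT z::complex^'n|lborel. of_real (exp (- (norm z)\<^sup>2)))" .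
qed

text \<open>Rotating z multiplies \<open>hom_part f k\<close> by e^(2 pi i k x) and turns the
  exponential into one in e^(-2 pi i x), so the angular average keeps only the term <w,z>^k / k! of
  its series.\<close>

lemma fock_power:
  "(LINT z|lborel. (hom_part f k z * herm w z ^ k) * of_real (exp (- (norm z)\<^sup>2))) =
    fact k * hom_part f k w * (LINT z::complex^'n|lborel. of_real (exp (- (norm z)\<^sup>2)))"
proof -
  let ?c = "\<lambda>x. cis (2 * pi * x)"
  have "hom_part f k w * (LINT z::complex^'n|lborel. of_real (exp (- (norm z)\<^sup>2))) =
      (LINT z|lborel. LINT x|unit_interval. hom_part f k (?c x *s z) * exp (herm w (?c x *s z)) * of_real (exp (- (norm (?c x *s z))\<^sup>2)))"
    unfolding fock_reproducing [symmetric] by (rule integral_rotation_average [OF fock_integrable])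
  also have "\<dots> = (LINT z|lborel. ((hom_part f k z * herm w z ^ k) * of_real (exp (- (norm z)\<^sup>2))) / fact k)"
  proof (rule Bochner_Integration.integral_cong)
    fix z :: "complex^'n"
    have "(LINT x|unit_interval. hom_part f k (?c x *s z) * exp (herm w (?c x *s z)) * of_real (exp (- (norm (?c x *s z))\<^sup>2))) =
        (LINT x|unit_interval. (hom_part f k z * of_real (exp (- (norm z)\<^sup>2))) * (?c x ^ k * exp (cnj (?c x) * herm w z)))"
      by (simp add: hom_part_smult [OF f] herm_simps norm_smult_vec mult_ac)
    also have "\<dots> = ((hom_part f k z * herm w z ^ k) * of_real (exp (- (norm z)\<^sup>2))) / fact k"
      by (subst integral_mult_right_zero) (simp add: circle_coefficient_exp)
    finally show "(LINT x|unit_interval. hom_part f k (?c x *s z) * exp (herm w (?c x *s z)) * of_real (exp (- (norm (?c x *s z))\<^sup>2))) =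
      ((hom_part f k z * herm w z ^ k) * of_real (exp (- (norm z)\<^sup>2))) / fact k" .
  qed simp
  finally show ?thesis by (simp add: field_simps)
qed

end

section \<open>The weighted Bergman space\<close>

text \<open>The density of \<open>mu\<close> relative to Lebesgue measure on the whole space. With
  the indicator inside, integrals over the ball become integrals over \<open>lborel\<close>, to
  which rotation averaging applies.\<close>

definition bergman_density :: "real \<Rightarrow> complex^'n \<Rightarrow> real" where
  "bergman_density lam z =
     indicator (ball 0 1) z * (weight lam z / (LINT w:ball (0 :: complex^'n) 1|lborel. weight lam w))"

lemma weight_measurable [measurable]: "weight lam \<in> borel_measurable borel"
  unfolding weight_def [abs_def] by measurable

lemma weight_nonneg: "0 \<le> weight lam z"
  by (simp add: weight_def)

lemma bergman_density_rotate: "cmod c = 1 \<Longrightarrow> bergman_density lam (c *s z) = bergman_density lam z"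
  by (simp add: bergman_density_def weight_def norm_smult_vec indicator_def)

lemma sets_mu [simp]: "sets (mu lam) = sets (restrict_space borel (ball (0::complex^'n) 1))"
  by (simp add: mu_def cong: sets_restrict_space_cong)

lemma space_mu [simp]: "space (mu lam) = ball (0::complex^'n) 1"
  by (simp add: mu_def space_restrict_space)

lemma borel_measurable_mu:
  "borel_measurable (mu lam :: (complex^'n) measure) = borel_measurable (restrict_space borel (ball 0 1))"
  by (rule measurable_cong_sets) simp_all

lemma
  fixes g :: "complex^'n \<Rightarrow> 'b::{banach, second_countable_topology}"
  assumes g: "g \<in> borel_measurable (restrict_space borel (ball 0 1))"
  shows integral_mu: "(LINT z|mu lam. g z) = (LINT z|lborel. bergman_density lam z *\<^sub>R g z)"
    and integrable_mu: "integrable (mu lam) g \<longleftrightarrow> integrable lborel (\<lambda>z. bergman_density lam z *\<^sub>R g z)"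
proof -
  let ?W = "LINT w:ball (0 :: complex^'n) 1|lborel. weight lam w"
  have W: "?W \<ge> 0" unfolding set_lebesgue_integral_def
    by (intro Bochner_Integration.integral_nonneg) (simp add: weight_nonneg)
  have [measurable]: "g \<in> borel_measurable (restrict_space lborel (ball 0 1))"
    using g by (simp cong: measurable_cong_sets sets_restrict_space_cong)
  have [measurable]: "(\<lambda>z. weight lam z / ?W) \<in> borel_measurable (restrict_space lborel (ball 0 1))"
    by (intro measurable_restrict_space1) measurable
  show "(LINT z|mu lam. g z) = (LINT z|lborel. bergman_density lam z *\<^sub>R g z)"
    unfolding mu_def
    by (subst integral_density) (auto simp: W weight_nonneg integral_restrict_space bergman_density_def)
  show "integrable (mu lam) g \<longleftrightarrow> integrable lborel (\<lambda>z. bergman_density lam z *\<^sub>R g z)"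
    unfolding mu_def
    by (subst integrable_density) (auto simp: W weight_nonneg integrable_restrict_space bergman_density_def)
qed

definition gauss_mass :: "'n::finite itself \<Rightarrow> real" where
  "gauss_mass _ = (LINT z::complex^'n|lborel. exp (- (norm z)\<^sup>2))"

lemma gauss_mass_pos: "gauss_mass TYPE('n::finite) > 0"
proof -
  have int: "integrable lborel (\<lambda>z::complex^'n. exp (- (norm z)\<^sup>2))"
    using integrable_norm_power_ball(2) [of 1 0, where 'n='n] by simp
  have "gauss_mass TYPE('n) \<noteq> 0"
  proof
    assume "gauss_mass TYPE('n) = 0"
    then have "AE z::complex^'n in lborel. exp (- (norm z)\<^sup>2) = 0"
      unfolding gauss_mass_def using integral_nonneg_eq_0_iff_AE [OF int] by simp
    then have "AE z::complex^'n in lborel. False" by simp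
    then have "emeasure lborel (UNIV :: (complex^'n) set) = 0"
      using AE_iff_measurable [of "UNIV :: (complex^'n) set" lborel "\<lambda>_. False"] by simp
    then show False by simp
  qed
  moreover have "gauss_mass TYPE('n) \<ge> 0"
    unfolding gauss_mass_def by (intro Bochner_Integration.integral_nonneg) simp
  ultimately show ?thesis by simp
qed

text \<open>The general binomial series with exponent -lam at -\<zeta>: the signs cancel, and the
  coefficients are pochhammer lam k / k!, a quotient of Gamma values.\<close>

lemma
  assumes lam: "lam > 0"
  shows neg_binomial_sums: "cmod \<zeta> < 1 \<Longrightarrow>
      (\<lambda>k. of_real (Gamma (lam + real k) / (Gamma lam * fact k)) * \<zeta> ^ k) sums (1 - \<zeta>) powr (- of_real lam)"
    and neg_binomial_summable: "0 \<le> r \<Longrightarrow> r < 1 \<Longrightarrow>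
      summable (\<lambda>k. norm (complex_of_real (Gamma (lam + real k) / (Gamma lam * fact k)) * of_real r ^ k))"
proof -
  define b where "b k = (- complex_of_real lam gchoose k) * (- 1) ^ k" for k
  have b_eq: "b k = of_real (Gamma (lam + real k) / (Gamma lam * fact k))" for k
  proof -
    have "b k = pochhammer (of_real lam) k / fact k"
      by (simp add: b_def gbinomial_pochhammer)
    also have "pochhammer (complex_of_real lam) k = of_real (pochhammer lam k)"
      by (rule pochhammer_of_real)
    also have "pochhammer lam k = Gamma (lam + real k) / Gamma lam"
      using lam by (intro pochhammer_Gamma) (auto elim!: nonpos_Ints_cases')
    finally show ?thesis by simp
  qed
  have series: "(\<lambda>k. b k * \<zeta> ^ k) sums (1 - \<zeta>) powr (- of_real lam)" if "cmod \<zeta> < 1" for \<zeta>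
    using gen_binomial_complex [of "- \<zeta>" "- of_real lam"] that
    by (simp add: b_def power_minus [of \<zeta>] mult_ac)
  \<comment> \<open>A power series converging at the larger radius (1 + r) / 2 converges absolutely
    at r.\<close>
  have abs_summable: "summable (\<lambda>k. norm (b k * of_real r ^ k))" if "0 \<le> r" "r < 1" for r
  proof (rule powser_insidea)
    have "cmod (of_real ((1 + r) / 2)) < 1" unfolding norm_of_real using that by simp
    then show "summable (\<lambda>k. b k * of_real ((1 + r) / 2) ^ k)" by (rule sums_summable [OF series])
    show "cmod (of_real r) < cmod (of_real ((1 + r) / 2))" unfolding norm_of_real using that by simp
  qed
  show "cmod \<zeta> < 1 \<Longrightarrow>
      (\<lambda>k. of_real (Gamma (lam + real k) / (Gamma lam * fact k)) * \<zeta> ^ k) sums (1 - \<zeta>) powr (- of_real lam)"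
    using series by (simp only: b_eq)
  show "0 \<le> r \<Longrightarrow> r < 1 \<Longrightarrow>
      summable (\<lambda>k. norm (complex_of_real (Gamma (lam + real k) / (Gamma lam * fact k)) * of_real r ^ k))"
    using abs_summable by (simp only: b_eq)
qed

context
  fixes lam :: real
  assumes lam: "lam > real CARD('n::finite)"
begin

lemma Gamma_lam_pos: "Gamma (lam + real k) > 0" "Gamma lam > 0" "Gamma (lam - real CARD('n)) > 0"
  using lam by (auto intro!: Gamma_real_pos simp: add_pos_nonneg le_less_trans [OF of_nat_0_le_iff])

text \<open>The scaling identity in degree 0, with h = 1 and a = lam - n.\<close>

lemma weight_mass:
  "(LINT w:ball (0 :: complex^'n) 1|lborel. weight lam w) =
    Gamma (lam - real CARD('n)) / Gamma lam * gauss_mass TYPE('n)"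
proof -
  have "(LINT w:ball (0 :: complex^'n) 1|lborel. weight lam w) =
      (LINT z::complex^'n|lborel. 1 * ((1 - (norm z)\<^sup>2) powr (lam - real CARD('n) - 1) * indicator (ball 0 1) z))"
    unfolding set_lebesgue_integral_def weight_def by (simp add: mult.commute)
  moreover have "Gamma (lam - real CARD('n) + real CARD('n) + real 0) * \<dots> = Gamma (lam - real CARD('n)) * gauss_mass TYPE('n)"
    using integral_homogeneous_ball_real(3) [of "\<lambda>z::complex^'n. 1" "lam - real CARD('n)" 0 1] lam
    by (simp add: gauss_mass_def)
  ultimately show ?thesis using Gamma_lam_pos by (simp add: field_simps)
qed

lemma weight_mass_pos: "(LINT w:ball (0 :: complex^'n) 1|lborel. weight lam w) > 0"
  unfolding weight_mass using Gamma_lam_pos gauss_mass_pos [where 'n='n] by simp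

text \<open>The scaling identity at a = lam - n. Dividing by the mass of the weight cancels
  Gamma(lam - n), so that only lam itself and the degree enter the constant.\<close>

lemma mu_homogeneous:
  fixes h :: "complex^'n \<Rightarrow> complex"
  assumes [measurable]: "h \<in> borel_measurable borel"
    and hom: "\<And>r z. r > 0 \<Longrightarrow> h (r *\<^sub>R z) = of_real (r ^ (2 * k)) * h z"
    and bound: "\<And>z. cmod (h z) \<le> C * norm z ^ (2 * k)"
  shows "integrable (mu lam) h"
    and "(LINT z|mu lam. h z) =
      of_real (Gamma lam / (Gamma (lam + real k) * gauss_mass TYPE('n))) *
      (LINT z|lborel. h z * of_real (exp (- (norm z)\<^sup>2)))"
proof -
  have a: "lam - real CARD('n) > 0" using lam by simp
  let ?W = "LINT w:ball (0 :: complex^'n) 1|lborel. weight lam w"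
  let ?w = "\<lambda>z::complex^'n. (1 - (norm z)\<^sup>2) powr (lam - real CARD('n) - 1) * indicator (ball 0 1) z"
  note H = integral_homogeneous_ball [OF assms(1) a hom bound]
  have hm: "h \<in> borel_measurable (restrict_space borel (ball 0 1))"
    by (rule measurable_restrict_space1) measurable
  have eq: "bergman_density lam z *\<^sub>R h z = of_real (1 / ?W) * (h z * of_real (?w z))" for z
    by (simp add: bergman_density_def weight_def scaleR_conv_of_real)
  show "integrable (mu lam) h"
    unfolding integrable_mu [OF hm] eq using H(2) by (intro integrable_mult_right) simp
  have "(LINT z|mu lam. h z) = of_real (1 / ?W) * (LINT z|lborel. h z * of_real (?w z))"
    unfolding integral_mu [OF hm] eq by (rule integral_mult_right_zero)
  also have "(LINT z|lborel. h z * of_real (?w z)) =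
      of_real (Gamma (lam - real CARD('n)) / Gamma (lam + real k)) * (LINT z|lborel. h z * of_real (exp (- (norm z)\<^sup>2)))"
    using H(3) Gamma_lam_pos(1) [of k] by (simp add: field_simps)
  also have "of_real (1 / ?W) * (of_real (Gamma (lam - real CARD('n)) / Gamma (lam + real k)) * (LINT z|lborel. h z * of_real (exp (- (norm z)\<^sup>2)))) =
      of_real (1 / ?W * (Gamma (lam - real CARD('n)) / Gamma (lam + real k))) * (LINT z|lborel. h z * of_real (exp (- (norm z)\<^sup>2)))"
    by (simp only: of_real_mult mult.assoc)
  also have "1 / ?W * (Gamma (lam - real CARD('n)) / Gamma (lam + real k)) =
      Gamma lam / (Gamma (lam + real k) * gauss_mass TYPE('n))"
    unfolding weight_mass using Gamma_lam_pos(2,3) gauss_mass_pos [where 'n='n]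
    by (simp add: field_simps)
  finally show "(LINT z|mu lam. h z) =
      of_real (Gamma lam / (Gamma (lam + real k) * gauss_mass TYPE('n))) *
      (LINT z|lborel. h z * of_real (exp (- (norm z)\<^sup>2)))" .
qed

lemma mu_prob: "emeasure (mu lam :: (complex^'n) measure) (ball 0 1) = 1"
proof -
  let ?W = "LINT w:ball (0 :: complex^'n) 1|lborel. weight lam w"
  have W: "?W > 0" by (rule weight_mass_pos)
  \<comment> \<open>The integral of a non-integrable function is 0, so a positive integral already
    certifies integrability.\<close>
  have int: "integrable lborel (\<lambda>w::complex^'n. indicator (ball 0 1) w *\<^sub>R weight lam w)"
    using not_integrable_integral_eq W unfolding set_lebesgue_integral_def by fastforce
  have [measurable]: "(\<lambda>z. weight lam z / ?W) \<in> borel_measurable (restrict_space lborel (ball 0 1))"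
    by (intro measurable_restrict_space1) measurable
  have "emeasure (mu lam :: (complex^'n) measure) (ball 0 1) =
      (\<integral>\<^sup>+z. ennreal (weight lam z / ?W) * indicator (ball 0 1) z \<partial>restrict_space lborel (ball (0::complex^'n) 1))"
    unfolding mu_def by (rule emeasure_density) (auto simp: sets_restrict_space)
  also have "\<dots> = (\<integral>\<^sup>+z. ennreal (indicator (ball 0 1) (z::complex^'n) *\<^sub>R weight lam z / ?W) \<partial>lborel)"
  proof -
    have "ennreal (weight lam z / ?W) * indicator (ball 0 1) z * indicator (ball 0 1) z =
        ennreal (indicator (ball 0 1) z *\<^sub>R weight lam z / ?W)" for z :: "complex^'n"
      by (cases "z \<in> ball 0 1") (simp_all del: mem_ball mem_ball_0)
    then show ?thesis by (subst nn_integral_restrict_space) simp_all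
  qed
  also have "\<dots> = ennreal (LINT z:ball (0 :: complex^'n) 1|lborel. weight lam z / ?W)"
    unfolding set_lebesgue_integral_def
    by (subst nn_integral_eq_integral) (use int W in \<open>auto simp: weight_nonneg\<close>)
  also have "(LINT z:ball (0 :: complex^'n) 1|lborel. weight lam z / ?W) = 1"
    using W by simp
  finally show ?thesis by simp
qed

lemma finite_measure_mu: "finite_measure (mu lam :: (complex^'n) measure)"
  by standard (simp add: mu_prob)

lemma measure_mu: "measure (mu lam :: (complex^'n) measure) (ball 0 1) = 1"
  by (simp add: measure_def mu_prob)

text \<open>Density and ball are rotation invariant, and <w,z>^k picks up e^(-2 pi i k x); the
  angular average therefore replaces \<open>f\<close> by its homogeneous part of degree k. The
  integrand is then homogeneous, so \<open>mu_homogeneous\<close> carries it to the Gaussian, where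
  \<open>fock_power\<close> evaluates it.\<close>

lemma mu_moment:
  fixes f :: "complex^'n \<Rightarrow> complex"
  assumes f: "f holomorphic_vec_on ball 0 1" and int: "integrable (mu lam) f"
  shows "integrable (mu lam) (\<lambda>z. f z * herm w z ^ k)"
    and "(LINT z|mu lam. f z * herm w z ^ k) =
      of_real (fact k * Gamma lam / Gamma (lam + real k)) * hom_part f k w"
proof -
  let ?c = "\<lambda>x. cis (2 * pi * x)"
  have fm [measurable]: "f \<in> borel_measurable (restrict_space borel (ball 0 1))"
    by (rule borel_measurable_continuous_on_restrict [OF holomorphic_vec_on_imp_continuous_on [OF f]])
  have hm [measurable]: "(\<lambda>z. herm w z ^ k) \<in> borel_measurable (restrict_space borel (ball 0 1))"
    by (rule measurable_restrict_space1) measurable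
  have fhm: "(\<lambda>z. f z * herm w z ^ k) \<in> borel_measurable (restrict_space borel (ball 0 1))"
    by measurable
  show i: "integrable (mu lam) (\<lambda>z. f z * herm w z ^ k)"
  proof (rule Bochner_Integration.integrable_bound [OF integrable_mult_left [of "of_real (norm w ^ k)", OF int]])
    show "AE z in mu lam. norm (f z * herm w z ^ k) \<le> norm (f z * of_real (norm w ^ k))"
    proof (rule AE_I2)
      fix z :: "complex^'n" assume "z \<in> space (mu lam)"
      then have "cmod (herm w z) \<le> norm w"
        using norm_herm_le [of w z] mult_left_le [of "norm z" "norm w"] by simp
      then have "cmod (herm w z) ^ k \<le> norm w ^ k" by (intro power_mono) auto
      then show "norm (f z * herm w z ^ k) \<le> norm (f z * of_real (norm w ^ k))"
        by (simp add: norm_mult norm_power mult_left_mono)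
    qed
  qed (use fhm in \<open>simp add: borel_measurable_mu\<close>)
  define F where "F = hom_part f k"
  have Fm [measurable]: "F \<in> borel_measurable borel" unfolding F_def by (rule hom_part_measurable [OF f])
  have "(LINT z|mu lam. f z * herm w z ^ k) = (LINT z|lborel. bergman_density lam z *\<^sub>R (f z * herm w z ^ k))"
    by (rule integral_mu [OF fhm])
  also have "\<dots> = (LINT z|lborel. LINT x|unit_interval. bergman_density lam (?c x *s z) *\<^sub>R (f (?c x *s z) * herm w (?c x *s z) ^ k))"
    by (rule integral_rotation_average) (use i integrable_mu [OF fhm] in blast)
  also have "\<dots> = (LINT z|lborel. bergman_density lam z *\<^sub>R (F z * herm w z ^ k))"
  proof (rule Bochner_Integration.integral_cong)
    fix z :: "complex^'n"
    have "(LINT x|unit_interval. bergman_density lam (?c x *s z) *\<^sub>R (f (?c x *s z) * herm w (?c x *s z) ^ k)) =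
        (LINT x|unit_interval. (of_real (bergman_density lam z) * herm w z ^ k) * (f (?c x *s z) * cnj (?c x) ^ k))"
      by (simp add: bergman_density_rotate herm_simps scaleR_conv_of_real power_mult_distrib mult_ac)
    also have "\<dots> = (of_real (bergman_density lam z) * herm w z ^ k) * (LINT x|unit_interval. f (?c x *s z) * cnj (?c x) ^ k)"
      by (rule integral_mult_right_zero)
    also have "\<dots> = bergman_density lam z *\<^sub>R (F z * herm w z ^ k)"
    proof (cases "norm z < 1")
      case True
      then show ?thesis unfolding F_def hom_part_circle [OF f True] by (simp add: scaleR_conv_of_real mult_ac)
    qed (simp add: bergman_density_def)
    finally show "(LINT x|unit_interval. bergman_density lam (?c x *s z) *\<^sub>R (f (?c x *s z) * herm w (?c x *s z) ^ k)) =
        bergman_density lam z *\<^sub>R (F z * herm w z ^ k)" .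
  qed simp
  also have "\<dots> = (LINT z|mu lam. F z * herm w z ^ k)"
    by (rule integral_mu [symmetric], rule measurable_restrict_space1) measurable
  also have "\<dots> = of_real (Gamma lam / (Gamma (lam + real k) * gauss_mass TYPE('n))) *
      (LINT z|lborel. (F z * herm w z ^ k) * of_real (exp (- (norm z)\<^sup>2)))"
  proof -
    obtain C where C: "C \<ge> 0" "\<And>z. cmod (F z) \<le> C * norm z ^ k"
      unfolding F_def using hom_part_bound [OF f] by blast
    show ?thesis
    proof (rule mu_homogeneous(2))
      fix r :: real and z :: "complex^'n" assume "r > 0"
      show "F (r *\<^sub>R z) * herm w (r *\<^sub>R z) ^ k = of_real (r ^ (2 * k)) * (F z * herm w z ^ k)"
        unfolding F_def scaleR_eq_smult hom_part_smult [OF f] herm_simps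
        by (simp add: power_mult_distrib mult_2 power_add)
    next
      fix z :: "complex^'n"
      have "cmod (F z * herm w z ^ k) \<le> (C * norm z ^ k) * (norm w * norm z) ^ k"
        unfolding norm_mult norm_power
        by (intro mult_mono C power_mono norm_herm_le) (auto simp: C(1))
      then show "cmod (F z * herm w z ^ k) \<le> (C * norm w ^ k) * norm z ^ (2 * k)"
        unfolding mult_2 power_add power_mult_distrib by (simp only: mult_ac)
    qed measurable
  qed
  also have "(LINT z|lborel. (F z * herm w z ^ k) * of_real (exp (- (norm z)\<^sup>2))) =
      fact k * F w * of_real (gauss_mass TYPE('n))"
    unfolding F_def fock_power [OF f] gauss_mass_def by simp
  finally show "(LINT z|mu lam. f z * herm w z ^ k) =
      of_real (fact k * Gamma lam / Gamma (lam + real k)) * hom_part f k w"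
    using gauss_mass_pos [where 'n='n] Gamma_lam_pos(1) [of k] by (simp add: F_def field_simps)
qed

text \<open>The binomial coefficients of the kernel are exactly the reciprocals of the constants in
  \<open>mu_moment\<close>, so termwise integration leaves the sum of the homogeneous parts at w.
  The terms are dominated because |<w,z>| <= |w| < 1 on the ball.\<close>

lemma reproducing_formula:
  fixes f :: "complex^'n \<Rightarrow> complex"
  assumes f: "f holomorphic_vec_on ball 0 1" and int: "integrable (mu lam) f" and w: "norm w < 1"
  shows "(LINT z|mu lam. f z * (1 - herm w z) powr (- of_real lam)) = f w"
proof -
  define b where "b k = complex_of_real (Gamma (lam + real k) / (Gamma lam * fact k))" for k
  have lam0: "lam > 0" using lam by (rule le_less_trans [OF of_nat_0_le_iff])
  note series = neg_binomial_sums [OF lam0, folded b_def]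
  note abs_summable = neg_binomial_summable [OF lam0, folded b_def]
  let ?g = "\<lambda>k z. b k * (f z * herm w z ^ k)"
  have lt1: "cmod (herm w z) \<le> norm w" if "z \<in> space (mu lam)" for z
    using norm_herm_le [of w z] mult_left_le [of "norm z" "norm w"] that by simp
  have norm_g: "norm (?g k z) \<le> cmod (f z) * norm (b k * of_real (norm w) ^ k)" if "z \<in> space (mu lam)" for k z
    using power_mono [OF lt1 [OF that] norm_ge_zero, of k]
    by (simp add: norm_mult norm_power mult_ac mult_left_mono)
  have int_g: "integrable (mu lam) (?g k)" for k
    by (intro integrable_mult_right mu_moment(1) f int)
  have "(\<lambda>k. LINT z|mu lam. ?g k z) sums (LINT z|mu lam. (\<Sum>k. ?g k z))"
  proof (rule sums_integral)
    show "integrable (mu lam) (?g k)" for k by (rule int_g)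
    show "AE z in mu lam. summable (\<lambda>k. norm (?g k z))"
    proof (rule AE_I2)
      fix z :: "complex^'n" assume z: "z \<in> space (mu lam)"
      show "summable (\<lambda>k. norm (?g k z))"
        by (rule summable_comparison_test' [OF summable_mult [OF abs_summable [OF norm_ge_zero w]], of 0 _ "cmod (f z)"])
           (use norm_g [OF z] in simp)
    qed
    have "norm (LINT z|mu lam. norm (?g k z)) \<le> (LINT z|mu lam. cmod (f z)) * norm (b k * of_real (norm w) ^ k)" for k
    proof -
      have "(LINT z|mu lam. norm (?g k z)) \<le> (LINT z|mu lam. cmod (f z) * norm (b k * of_real (norm w) ^ k))"
        by (rule Bochner_Integration.integral_mono [OF integrable_norm [OF int_g] integrable_mult_left [OF integrable_norm [OF int]]])
           (rule norm_g)
      also have "\<dots> = (LINT z|mu lam. cmod (f z)) * norm (b k * of_real (norm w) ^ k)"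
        by (rule integral_mult_left_zero)
      finally show ?thesis by (simp add: Bochner_Integration.integral_nonneg)
    qed
    then show "summable (\<lambda>k. LINT z|mu lam. norm (?g k z))"
      by (rule summable_comparison_test' [OF summable_mult [OF abs_summable [OF norm_ge_zero w]], of 0])
  qed
  moreover have "(LINT z|mu lam. ?g k z) = hom_part f k w" for k
  proof -
    have "(LINT z|mu lam. ?g k z) = b k * (LINT z|mu lam. f z * herm w z ^ k)"
      by (rule integral_mult_right_zero)
    then show ?thesis unfolding mu_moment(2) [OF f int] b_def
      using Gamma_lam_pos(1) [of k] Gamma_lam_pos(2) by (simp add: field_simps)
  qed
  moreover have "(LINT z|mu lam. (\<Sum>k. ?g k z)) = (LINT z|mu lam. f z * (1 - herm w z) powr (- of_real lam))"
  proof (rule Bochner_Integration.integral_cong)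
    fix z :: "complex^'n" assume "z \<in> space (mu lam)"
    then have "cmod (herm w z) < 1" using lt1 w by (meson le_less_trans)
    from sums_mult [OF series [OF this], of "f z"]
    show "(\<Sum>k. ?g k z) = f z * (1 - herm w z) powr (- of_real lam)"
      by (simp add: sums_iff mult_ac)
  qed simp
  ultimately have "(\<lambda>k. hom_part f k w) sums (LINT z|mu lam. f z * (1 - herm w z) powr (- of_real lam))"
    by simp
  with hom_part_sums [OF f w] show ?thesis by (rule sums_unique2 [symmetric])
qed

end

section \<open>Fourier analysis on the torus\<close>

lemma torus_exp_in_torus [simp]: "torus_exp \<theta> \<in> torus"
  by (simp add: torus_exp_def torus_def)

lemma torus_nth: "t \<in> torus \<Longrightarrow> cmod (t $ i) = 1"
  by (simp add: torus_def)

lemma torus_nth_nonzero: "t \<in> torus \<Longrightarrow> t $ i \<noteq> 0"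
  using torus_nth [of t i] by force

lemma compact_torus: "compact (torus :: (complex^'n) set)"
proof -
  have "torus = (\<Inter>i. {t::complex^'n. cmod (t $ i) = 1})" by (auto simp: torus_def)
  moreover have "closed \<dots>" by (intro closed_INT ballI closed_Collect_eq continuous_intros)
  moreover have "bounded (torus :: (complex^'n) set)"
    unfolding bounded_iff
  proof (intro exI ballI)
    fix t :: "complex^'n" assume "t \<in> torus"
    then show "norm t \<le> sqrt (real CARD('n))"
      by (simp add: norm_vec_def L2_set_def torus_nth)
  qed
  ultimately show ?thesis by (simp add: compact_eq_bounded_closed)
qed

lemma torus_borel [measurable]: "(torus :: (complex^'n) set) \<in> sets borel"
  using compact_torus by (auto intro: borel_closed compact_imp_closed)

lemma continuous_on_torus_exp: "continuous_on S torus_exp"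
  unfolding torus_exp_def by (intro continuous_on_vec_lambda continuous_intros)

lemma torus_exp_measurable:
  "torus_exp \<in> restrict_space lborel (cbox 0 1) \<rightarrow>\<^sub>M restrict_space borel (torus :: (complex^'n) set)"
proof (rule measurable_restrict_space3)
  show "torus_exp \<in> lborel \<rightarrow>\<^sub>M (borel :: (complex^'n) measure)"
    using borel_measurable_continuous_onI [OF continuous_on_torus_exp] by simp
qed auto

lemma sets_haar [simp]: "sets haar = sets (restrict_space borel torus)"
  and space_haar [simp]: "space haar = torus"
  by (simp_all add: haar_def space_restrict_space)

lemma borel_measurable_haar: "borel_measurable haar = borel_measurable (restrict_space borel torus)"
  by (rule measurable_cong_sets) simp_all

lemma emeasure_haar: "emeasure (haar :: (complex^'n) measure) torus = 1"
proof -
  have "emeasure (haar :: (complex^'n) measure) torus =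
      emeasure (restrict_space lborel (cbox 0 1 :: (real^'n) set)) (cbox 0 1)"
    unfolding haar_def
    by (subst emeasure_distr [OF torus_exp_measurable])
       (auto simp: sets_restrict_space space_restrict_space vimage_def)
  also have "\<dots> = emeasure lborel (cbox 0 1 :: (real^'n) set)"
    by (subst emeasure_restrict_space) auto
  also have "\<dots> = 1"
  proof -
    have "(1::real^'n) \<bullet> b = 1" "(0::real^'n) \<bullet> b = 0" if "b \<in> Basis" for b
      using that by (auto simp: Basis_vec_def inner_axis)
    then show ?thesis by (subst emeasure_lborel_cbox) auto
  qed
  finally show ?thesis .
qed

interpretation haar: finite_measure haar
  by standard (simp add: emeasure_haar)

lemma measure_haar [simp]: "measure haar torus = 1"
  by (simp add: measure_def emeasure_haar)

lemma integral_haar: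
  fixes g :: "complex^'n \<Rightarrow> complex"
  assumes [measurable]: "g \<in> borel_measurable (restrict_space borel torus)"
  shows "(LINT t|haar. g t) = (LINT \<theta>|lborel. indicator (cbox 0 1) \<theta> *\<^sub>R g (torus_exp \<theta>))"
  unfolding haar_def
  by (subst integral_distr [OF torus_exp_measurable assms]) (simp add: integral_restrict_space)

lemma integrable_haar_bounded:
  fixes g :: "complex^'n \<Rightarrow> 'b::{banach, second_countable_topology}"
  assumes "g \<in> borel_measurable (restrict_space borel torus)" "\<And>t. t \<in> torus \<Longrightarrow> norm (g t) \<le> C"
  shows "integrable haar g"
  using assms by (intro haar.integrable_const_bound [of _ C]) (auto simp: borel_measurable_haar)

lemma integral_lborel_prod:
  fixes f :: "'a::euclidean_space \<Rightarrow> real \<Rightarrow> complex"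
  assumes f: "\<And>b. b \<in> Basis \<Longrightarrow> integrable lborel (f b)"
  shows "(LINT x|lborel. (\<Prod>b\<in>Basis. f b (x \<bullet> b))) = (\<Prod>b\<in>Basis. (LINT x|lborel. f b x))"
proof -
  interpret product_sigma_finite "\<lambda>_::'a. lborel :: real measure" by standard
  have [measurable]: "f b \<in> borel_measurable borel" if "b \<in> Basis" for b
    using f [OF that] by (auto dest: borel_measurable_integrable)
  have "(LINT x|lborel. (\<Prod>b\<in>Basis. f b (x \<bullet> b))) =
      (LINT g|Pi\<^sub>M Basis (\<lambda>_. lborel). (\<Prod>b\<in>Basis. f b ((\<Sum>b\<in>Basis. g b *\<^sub>R b) \<bullet> b)))"
    by (subst lborel_eq, subst integral_distr) auto
  also have "\<dots> = (LINT g|Pi\<^sub>M Basis (\<lambda>_. lborel). (\<Prod>b\<in>Basis. f b (g b)))"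
    by simp
  also have "\<dots> = (\<Prod>b\<in>Basis. (LINT x|lborel. f b x))"
    by (rule product_integral_prod) (auto simp: f)
  finally show ?thesis .
qed

section \<open>Characters of the torus and their integrals\<close>

lemma integral_cis_int: "(LINT x:{0..1}|lborel. cis (2 * pi * (of_int m * x))) = (if m = 0 then 1 else 0)"
proof (cases "m = 0")
  case False
  define c where "c = 2 * pi * real_of_int m"
  have c: "c \<noteq> 0" using False by (simp add: c_def)
  have der: "((\<lambda>x. cis (c * x) / (\<i> * c)) has_vector_derivative cis (c * x)) (at x within {0..1})" for x
  proof -
    have "((\<lambda>z. exp (\<i> * (c * z)) / (\<i> * c)) has_field_derivative exp (\<i> * (c * of_real x))) (at (of_real x))"
      using c by (auto intro!: derivative_eq_intros simp: mult.commute [of _ \<i>])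
    from has_vector_derivative_real_field [OF this] show ?thesis by (simp add: cis_conv_exp)
  qed
  have "((\<lambda>x::real. cis (c * x)) has_integral (cis (c * 1) / (\<i> * c) - cis (c * 0) / (\<i> * c))) {0..1}"
    by (rule fundamental_theorem_of_calculus) (auto intro: der)
  moreover have "cis (c * 1) = 1" by (simp add: c_def cis_multiple_2pi)
  ultimately have "((\<lambda>x. cis (c * x)) has_integral 0) {0..1}" by simp
  moreover have "(LINT x:{0..1}|lborel. cis (c * x)) = integral {0..1} (\<lambda>x. cis (c * x))"
    by (rule set_borel_integral_eq_integral) (auto intro!: borel_integrable_atLeastAtMost' continuous_intros)
  ultimately show ?thesis using False by (simp add: integral_unique c_def mult.assoc)
qed (simp add: set_lebesgue_integral_def)

lemma monomial_torus_exp: "monomial \<alpha> (torus_exp \<theta>) = (\<Prod>i\<in>UNIV. cis (2 * pi * (of_int (\<alpha> $ i) * \<theta> $ i)))"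
  unfolding monomial_def torus_exp_def
  by (rule prod.cong) (auto simp: cis_power_int mult_ac)

lemma norm_monomial [simp]: "t \<in> torus \<Longrightarrow> cmod (monomial \<alpha> t) = 1"
  by (simp add: monomial_def prod_norm [symmetric] norm_power_int torus_nth)

lemma monomial_add: "t \<in> torus \<Longrightarrow> monomial (\<alpha> + \<beta>) t = monomial \<alpha> t * monomial \<beta> t"
  by (simp add: monomial_def prod.distrib [symmetric] power_int_add torus_nth_nonzero)

lemma cnj_monomial: "t \<in> torus \<Longrightarrow> cnj (monomial \<alpha> t) = monomial (- \<alpha>) t"
  unfolding monomial_def cnj_prod
proof (rule prod.cong)
  fix i assume t: "t \<in> torus"
  have "cnj (t $ i) = inverse (t $ i)"
    using torus_nth [OF t, of i] by (simp add: inverse_complex_def complex_eq_iff cmod_def)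
  then show "cnj (t $ i powi \<alpha> $ i) = t $ i powi (- \<alpha>) $ i"
    by (simp add: power_int_minus power_int_inverse complex_cnj_power_int)
qed simp

lemma monomial_0 [simp]: "monomial 0 t = 1"
  by (simp add: monomial_def)

lemma monomial_axis [simp]: "monomial (axis i 1) t = t $ i"
proof -
  have "monomial (axis i 1) t = (\<Prod>j\<in>UNIV. if j = i then t $ i else 1)"
    unfolding monomial_def by (rule prod.cong) (auto simp: axis_def)
  then show ?thesis by simp
qed

lemma continuous_on_monomial: "continuous_on torus (monomial \<alpha>)"
  unfolding monomial_def [abs_def]
  by (intro continuous_intros) (auto simp: torus_nth_nonzero)

lemma monomial_measurable [measurable]: "monomial \<alpha> \<in> borel_measurable (restrict_space borel torus)"
  by (rule borel_measurable_continuous_on_restrict [OF continuous_on_monomial])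

lemma integral_monomial:
  fixes \<alpha> :: "int^'n"
  shows "(LINT t|haar. monomial \<alpha> t) = (if \<alpha> = 0 then 1 else 0)"
proof -
  \<comment> \<open>The product formula for \<open>lborel\<close> indexes its factors by basis
    vectors, so \<open>SOME\<close> recovers the coordinate that belongs to
    \<open>b\<close>.\<close>
  define g :: "real^'n \<Rightarrow> real \<Rightarrow> complex"
    where "g b x = indicator {0..1} x *\<^sub>R cis (2 * pi * (of_int (\<alpha> $ (SOME i. b = axis i 1)) * x))" for b x
  have g_axis: "g (axis i 1) x = indicator {0..1} x *\<^sub>R cis (2 * pi * (of_int (\<alpha> $ i) * x))" for i x
  proof -
    have "(SOME j. (axis i 1 :: real^'n) = axis j 1) = i"
      by (rule some_equality) (auto simp: axis_eq_axis)
    then show ?thesis by (simp add: g_def)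
  qed
  have Basis: "(Basis :: (real^'n) set) = range (\<lambda>i. axis i 1)"
    by (auto simp: Basis_vec_def)
  have prodB: "(\<Prod>b\<in>Basis. h b) = (\<Prod>i\<in>UNIV. h (axis i 1))" for h :: "real^'n \<Rightarrow> complex"
    unfolding Basis by (subst prod.reindex) (auto simp: inj_on_def axis_eq_axis)
  have gi: "integrable lborel (g b)" for b
    unfolding g_def set_integrable_def [symmetric]
    by (intro borel_integrable_atLeastAtMost' continuous_intros)
  have "(LINT t|haar. monomial \<alpha> t) =
      (LINT \<theta>|lborel. indicator (cbox 0 1) \<theta> *\<^sub>R (\<Prod>i\<in>UNIV. cis (2 * pi * (of_int (\<alpha> $ i) * \<theta> $ i))))"
    by (simp add: integral_haar [OF monomial_measurable] monomial_torus_exp)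
  also have "\<dots> = (LINT \<theta>|lborel. (\<Prod>b\<in>Basis. g b (\<theta> \<bullet> b)))"
  proof (rule Bochner_Integration.integral_cong)
    fix \<theta> :: "real^'n"
    show "indicator (cbox 0 1) \<theta> *\<^sub>R (\<Prod>i\<in>UNIV. cis (2 * pi * (of_int (\<alpha> $ i) * \<theta> $ i))) = (\<Prod>b\<in>Basis. g b (\<theta> \<bullet> b))"
    proof (cases "\<theta> \<in> cbox 0 1")
      case True
      then show ?thesis unfolding prodB
        by (auto simp: g_axis inner_axis mem_box_cart intro!: prod.cong)
    next
      case False
      \<comment> \<open>Off the cube some coordinate leaves the unit interval, and the indicator
        inside that one factor kills the whole product.\<close>
      then obtain i where "\<theta> $ i \<notin> {0..1}" by (auto simp: mem_box_cart)
      then have "g (axis i 1) (\<theta> \<bullet> axis i 1) = 0" by (simp add: g_axis inner_axis)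
      then have "\<exists>i\<in>UNIV. g (axis i 1) (\<theta> \<bullet> axis i 1) = 0" by blast
      then show ?thesis using False unfolding prodB by (simp add: prod_zero_iff)
    qed
  qed simp
  also have "\<dots> = (\<Prod>i\<in>UNIV. (LINT x|lborel. g (axis i 1) x))"
    by (subst integral_lborel_prod [OF gi]) (rule prodB)
  also have "\<dots> = (\<Prod>i\<in>UNIV. if \<alpha> $ i = 0 then 1 else 0)"
    using integral_cis_int by (simp add: g_axis set_lebesgue_integral_def)
  also have "\<dots> = (if \<alpha> = 0 then 1 else 0)"
    by (auto simp: vec_eq_iff prod_zero_iff)
  finally show ?thesis .
qed

section \<open>Fourier coefficients of powers of linear forms\<close>

definition multi_coeff :: "complex^'n \<Rightarrow> int^'n \<Rightarrow> complex" where
  "multi_coeff b \<alpha> =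
    (if \<forall>i. \<alpha> $ i \<ge> 0 then \<Prod>i\<in>UNIV. b $ i ^ nat (\<alpha> $ i) / fact (nat (\<alpha> $ i)) else 0)"

text \<open>The identity b_i b^(\<alpha> - e_i) / (\<alpha> - e_i)! = \<alpha>_i b^\<alpha> /
  \<alpha>!. Extension by 0 off the cone makes it valid for all integer vectors: if \<alpha>_i = 0,
  then \<alpha> - e_i leaves the cone and both sides vanish.\<close>

lemma multi_coeff_lower:
  "b $ i * multi_coeff b (\<alpha> - axis i 1) = of_int (\<alpha> $ i) * multi_coeff b \<alpha>"
proof (cases "(\<forall>j. \<alpha> $ j \<ge> 0) \<and> \<alpha> $ i \<noteq> 0")
  case True
  then have pos: "\<alpha> $ i > 0" and nn: "\<And>j. \<alpha> $ j \<ge> 0" by (auto simp: order.not_eq_order_implies_strict)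
  have nn': "\<forall>j. (\<alpha> - axis i 1) $ j \<ge> 0" using pos nn by (auto simp: axis_def)
  let ?p = "\<lambda>\<alpha> j. b $ j ^ nat (\<alpha> $ j) / fact (nat (\<alpha> $ j))"
  obtain m where "\<alpha> $ i = int (Suc m)"
    using pos by (metis pos_int_cases Suc_pred)
  then have m: "nat (\<alpha> $ i) = Suc m" "nat ((\<alpha> - axis i 1) $ i) = m" "of_int (\<alpha> $ i) = (of_nat (Suc m) :: complex)"
    by (simp_all add: axis_def)
  have "b $ i * multi_coeff b (\<alpha> - axis i 1) =
      b $ i * (?p (\<alpha> - axis i 1) i * (\<Prod>j\<in>UNIV - {i}. ?p (\<alpha> - axis i 1) j))"
    using nn' by (simp add: multi_coeff_def prod.remove [of UNIV i])
  also have "(\<Prod>j\<in>UNIV - {i}. ?p (\<alpha> - axis i 1) j) = (\<Prod>j\<in>UNIV - {i}. ?p \<alpha> j)"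
    by (rule prod.cong) (auto simp: axis_def)
  also have "b $ i * (?p (\<alpha> - axis i 1) i * (\<Prod>j\<in>UNIV - {i}. ?p \<alpha> j)) =
      of_int (\<alpha> $ i) * (?p \<alpha> i * (\<Prod>j\<in>UNIV - {i}. ?p \<alpha> j))"
    unfolding m by (simp add: field_simps del: of_nat_Suc)
  also have "\<dots> = of_int (\<alpha> $ i) * multi_coeff b \<alpha>"
    using nn by (simp add: multi_coeff_def prod.remove [of UNIV i])
  finally show ?thesis .
next
  case False
  then consider "\<alpha> $ i = 0" | j where "\<alpha> $ j < 0" by (auto simp: not_le)
  then show ?thesis
  proof cases
    case 1
    then have "\<not> (\<forall>j. (\<alpha> - axis i 1) $ j \<ge> 0)" by (auto intro!: exI [of _ i])
    then have "multi_coeff b (\<alpha> - axis i 1) = 0" unfolding multi_coeff_def by (rule if_not_P)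
    with 1 show ?thesis by simp
  next
    case 2
    then have "(\<alpha> - axis i 1) $ j < 0" by (auto simp: axis_def)
    then have "\<not> (\<forall>j. (\<alpha> - axis i 1) $ j \<ge> 0)" "\<not> (\<forall>j. \<alpha> $ j \<ge> 0)"
      using 2 by (auto simp: not_le simp del: vector_minus_component)
    then have "multi_coeff b (\<alpha> - axis i 1) = 0" "multi_coeff b \<alpha> = 0"
      unfolding multi_coeff_def by (simp_all only: if_False)
    then show ?thesis by simp
  qed
qed

lemma linear_form_measurable [measurable]:
  "(\<lambda>t::complex^'n. \<Sum>i\<in>UNIV. b $ i * t $ i) \<in> borel_measurable (restrict_space borel torus)"
  by (intro measurable_restrict_space1 borel_measurable_continuous_onI continuous_intros)

lemma norm_linear_form_le:
  "t \<in> torus \<Longrightarrow> cmod (\<Sum>i\<in>UNIV. b $ i * t $ i) \<le> (\<Sum>i\<in>UNIV. cmod (b $ i))"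
  by (rule order.trans [OF norm_sum]) (simp add: norm_mult torus_nth)

lemma integrable_linear_form_power:
  fixes b :: "complex^'n"
  shows "integrable haar (\<lambda>t. (\<Sum>i\<in>UNIV. b $ i * t $ i) ^ k * cnj (monomial \<alpha> t))"
proof (rule integrable_haar_bounded [where C = "(\<Sum>i\<in>UNIV. cmod (b $ i)) ^ k"])
  have [measurable]: "(\<lambda>t. cnj (monomial \<alpha> t)) \<in> borel_measurable (restrict_space borel torus)"
    using measurable_compose [OF monomial_measurable, of cnj borel \<alpha>]
      borel_measurable_continuous_onI [of cnj] by (simp add: continuous_on_cnj)
  show "(\<lambda>t. (\<Sum>i\<in>UNIV. b $ i * t $ i) ^ k * cnj (monomial \<alpha> t)) \<in> borel_measurable (restrict_space borel torus)"
    using borel_measurable_times [OF borel_measurable_power [OF linear_form_measurable]] by measurable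
qed (auto simp: norm_mult norm_power intro!: power_mono norm_linear_form_le)

text \<open>The multinomial theorem in integrated form. Induction splits off one linear factor,
  which shifts the frequency by e_i; by \<open>multi_coeff_lower\<close> the factors \<alpha>_i add
  up to k + 1 and turn k! into (k+1)!.\<close>

lemma integral_linear_form_power:
  "(LINT t|haar. (\<Sum>i\<in>UNIV. b $ i * t $ i) ^ k * cnj (monomial \<alpha> t)) =
    (if (\<Sum>i\<in>UNIV. \<alpha> $ i) = int k then fact k * multi_coeff b \<alpha> else 0)"
proof (induction k arbitrary: \<alpha>)
  case 0
  have "(LINT t|haar. cnj (monomial \<alpha> t)) = (if \<alpha> = 0 then 1 else 0)"
    by (simp add: integral_monomial)
  moreover have "multi_coeff b 0 = 1" by (simp add: multi_coeff_def)
  moreover have "multi_coeff b \<alpha> = 0" if "(\<Sum>i\<in>UNIV. \<alpha> $ i) = 0" "\<alpha> \<noteq> 0"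
  proof (rule ccontr)
    assume "multi_coeff b \<alpha> \<noteq> 0"
    then have "\<forall>i. \<alpha> $ i \<ge> 0" by (auto simp: multi_coeff_def split: if_splits)
    with that show False by (simp add: sum_nonneg_eq_0_iff vec_eq_iff)
  qed
  ultimately show ?case by auto
next
  case (Suc k)
  let ?L = "\<lambda>t::complex^'a. \<Sum>i\<in>UNIV. b $ i * t $ i"
  have "(LINT t|haar. ?L t ^ Suc k * cnj (monomial \<alpha> t)) =
      (LINT t|haar. (\<Sum>i\<in>UNIV. b $ i * (?L t ^ k * cnj (monomial (\<alpha> - axis i 1) t))))"
  proof (rule Bochner_Integration.integral_cong)
    fix t :: "complex^'a" assume "t \<in> space haar"
    then have t: "t \<in> torus" by simp
    have "t $ i * cnj (monomial \<alpha> t) = cnj (monomial (\<alpha> - axis i 1) t)" for i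
      using monomial_add [OF t, of "axis i 1" "- \<alpha>"] by (simp add: cnj_monomial [OF t])
    then have "(\<Sum>i\<in>UNIV. b $ i * (?L t ^ k * cnj (monomial (\<alpha> - axis i 1) t))) =
        (\<Sum>i\<in>UNIV. (b $ i * t $ i) * (?L t ^ k * cnj (monomial \<alpha> t)))"
      by (intro sum.cong) (auto simp: mult_ac)
    then show "?L t ^ Suc k * cnj (monomial \<alpha> t) =
        (\<Sum>i\<in>UNIV. b $ i * (?L t ^ k * cnj (monomial (\<alpha> - axis i 1) t)))"
      using sum_distrib_right [of "\<lambda>i. b $ i * t $ i" UNIV "?L t ^ k * cnj (monomial \<alpha> t)"]
      by (simp only: power_Suc mult.assoc)
  qed simp
  also have "\<dots> = (\<Sum>i\<in>UNIV. b $ i * (LINT t|haar. ?L t ^ k * cnj (monomial (\<alpha> - axis i 1) t)))"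
    by (subst Bochner_Integration.integral_sum) (auto intro!: integrable_linear_form_power integrable_mult_right)
  also have "\<dots> = (\<Sum>i\<in>UNIV. if (\<Sum>i\<in>UNIV. \<alpha> $ i) = int (Suc k) then fact k * (b $ i * multi_coeff b (\<alpha> - axis i 1)) else 0)"
  proof (rule sum.cong)
    fix i
    have "(\<Sum>j\<in>UNIV. (\<alpha> - axis i 1) $ j) = (\<Sum>j\<in>UNIV. \<alpha> $ j) - 1"
      by (simp add: sum_subtractf axis_def)
    then show "b $ i * (LINT t|haar. ?L t ^ k * cnj (monomial (\<alpha> - axis i 1) t)) =
        (if (\<Sum>i\<in>UNIV. \<alpha> $ i) = int (Suc k) then fact k * (b $ i * multi_coeff b (\<alpha> - axis i 1)) else 0)"
      unfolding Suc.IH by auto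
  qed simp
  also have "\<dots> = (if (\<Sum>i\<in>UNIV. \<alpha> $ i) = int (Suc k) then fact k * (of_int (\<Sum>i\<in>UNIV. \<alpha> $ i) * multi_coeff b \<alpha>) else 0)"
  proof -
    have "(\<Sum>i\<in>UNIV. fact k * (of_int (\<alpha> $ i) * multi_coeff b \<alpha>)) =
        fact k * (of_int (\<Sum>i\<in>UNIV. \<alpha> $ i) * multi_coeff b \<alpha>)"
      unfolding of_int_sum sum_distrib_left sum_distrib_right ..
    then show ?thesis unfolding multi_coeff_lower
      by (cases "(\<Sum>i\<in>UNIV. \<alpha> $ i) = int (Suc k)") (simp_all only: if_True if_False sum.neutral_const refl)
  qed
  finally show ?case by (simp add: algebra_simps del: of_int_sum)
qed

text \<open>Of the binomial series only the term whose degree is the sum of the \<alpha>_i survives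
  integration. If that sum is negative there is no such term, and the right side is 0 through
  \<open>multi_coeff\<close>, whatever value \<open>Gamma\<close> has there.\<close>

lemma integral_torus_kernel:
  fixes b :: "complex^'n"
  assumes lam: "lam > 0" and b: "(\<Sum>i\<in>UNIV. cmod (b $ i)) < 1"
  shows "(LINT t|haar. (1 - (\<Sum>i\<in>UNIV. b $ i * t $ i)) powr (- of_real lam) * cnj (monomial \<alpha> t)) =
    of_real (Gamma (lam + of_int (\<Sum>i\<in>UNIV. \<alpha> $ i)) / Gamma lam) * multi_coeff b \<alpha>"
proof -
  define r where "r = (\<Sum>i\<in>UNIV. cmod (b $ i))"
  have r: "0 \<le> r" "r < 1" using b by (auto simp: r_def sum_nonneg)
  define c where "c k = complex_of_real (Gamma (lam + real k) / (Gamma lam * fact k))" for k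
  let ?L = "\<lambda>t::complex^'n. \<Sum>i\<in>UNIV. b $ i * t $ i"
  let ?g = "\<lambda>k t. c k * (?L t ^ k * cnj (monomial \<alpha> t))"
  note series = neg_binomial_sums [OF lam, folded c_def]
  note abs_summable = neg_binomial_summable [OF lam r, folded c_def]
  have int_g: "integrable haar (?g k)" for k
    by (intro integrable_mult_right integrable_linear_form_power)
  have norm_g: "norm (?g k t) \<le> norm (c k * of_real r ^ k)" if "t \<in> space haar" for k t
    using that r norm_linear_form_le [of t b, folded r_def]
    by (auto simp: norm_mult norm_power intro!: mult_left_mono power_mono)
  have sums1: "(\<lambda>k. LINT t|haar. ?g k t) sums (LINT t|haar. (\<Sum>k. ?g k t))"
  proof (rule sums_integral)
    show "integrable haar (?g k)" for k by (rule int_g)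
    show "AE t in haar. summable (\<lambda>k. norm (?g k t))"
    proof (rule AE_I2)
      fix t :: "complex^'n" assume t: "t \<in> space haar"
      show "summable (\<lambda>k. norm (?g k t))"
        by (rule summable_comparison_test' [OF abs_summable, of 0]) (use norm_g [OF t] in simp)
    qed
    have "norm (LINT t|haar. norm (?g k t)) \<le> norm (c k * of_real r ^ k)" for k
    proof -
      have "(LINT t|haar. norm (?g k t)) \<le> (LINT t::complex^'n|haar. norm (c k * of_real r ^ k))"
        by (rule Bochner_Integration.integral_mono [OF integrable_norm [OF int_g]]) (use norm_g in auto)
      then show ?thesis by (simp add: Bochner_Integration.integral_nonneg)
    qed
    then show "summable (\<lambda>k. LINT t|haar. norm (?g k t))"
      by (rule summable_comparison_test' [OF abs_summable, of 0])
  qed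
  have suminf: "(LINT t|haar. (\<Sum>k. ?g k t)) = (LINT t|haar. (1 - ?L t) powr (- of_real lam) * cnj (monomial \<alpha> t))"
  proof (rule Bochner_Integration.integral_cong)
    fix t :: "complex^'n" assume "t \<in> space haar"
    then have "cmod (?L t) < 1" using norm_linear_form_le [of t b, folded r_def] r by simp
    from sums_mult2 [OF series [OF this], of "cnj (monomial \<alpha> t)"]
    show "(\<Sum>k. ?g k t) = (1 - ?L t) powr (- of_real lam) * cnj (monomial \<alpha> t)"
      by (simp add: sums_iff mult.assoc)
  qed simp
  have sums2: "(\<lambda>k. LINT t|haar. ?g k t) sums
      (of_real (Gamma (lam + of_int (\<Sum>i\<in>UNIV. \<alpha> $ i)) / Gamma lam) * multi_coeff b \<alpha>)"
  proof -
    have eq: "(LINT t|haar. ?g k t) = (if int k = (\<Sum>i\<in>UNIV. \<alpha> $ i)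
        then of_real (Gamma (lam + real k) / Gamma lam) * multi_coeff b \<alpha> else 0)" for k
    proof -
      have "(LINT t|haar. ?g k t) = c k * (LINT t|haar. ?L t ^ k * cnj (monomial \<alpha> t))"
        by (rule integral_mult_right_zero)
      then show ?thesis unfolding integral_linear_form_power by (auto simp: c_def)
    qed
    show ?thesis
    proof (cases "(\<Sum>i\<in>UNIV. \<alpha> $ i) \<ge> 0")
      case True
      then obtain m where m: "(\<Sum>i\<in>UNIV. \<alpha> $ i) = int m" by (metis nonneg_int_cases)
      define I where "I k = (LINT t|haar. ?g k t)" for k
      have "I k = 0" if "k \<noteq> m" for k using that eq m by (simp add: I_def)
      then have "I sums I m" using sums_finite [of "{m}" I] by simp
      moreover have "I m = of_real (Gamma (lam + real m) / Gamma lam) * multi_coeff b \<alpha>"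
        by (simp only: I_def eq m simp_thms if_True)
      ultimately show ?thesis by (simp only: I_def [abs_def] m of_int_of_nat_eq)
    next
      case False
      then have "\<not> (\<forall>i. \<alpha> $ i \<ge> 0)" by (meson sum_nonneg)
      then have "multi_coeff b \<alpha> = 0" unfolding multi_coeff_def by (rule if_not_P)
      moreover have "(LINT t|haar. ?g k t) = 0" for k
      proof -
        have "int k \<noteq> (\<Sum>i\<in>UNIV. \<alpha> $ i)" using False by linarith
        then show ?thesis by (simp only: eq if_False)
      qed
      ultimately show ?thesis by (simp only: mult_zero_right sums_zero)
    qed
  qed
  show ?thesis using sums_unique2 [OF sums1 sums2] unfolding suminf .
qed

section \<open>Density of trigonometric polynomials in mean square\<close>

inductive_set trig_polys :: "(complex^'n \<Rightarrow> complex) set" where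
  monomial: "(\<lambda>t. c * monomial \<alpha> t) \<in> trig_polys"
| add: "p \<in> trig_polys \<Longrightarrow> q \<in> trig_polys \<Longrightarrow> (\<lambda>t. p t + q t) \<in> trig_polys"

lemma trig_polys_const: "(\<lambda>t. c) \<in> trig_polys"
  using trig_polys.monomial [of c 0] by simp

lemma trig_polys_cmult: "p \<in> trig_polys \<Longrightarrow> (\<lambda>t. c * p t) \<in> trig_polys"
proof (induction rule: trig_polys.induct)
  case (monomial d \<alpha>)
  then show ?case using trig_polys.monomial [of "c * d" \<alpha>] by (simp add: mult.assoc)
next
  case (add p q)
  then show ?case using trig_polys.add by (fastforce simp: distrib_left)
qed

text \<open>Equality is claimed on the torus only: exponents add for nonzero coordinates, whereas
  t^1 t^(-1) is 0 and not 1 at t = 0.\<close>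

lemma trig_polys_mult_monomial:
  "p \<in> trig_polys \<Longrightarrow> \<exists>r\<in>trig_polys. \<forall>t\<in>torus. p t * (c * monomial \<beta> t) = r t"
proof (induction rule: trig_polys.induct)
  case (monomial d \<alpha>)
  show ?case
    by (rule bexI [OF _ trig_polys.monomial [of "d * c" "\<alpha> + \<beta>"]]) (simp add: monomial_add mult_ac)
next
  case (add p q)
  then obtain r s where "r \<in> trig_polys" "s \<in> trig_polys"
    "\<forall>t\<in>torus. p t * (c * monomial \<beta> t) = r t" "\<forall>t\<in>torus. q t * (c * monomial \<beta> t) = s t" by auto
  then show ?case by (intro bexI [OF _ trig_polys.add [of r s]]) (simp_all add: distrib_right)
qed

lemma trig_polys_mult:
  assumes p: "p \<in> trig_polys"
  shows "q \<in> trig_polys \<Longrightarrow> \<exists>r\<in>trig_polys. \<forall>t\<in>torus. p t * q t = r t"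
proof (induction rule: trig_polys.induct)
  case (monomial d \<alpha>)
  show ?case by (rule trig_polys_mult_monomial [OF p])
next
  case (add q q')
  then obtain r s where "r \<in> trig_polys" "s \<in> trig_polys"
    "\<forall>t\<in>torus. p t * q t = r t" "\<forall>t\<in>torus. p t * q' t = s t" by auto
  then show ?case by (intro bexI [OF _ trig_polys.add [of r s]]) (simp_all add: distrib_left)
qed

lemma trig_polys_continuous: "p \<in> trig_polys \<Longrightarrow> continuous_on torus p"
  by (induction rule: trig_polys.induct) (auto intro!: continuous_intros continuous_on_monomial)

lemma torus_bounded:
  fixes g :: "complex^'n \<Rightarrow> complex"
  assumes "continuous_on torus g"
  obtains C where "\<And>t. t \<in> torus \<Longrightarrow> cmod (g t) \<le> C"
proof -
  have "bounded (g ` torus)"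
    using assms compact_torus by (intro compact_imp_bounded compact_continuous_image)
  then show thesis using that unfolding bounded_iff by blast
qed

text \<open>Measurability of \<open>g\<close> is demanded separately because integrability of its
  squared modulus does not imply it.\<close>

definition sq_integrable :: "(complex^'n \<Rightarrow> complex) \<Rightarrow> bool" where
  "sq_integrable g \<longleftrightarrow> g \<in> borel_measurable haar \<and> integrable haar (\<lambda>t. (cmod (g t))\<^sup>2)"

lemma sq_integrable_bounded:
  assumes "g \<in> borel_measurable haar" "\<And>t. t \<in> torus \<Longrightarrow> cmod (g t) \<le> C"
  shows "sq_integrable g"
  unfolding sq_integrable_def
proof (intro conjI)
  have "(cmod (g t))\<^sup>2 \<le> C\<^sup>2" if "t \<in> torus" for t using assms(2) [OF that] by (intro power_mono) auto
  then show "integrable haar (\<lambda>t. (cmod (g t))\<^sup>2)"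
    using assms(1) by (intro integrable_haar_bounded [of _ "C\<^sup>2"]) (auto simp: borel_measurable_haar [symmetric])
qed fact

lemma continuous_measurable_haar: "continuous_on torus g \<Longrightarrow> g \<in> borel_measurable haar"
  unfolding borel_measurable_haar by (rule borel_measurable_continuous_on_restrict)

lemma sq_integrable_continuous:
  assumes "continuous_on torus g"
  shows "sq_integrable g"
  using torus_bounded [OF assms] by (metis sq_integrable_bounded continuous_measurable_haar [OF assms])

lemma cmod_add_sq_le: "(cmod (a + b))\<^sup>2 \<le> 2 * (cmod a)\<^sup>2 + 2 * (cmod b)\<^sup>2"
proof -
  have "(cmod (a + b))\<^sup>2 \<le> (cmod a + cmod b)\<^sup>2" by (intro power_mono norm_triangle_ineq) auto
  moreover have "(cmod a - cmod b)\<^sup>2 \<ge> 0" by simp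
  ultimately show ?thesis by (simp add: power2_sum power2_diff)
qed

lemma sq_integrable_add:
  assumes f: "sq_integrable f" and g: "sq_integrable g"
  shows "sq_integrable (\<lambda>t. f t + g t)"
    and "(LINT t|haar. (cmod (f t + g t))\<^sup>2) \<le> 2 * (LINT t|haar. (cmod (f t))\<^sup>2) + 2 * (LINT t|haar. (cmod (g t))\<^sup>2)"
proof -
  have [measurable]: "f \<in> borel_measurable haar" "g \<in> borel_measurable haar"
    using f g by (auto simp: sq_integrable_def)
  have i: "integrable haar (\<lambda>t. 2 * (cmod (f t))\<^sup>2 + 2 * (cmod (g t))\<^sup>2)"
    using f g by (auto simp: sq_integrable_def)
  have j: "integrable haar (\<lambda>t. (cmod (f t + g t))\<^sup>2)"
    by (rule Bochner_Integration.integrable_bound [OF i]) (auto simp: cmod_add_sq_le intro!: AE_I2)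
  then show "sq_integrable (\<lambda>t. f t + g t)" by (simp add: sq_integrable_def)
  have "(LINT t|haar. (cmod (f t + g t))\<^sup>2) \<le> (LINT t|haar. 2 * (cmod (f t))\<^sup>2 + 2 * (cmod (g t))\<^sup>2)"
    by (rule Bochner_Integration.integral_mono [OF j i cmod_add_sq_le])
  also have "\<dots> = 2 * (LINT t|haar. (cmod (f t))\<^sup>2) + 2 * (LINT t|haar. (cmod (g t))\<^sup>2)"
    using f g by (subst Bochner_Integration.integral_add) (auto simp: sq_integrable_def)
  finally show "(LINT t|haar. (cmod (f t + g t))\<^sup>2) \<le> 2 * (LINT t|haar. (cmod (f t))\<^sup>2) + 2 * (LINT t|haar. (cmod (g t))\<^sup>2)" .
qed

lemma sq_integrable_cmult: "sq_integrable f \<Longrightarrow> sq_integrable (\<lambda>t. c * f t)"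
  by (auto simp: sq_integrable_def norm_mult power_mult_distrib)

lemma sq_integrable_diff:
  "sq_integrable f \<Longrightarrow> sq_integrable g \<Longrightarrow> sq_integrable (\<lambda>t. f t - g t)"
  using sq_integrable_add(1) [of f "\<lambda>t. (- 1) * g t"] sq_integrable_cmult [of g "- 1"] by simp

lemma sq_integrable_trig: "p \<in> trig_polys \<Longrightarrow> sq_integrable p"
  by (intro sq_integrable_continuous trig_polys_continuous)

definition trig_approx :: "(complex^'n \<Rightarrow> complex) \<Rightarrow> bool" where
  "trig_approx g \<longleftrightarrow> sq_integrable g \<and>
     (\<forall>e>0. \<exists>p\<in>trig_polys. (LINT t|haar. (cmod (g t - p t))\<^sup>2) < e)"

lemma trig_approx_limit:
  assumes g: "sq_integrable g"
    and lim: "\<And>e. e > 0 \<Longrightarrow> \<exists>g'. trig_approx g' \<and> (LINT t|haar. (cmod (g t - g' t))\<^sup>2) < e"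
  shows "trig_approx g"
  unfolding trig_approx_def
proof (intro conjI allI impI)
  fix e :: real assume "e > 0"
  \<comment> \<open>\<open>sq_integrable_add\<close> has a factor 2 in front of each squared
    distance, so e/4 for each of the two is the right share.\<close>
  then obtain g' where g': "trig_approx g'" "(LINT t|haar. (cmod (g t - g' t))\<^sup>2) < e / 4"
    using lim [of "e / 4"] by auto
  obtain p where p: "p \<in> trig_polys" "(LINT t|haar. (cmod (g' t - p t))\<^sup>2) < e / 4"
    using g'(1) \<open>e > 0\<close> unfolding trig_approx_def by (meson zero_less_divide_iff zero_less_numeral)
  have s: "sq_integrable g'" using g'(1) by (simp add: trig_approx_def)
  have "(LINT t|haar. (cmod ((g t - g' t) + (g' t - p t)))\<^sup>2) < e"
    using sq_integrable_add(2) [OF sq_integrable_diff [OF g s] sq_integrable_diff [OF s sq_integrable_trig [OF p(1)]]]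
      g'(2) p(2) by linarith
  then show "\<exists>p\<in>trig_polys. (LINT t|haar. (cmod (g t - p t))\<^sup>2) < e"
    using p(1) by (intro bexI [of _ p]) simp_all
qed fact

lemma trig_approx_add:
  assumes f: "trig_approx f" and g: "trig_approx g"
  shows "trig_approx (\<lambda>t. f t + g t)"
  unfolding trig_approx_def
proof (intro conjI allI impI)
  have fg: "sq_integrable f" "sq_integrable g" using f g by (auto simp: trig_approx_def)
  then show "sq_integrable (\<lambda>t. f t + g t)" by (rule sq_integrable_add)
  fix e :: real assume e: "e > 0"
  obtain p where p: "p \<in> trig_polys" "(LINT t|haar. (cmod (f t - p t))\<^sup>2) < e / 4"
    using f e unfolding trig_approx_def by (meson zero_less_divide_iff zero_less_numeral)
  obtain q where q: "q \<in> trig_polys" "(LINT t|haar. (cmod (g t - q t))\<^sup>2) < e / 4"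
    using g e unfolding trig_approx_def by (meson zero_less_divide_iff zero_less_numeral)
  have "(LINT t|haar. (cmod ((f t - p t) + (g t - q t)))\<^sup>2) < e"
    using sq_integrable_add(2) [OF sq_integrable_diff [OF fg(1) sq_integrable_trig [OF p(1)]] sq_integrable_diff [OF fg(2) sq_integrable_trig [OF q(1)]]]
      p(2) q(2) by linarith
  then show "\<exists>p\<in>trig_polys. (LINT t|haar. (cmod (f t + g t - p t))\<^sup>2) < e"
    using trig_polys.add [OF p(1) q(1)] by (intro bexI [of _ "\<lambda>t. p t + q t"]) (simp_all add: algebra_simps)
qed

lemma trig_approx_cmult:
  assumes f: "trig_approx f"
  shows "trig_approx (\<lambda>t. c * f t)"
  unfolding trig_approx_def
proof (intro conjI allI impI)
  show "sq_integrable (\<lambda>t. c * f t)" using f by (auto simp: trig_approx_def intro: sq_integrable_cmult)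
  fix e :: real assume e: "e > 0"
  define d where "d = e / (1 + (cmod c)\<^sup>2)"
  have c1: "1 + (cmod c)\<^sup>2 > 0" by (simp add: add_pos_nonneg)
  then have "d > 0" using e by (simp add: d_def)
  then obtain p where p: "p \<in> trig_polys" "(LINT t|haar. (cmod (f t - p t))\<^sup>2) < d"
    using f unfolding trig_approx_def by blast
  have "(LINT t|haar. (cmod (c * f t - c * p t))\<^sup>2) = (cmod c)\<^sup>2 * (LINT t|haar. (cmod (f t - p t))\<^sup>2)"
    by (simp add: right_diff_distrib [symmetric] norm_mult power_mult_distrib)
  also have "\<dots> \<le> (cmod c)\<^sup>2 * d" using p(2) by (intro mult_left_mono) auto
  also have "\<dots> < (1 + (cmod c)\<^sup>2) * d" using \<open>d > 0\<close> by simp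
  also have "\<dots> = e" using c1 by (simp add: d_def)
  finally show "\<exists>p\<in>trig_polys. (LINT t|haar. (cmod (c * f t - p t))\<^sup>2) < e"
    using trig_polys_cmult [OF p(1), of c] by (intro bexI [of _ "\<lambda>t. c * p t"])
qed

lemma trig_approx_trig: "p \<in> trig_polys \<Longrightarrow> trig_approx p"
  unfolding trig_approx_def by (auto intro!: bexI [of _ p] sq_integrable_trig)

lemma trig_approx_sum:
  "finite I \<Longrightarrow> (\<And>i. i \<in> I \<Longrightarrow> trig_approx (f i)) \<Longrightarrow> trig_approx (\<lambda>t. \<Sum>i\<in>I. f i t)"
  by (induction rule: finite_induct) (auto intro: trig_approx_add trig_approx_trig [OF trig_polys_const])

text \<open>Stone-Weierstrass for the real algebra of functions that agree on the torus with a
  trigonometric polynomial; real and imaginary parts of the coordinates separate points.\<close>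

lemma trig_approx_continuous:
  fixes f :: "complex^'n \<Rightarrow> real"
  assumes f: "continuous_on torus f"
  shows "trig_approx (\<lambda>t. of_real (f t))"
  unfolding trig_approx_def
proof (intro conjI allI impI)
  show fs: "sq_integrable (\<lambda>t. of_real (f t))"
    by (intro sq_integrable_continuous continuous_intros f)
  fix e :: real assume e: "e > 0"
  \<comment> \<open>Haar measure has mass 1, so a uniform error below \<open>d\<close> costs at most
    e/2 in squared distance.\<close>
  define d where "d = sqrt (e / 2)"
  have d: "d > 0" using e by (simp add: d_def)
  let ?P = "\<lambda>g :: complex^'n \<Rightarrow> real. \<exists>p\<in>trig_polys. \<forall>t\<in>torus. complex_of_real (g t) = p t"
  have cont: "continuous_on torus g" if Pg: "?P g" for g
  proof -
    obtain p where p: "p \<in> trig_polys" "\<forall>t\<in>torus. complex_of_real (g t) = p t" using Pg by blast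
    have "continuous_on torus (\<lambda>t. Re (p t))" by (intro continuous_intros trig_polys_continuous p(1))
    then show ?thesis
      by (rule continuous_on_eq) (use p(2) in \<open>metis Re_complex_of_real\<close>)
  qed
  have "\<exists>g. ?P g \<and> (\<forall>t\<in>torus. \<bar>f t - g t\<bar> < d)"
  proof (rule Stone_Weierstrass_HOL [OF compact_torus, of ?P])
    show "?P (\<lambda>t. c)" for c using trig_polys_const [of "of_real c"] by fastforce
    show "continuous_on torus g" if "?P g" for g using cont [OF that] .
    show "?P (\<lambda>t. g t + h t)" if gh: "?P g \<and> ?P h" for g h
    proof -
      obtain p q where "p \<in> trig_polys" "\<forall>t\<in>torus. complex_of_real (g t) = p t"
        "q \<in> trig_polys" "\<forall>t\<in>torus. complex_of_real (h t) = q t" using gh by blast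
      then show ?thesis by (intro bexI [OF _ trig_polys.add [of p q]]) simp_all
    qed
    show "?P (\<lambda>t. g t * h t)" if gh: "?P g \<and> ?P h" for g h
    proof -
      obtain p q where pq: "p \<in> trig_polys" "\<forall>t\<in>torus. complex_of_real (g t) = p t"
        "q \<in> trig_polys" "\<forall>t\<in>torus. complex_of_real (h t) = q t" using gh by blast
      obtain r where "r \<in> trig_polys" "\<forall>t\<in>torus. p t * q t = r t" using trig_polys_mult [OF pq(1,3)] by blast
      then show ?thesis using pq by (intro bexI [of _ r]) simp_all
    qed
    show "\<exists>g. ?P g \<and> g x \<noteq> g y" if xy: "x \<in> torus \<and> y \<in> torus \<and> x \<noteq> y" for x y
    proof -
      \<comment> \<open>On the torus the conjugate of a coordinate is the monomial with exponent -1,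
        so real and imaginary parts are combinations of two monomials.\<close>
      have re: "?P (\<lambda>t. Re (t $ i))" for i
      proof (rule bexI [OF _ trig_polys.add [OF trig_polys.monomial [of "1/2" "axis i 1"] trig_polys.monomial [of "1/2" "- axis i 1"]]], rule ballI)
        fix t :: "complex^'n" assume "t \<in> torus"
        then show "complex_of_real (Re (t $ i)) = 1/2 * monomial (axis i 1) t + 1/2 * monomial (- axis i 1) t"
          unfolding cnj_monomial [OF \<open>t \<in> torus\<close>, symmetric] by (simp add: complex_eq_iff)
      qed
      have im: "?P (\<lambda>t. Im (t $ i))" for i
      proof (rule bexI [OF _ trig_polys.add [OF trig_polys.monomial [of "- \<i> / 2" "axis i 1"] trig_polys.monomial [of "\<i> / 2" "- axis i 1"]]], rule ballI)
        fix t :: "complex^'n" assume "t \<in> torus"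
        then show "complex_of_real (Im (t $ i)) = - \<i> / 2 * monomial (axis i 1) t + \<i> / 2 * monomial (- axis i 1) t"
          unfolding cnj_monomial [OF \<open>t \<in> torus\<close>, symmetric] by (simp add: complex_eq_iff)
      qed
      obtain i where "x $ i \<noteq> y $ i" using xy by (auto simp: vec_eq_iff)
      then have "Re (x $ i) \<noteq> Re (y $ i) \<or> Im (x $ i) \<noteq> Im (y $ i)" by (auto simp: complex_eq_iff)
      then show ?thesis using re [of i] im [of i] by meson
    qed
  qed (use f d in auto)
  then obtain g p where p: "p \<in> trig_polys" "\<forall>t\<in>torus. complex_of_real (g t) = p t"
      and fg: "\<forall>t\<in>torus. \<bar>f t - g t\<bar> < d" by blast
  have "(LINT t|haar. (cmod (of_real (f t) - p t))\<^sup>2) \<le> (LINT t::complex^'n|haar. d\<^sup>2)"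
  proof (rule Bochner_Integration.integral_mono)
    show "integrable haar (\<lambda>t. (cmod (of_real (f t) - p t))\<^sup>2)"
      using sq_integrable_diff [OF fs sq_integrable_trig [OF p(1)]] by (simp add: sq_integrable_def)
    fix t :: "complex^'n" assume "t \<in> space haar"
    then have t: "t \<in> torus" by simp
    have "cmod (of_real (f t) - p t) = \<bar>f t - g t\<bar>"
      using p(2) t by (metis norm_of_real of_real_diff)
    then show "(cmod (of_real (f t) - p t))\<^sup>2 \<le> d\<^sup>2" using fg t by (intro power_mono) (auto simp: less_imp_le)
  qed simp
  also have "\<dots> < e" using e by (simp add: d_def)
  finally show "\<exists>p\<in>trig_polys. (LINT t|haar. (cmod (of_real (f t) - p t))\<^sup>2) < e" using p(1) by blast
qed

lemma trig_approx_sequence: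
  fixes f :: "complex^'n \<Rightarrow> complex"
  assumes f: "sq_integrable f" and s: "\<And>k. trig_approx (s k)"
    and lim: "\<And>t. t \<in> torus \<Longrightarrow> (\<lambda>k. s k t) \<longlonglongrightarrow> f t"
    and w: "integrable haar w" and bound: "\<And>k t. t \<in> torus \<Longrightarrow> (cmod (f t - s k t))\<^sup>2 \<le> w t"
  shows "trig_approx f"
proof (rule trig_approx_limit [OF f])
  fix e :: real assume e: "e > 0"
  have [measurable]: "f \<in> borel_measurable haar" "\<And>k. s k \<in> borel_measurable haar"
    using f s by (auto simp: sq_integrable_def trig_approx_def)
  have "(\<lambda>k. LINT t|haar. (cmod (f t - s k t))\<^sup>2) \<longlonglongrightarrow> (LINT t::complex^'n|haar. 0)"
  proof (rule integral_dominated_convergence [OF _ _ w])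
    show "AE t in haar. (\<lambda>k. (cmod (f t - s k t))\<^sup>2) \<longlonglongrightarrow> 0"
    proof (rule AE_I2)
      fix t :: "complex^'n" assume "t \<in> space haar"
      then have "(\<lambda>k. (cmod (f t - s k t))\<^sup>2) \<longlonglongrightarrow> (cmod (f t - f t))\<^sup>2"
        by (intro tendsto_intros lim) simp
      then show "(\<lambda>k. (cmod (f t - s k t))\<^sup>2) \<longlonglongrightarrow> 0" by simp
    qed
    show "AE t in haar. norm ((cmod (f t - s k t))\<^sup>2) \<le> w t" for k
      by (rule AE_I2) (use bound in simp)
  qed measurable
  then have "(\<lambda>k. LINT t|haar. (cmod (f t - s k t))\<^sup>2) \<longlonglongrightarrow> 0" by simp
  from order_tendstoD(2) [OF this e] obtain k where "(LINT t|haar. (cmod (f t - s k t))\<^sup>2) < e"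
    by (auto simp: eventually_sequentially)
  then show "\<exists>g'. trig_approx g' \<and> (LINT t|haar. (cmod (f t - g' t))\<^sup>2) < e" using s by blast
qed

lemma cmod_indicator_diff_le: "(cmod (indicator A t - indicator B t))\<^sup>2 \<le> 1"
  by (simp add: indicator_def)

text \<open>Dynkin induction over the closed sets, an intersection-stable generator. For a closed
  set the indicator is a pointwise limit of continuous functions of the distance; complements follow
  by linearity, disjoint unions by dominated convergence.\<close>

lemma trig_approx_indicator:
  fixes A :: "(complex^'n) set"
  assumes "A \<in> sets borel"
  shows "trig_approx (indicator A)"
proof -
  have sq: "sq_integrable (indicator B)" if "B \<in> sets borel" for B :: "(complex^'n) set"
    by (rule sq_integrable_bounded [of _ 1])
       (use that in \<open>auto simp: borel_measurable_haar indicator_def intro!: measurable_restrict_space1\<close>)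
  have Int: "Int_stable (Collect closed :: (complex^'n) set set)"
    by (auto simp: Int_stable_def)
  have A: "A \<in> sigma_sets UNIV (Collect closed)"
    using assms by (simp add: borel_eq_closed sets_measure_of)
  have bor: "sigma_sets UNIV (Collect closed) = sets (borel :: (complex^'n) measure)"
    by (simp add: borel_eq_closed sets_measure_of)
  have sub: "(Collect closed :: (complex^'n) set set) \<subseteq> Pow UNIV" by simp
  show ?thesis using Int sub A
  proof (induction rule: sigma_sets_induct_disjoint)
    case (basic A)
    then have cl: "closed A" by simp
    show ?case
    proof (cases "A = {}")
      \<comment> \<open>\<open>infdist\<close> to the empty set is 0, so the approximants of the
        general case would be 1 rather than tend to 0.\<close>
      case True
      then show ?thesis using trig_approx_trig [OF trig_polys_const [of 0]] by (simp add: indicator_def [abs_def])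
    next
      case False
      define s where "s k t = max 0 (1 - real k * infdist t A)" for k t
      show ?thesis
      proof (rule trig_approx_sequence [where s = "\<lambda>k t. of_real (s k t)" and w = "\<lambda>_. 1"])
        show "sq_integrable (indicator A)" by (rule sq) (use cl in auto)
        show "trig_approx (\<lambda>t. of_real (s k t))" for k
          unfolding s_def by (intro trig_approx_continuous continuous_intros)
        have s_eq: "s k t = 1" if "t \<in> A" for k t using that by (simp add: s_def)
        have s01: "0 \<le> s k t" "s k t \<le> 1" for k t by (auto simp: s_def infdist_nonneg)
        show "(cmod (indicator A t - of_real (s k t)))\<^sup>2 \<le> 1" for k t
        proof -
          have "(indicator A t - of_real (s k t) :: complex) = of_real (indicator A t - s k t)"
            by (simp add: indicator_def)
          then have "cmod (indicator A t - of_real (s k t)) = \<bar>indicator A t - s k t\<bar>"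
            by (simp only: norm_of_real)
          also have "\<dots> \<le> 1" using s01 [of k t] by (auto simp: indicator_def)
          finally show ?thesis by (simp add: power_le_one)
        qed
        fix t :: "complex^'n"
        show "(\<lambda>k. complex_of_real (s k t)) \<longlonglongrightarrow> indicator A t"
        proof (cases "t \<in> A")
          case True
          then show ?thesis by (simp add: s_eq)
        next
          case False
          then have pos: "infdist t A > 0"
            using cl \<open>A \<noteq> {}\<close> by (simp add: in_closed_iff_infdist_zero infdist_pos_not_in_closed)
          obtain N where N: "real N * infdist t A > 1" using reals_Archimedean3 [OF pos] by blast
          have "s k t = 0" if "k \<ge> N" for k
          proof -
            have "real k * infdist t A \<ge> real N * infdist t A" using that pos by (intro mult_right_mono) auto
            then show ?thesis using N by (simp add: s_def)
          qed
          then have "\<forall>\<^sub>F k in sequentially. complex_of_real (s k t) = indicator A t"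
            using False by (intro eventually_sequentiallyI [of N]) simp
          then show ?thesis by (rule tendsto_eventually)
        qed
      qed simp
    qed
  next
    case empty
    then show ?case using trig_approx_trig [OF trig_polys_const [of 0]] by (simp add: indicator_def [abs_def])
  next
    case (compl A)
    have "trig_approx (\<lambda>t. 1 + (- 1) * indicator A t)"
      by (intro trig_approx_add trig_approx_cmult compl trig_approx_trig trig_polys_const)
    moreover have "(\<lambda>t. 1 + (- 1) * indicator A t) = (indicator (UNIV - A) :: complex^'n \<Rightarrow> complex)"
      by (auto simp: indicator_def)
    ultimately show ?case by simp
  next
    case (union A)
    have Ai: "A i \<in> sets borel" for i using union(2) bor by auto
    show ?case
    proof (rule trig_approx_sequence [where s = "\<lambda>k t. \<Sum>i<k. indicator (A i) t" and w = "\<lambda>_. 1"])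
      show "sq_integrable (indicator (\<Union>i. A i))" by (rule sq) (use Ai in auto)
      show "trig_approx (\<lambda>t. \<Sum>i<k. indicator (A i) t)" for k
        by (intro trig_approx_sum union) auto
      \<comment> \<open>Disjointness makes the partial sums indicators again, which keeps the error
        at most 1.\<close>
      have part: "(\<Sum>i<k. indicator (A i) t) = (indicator (\<Union>i<k. A i) t :: complex)" for k t
        by (rule indicator_UN_disjoint [symmetric])
           (use union(1) in \<open>auto simp: disjoint_family_on_def\<close>)
      show "(cmod (indicator (\<Union>i. A i) t - (\<Sum>i<k. indicator (A i) t)))\<^sup>2 \<le> 1" for k t
        unfolding part by (rule cmod_indicator_diff_le)
      fix t :: "complex^'n"
      show "(\<lambda>k. \<Sum>i<k. indicator (A i) t :: complex) \<longlonglongrightarrow> indicator (\<Union>i. A i) t"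
        unfolding part by (rule LIMSEQ_indicator_UN)
    qed simp
  qed
qed

lemma trig_approx_sq_integrable:
  fixes f :: "complex^'n \<Rightarrow> complex"
  assumes f: "sq_integrable f"
  shows "trig_approx f"
proof -
  have fm: "f \<in> borel_measurable haar" and fi: "integrable haar (\<lambda>t. (cmod (f t))\<^sup>2)"
    using f by (auto simp: sq_integrable_def)
  obtain F where "(\<forall>i. simple_function haar (F i)) \<and> (\<forall>t\<in>torus. (\<lambda>i. F i t) \<longlonglongrightarrow> f t) \<and>
      (\<forall>i. \<forall>t\<in>torus. cmod (F i t) \<le> 2 * cmod (f t))"
    using borel_measurable_implies_sequence_metric [OF fm, of 0] by auto
  then have F: "simple_function haar (F i)" "t \<in> torus \<Longrightarrow> (\<lambda>i. F i t) \<longlonglongrightarrow> f t"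
      "t \<in> torus \<Longrightarrow> cmod (F i t) \<le> 2 * cmod (f t)" for i t
    by auto
  \<comment> \<open>A simple function has finitely many values on the torus only; the indicator of
    the torus makes it a finite sum of indicators of Borel sets everywhere.\<close>
  have FA: "trig_approx (\<lambda>t. indicator torus t * F i t)" for i
  proof -
    have fin: "finite (F i ` torus)" using simple_functionD(1) [OF F(1)] by simp
    let ?S = "\<lambda>y. F i -` {y} \<inter> torus"
    have S: "?S y \<in> sets borel" for y
      using simple_functionD(2) [OF F(1) [of i], of "{y}"] by (auto simp: sets_restrict_space)
    have "trig_approx (\<lambda>t. \<Sum>y\<in>F i ` torus. y * indicator (?S y) t)"
      by (intro trig_approx_sum fin trig_approx_cmult trig_approx_indicator S)
    moreover have "(\<Sum>y\<in>F i ` torus. y * indicator (?S y) t) = indicator torus t * F i t" for t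
    proof (cases "t \<in> torus")
      case True
      have "(\<Sum>y\<in>F i ` torus. y * indicator (?S y) t) = (\<Sum>y\<in>F i ` torus. if y = F i t then y else 0)"
        using True by (intro sum.cong) (auto simp: indicator_def)
      also have "\<dots> = F i t" using fin True by simp
      finally show ?thesis using True by simp
    qed (simp add: indicator_def)
    ultimately show ?thesis by simp
  qed
  show ?thesis
  proof (rule trig_approx_sequence [OF f FA, where w = "\<lambda>t. 9 * (cmod (f t))\<^sup>2"])
    show "(\<lambda>i. indicator torus t * F i t) \<longlonglongrightarrow> f t" if "t \<in> torus" for t
      using F(2) [OF that] that by simp
    show "integrable haar (\<lambda>t. 9 * (cmod (f t))\<^sup>2)" using fi by simp
    show "(cmod (f t - indicator torus t * F i t))\<^sup>2 \<le> 9 * (cmod (f t))\<^sup>2" if "t \<in> torus" for i t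
    proof -
      \<comment> \<open>From |F| <= 2 |f|; its square is the origin of the factor 9 in the
        majorant.\<close>
      have "cmod (f t - F i t) \<le> 3 * cmod (f t)"
        using norm_triangle_ineq4 [of "f t" "F i t"] F(3) [OF that, of i] by simp
      then have "(cmod (f t - F i t))\<^sup>2 \<le> (3 * cmod (f t))\<^sup>2" by (intro power_mono) auto
      then show ?thesis using that by (simp add: power_mult_distrib)
    qed
  qed
qed

section \<open>Orthogonality and uniqueness of Fourier coefficients\<close>

lemma sq_integrable_mult_cnj:
  assumes "sq_integrable f" "sq_integrable g"
  shows "integrable haar (\<lambda>t. f t * cnj (g t))"
proof (rule Bochner_Integration.integrable_bound)
  show "integrable haar (\<lambda>t. (cmod (f t))\<^sup>2 + (cmod (g t))\<^sup>2)"
    using assms by (auto simp: sq_integrable_def)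
  have [measurable]: "f \<in> borel_measurable haar" "g \<in> borel_measurable haar"
    using assms by (auto simp: sq_integrable_def)
  have "(\<lambda>t. cnj (g t)) \<in> borel_measurable haar"
    by (rule borel_measurable_continuous_on [OF _ \<open>g \<in> borel_measurable haar\<close>]) (intro continuous_intros)
  then show "(\<lambda>t. f t * cnj (g t)) \<in> borel_measurable haar" by measurable
  have "cmod (f t) * cmod (g t) \<le> (cmod (f t))\<^sup>2 + (cmod (g t))\<^sup>2" for t
    using sum_squares_bound [of "cmod (f t)" "cmod (g t)"] mult_nonneg_nonneg [of "cmod (f t)" "cmod (g t)"]
    unfolding mult.assoc by (smt (verit) norm_ge_zero)
  then show "AE t in haar. norm (f t * cnj (g t)) \<le> norm ((cmod (f t))\<^sup>2 + (cmod (g t))\<^sup>2)"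
    by (intro AE_I2) (simp add: norm_mult)
qed

lemma sq_integrable_monomial: "sq_integrable (monomial \<alpha>)"
  by (rule sq_integrable_continuous [OF continuous_on_monomial])

lemma sq_integrable_imp_integrable: "sq_integrable g \<Longrightarrow> integrable haar g"
  using sq_integrable_mult_cnj [OF _ sq_integrable_monomial [of 0], of g] by simp

lemma integral_trig_orthogonal:
  assumes g: "sq_integrable g" and p: "p \<in> trig_polys" and zero: "\<And>\<alpha>. fourier g \<alpha> = 0"
  shows "(LINT t|haar. g t * cnj (p t)) = 0"
  using p
proof (induction rule: trig_polys.induct)
  case (monomial c \<alpha>)
  have "(LINT t|haar. g t * cnj (c * monomial \<alpha> t)) = (LINT t|haar. cnj c * (g t * cnj (monomial \<alpha> t)))"
    by (simp add: mult_ac)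
  also have "\<dots> = cnj c * fourier g \<alpha>" unfolding fourier_def by (rule integral_mult_right_zero)
  finally show ?case using zero by simp
next
  case (add p q)
  have "(LINT t|haar. g t * cnj (p t + q t)) = (LINT t|haar. g t * cnj (p t) + g t * cnj (q t))"
    by (simp add: distrib_left)
  also have "\<dots> = (LINT t|haar. g t * cnj (p t)) + (LINT t|haar. g t * cnj (q t))"
    by (intro Bochner_Integration.integral_add sq_integrable_mult_cnj g sq_integrable_trig add)
  finally show ?case using add by simp
qed

lemma integral_norm_diff_sq:
  assumes f: "sq_integrable f" and g: "sq_integrable g" and orth: "(LINT t|haar. f t * cnj (g t)) = 0"
  shows "(LINT t|haar. (cmod (f t - g t))\<^sup>2) = (LINT t|haar. (cmod (f t))\<^sup>2) + (LINT t|haar. (cmod (g t))\<^sup>2)"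
proof -
  have i: "integrable haar (\<lambda>t. f t * cnj (g t))" by (rule sq_integrable_mult_cnj [OF f g])
  have fi: "integrable haar (\<lambda>t. (cmod (f t))\<^sup>2)" "integrable haar (\<lambda>t. (cmod (g t))\<^sup>2)"
    using f g by (auto simp: sq_integrable_def)
  have "(cmod (f t - g t))\<^sup>2 = (cmod (f t))\<^sup>2 + (cmod (g t))\<^sup>2 - 2 * Re (f t * cnj (g t))" for t
    unfolding cmod_power2 by (simp add: power2_eq_square algebra_simps)
  then have "(LINT t|haar. (cmod (f t - g t))\<^sup>2) =
      (LINT t|haar. ((cmod (f t))\<^sup>2 + (cmod (g t))\<^sup>2) - 2 * Re (f t * cnj (g t)))" by simp
  also have "\<dots> = (LINT t|haar. (cmod (f t))\<^sup>2 + (cmod (g t))\<^sup>2) - (LINT t|haar. 2 * Re (f t * cnj (g t)))"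
    by (intro Bochner_Integration.integral_diff Bochner_Integration.integrable_add fi integrable_mult_right integrable_Re i)
  also have "(LINT t|haar. 2 * Re (f t * cnj (g t))) = 2 * (LINT t|haar. Re (f t * cnj (g t)))"
    by (rule integral_mult_right_zero)
  also have "(LINT t|haar. Re (f t * cnj (g t))) = Re (LINT t|haar. f t * cnj (g t))"
    by (rule integral_Re [OF i])
  finally show ?thesis using orth fi by simp
qed

text \<open>If the norm were positive, some trigonometric polynomial would be closer to
  \<open>g\<close> than 0 is. But \<open>g\<close> is orthogonal to all of them, so by Pythagoras
  none is closer than 0.\<close>

lemma fourier_unique:
  assumes g: "sq_integrable g" and zero: "\<And>\<alpha>. fourier g \<alpha> = 0"
  shows "(LINT t|haar. (cmod (g t))\<^sup>2) = 0"
proof (rule ccontr)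
  assume "(LINT t|haar. (cmod (g t))\<^sup>2) \<noteq> 0"
  moreover have "(LINT t|haar. (cmod (g t))\<^sup>2) \<ge> 0" by (intro Bochner_Integration.integral_nonneg) simp
  ultimately have "(LINT t|haar. (cmod (g t))\<^sup>2) > 0" by (simp add: less_le)
  then obtain p where p: "p \<in> trig_polys" "(LINT t|haar. (cmod (g t - p t))\<^sup>2) < (LINT t|haar. (cmod (g t))\<^sup>2)"
    using trig_approx_sq_integrable [OF g] unfolding trig_approx_def by blast
  moreover have "(LINT t|haar. (cmod (p t))\<^sup>2) \<ge> 0" by (intro Bochner_Integration.integral_nonneg) simp
  ultimately show False
    using integral_norm_diff_sq [OF g sq_integrable_trig [OF p(1)] integral_trig_orthogonal [OF g p(1) zero]] by simp
qed

lemma fourier_diff: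
  assumes "sq_integrable f" "sq_integrable g"
  shows "fourier (\<lambda>t. f t - g t) \<alpha> = fourier f \<alpha> - fourier g \<alpha>"
  unfolding fourier_def left_diff_distrib
  by (intro Bochner_Integration.integral_diff sq_integrable_mult_cnj assms sq_integrable_monomial)

lemma fourier_unique_AE:
  assumes f: "sq_integrable f" and g: "sq_integrable g" and eq: "\<And>\<alpha>. fourier f \<alpha> = fourier g \<alpha>"
  shows "AE t in haar. f t = g t"
proof -
  have fg: "sq_integrable (\<lambda>t. f t - g t)" by (rule sq_integrable_diff [OF f g])
  have "(LINT t|haar. (cmod (f t - g t))\<^sup>2) = 0"
    by (rule fourier_unique [OF fg]) (simp add: fourier_diff [OF f g] eq)
  then have "AE t in haar. (cmod (f t - g t))\<^sup>2 = 0"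
    using fg by (subst (asm) integral_nonneg_eq_0_iff_AE) (auto simp: sq_integrable_def)
  then show ?thesis by simp
qed

lemma norm_fourier_le: "integrable haar g \<Longrightarrow> cmod (fourier g \<alpha>) \<le> (LINT t|haar. cmod (g t))"
  unfolding fourier_def
  by (rule order.trans [OF integral_norm_bound])
     (auto simp: norm_mult intro!: Bochner_Integration.integral_cong [THEN eq_refl])

section \<open>Absolutely convergent Fourier series\<close>

definition freq :: "nat \<Rightarrow> int^'n" where
  "freq = from_nat_into UNIV"

lemma bij_freq: "bij (freq :: nat \<Rightarrow> int^'n)"
proof -
  have "infinite (UNIV :: (int^'n) set)"
  proof
    assume "finite (UNIV :: (int^'n) set)"
    then have "finite (range (\<lambda>m::int. (\<chi> i. m) :: int^'n))" by (rule finite_subset [OF subset_UNIV])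
    then have "finite (UNIV :: int set)"
      by (rule finite_imageD) (auto simp: inj_on_def vec_eq_iff)
    then show False by simp
  qed
  then show ?thesis unfolding freq_def by (intro bij_betw_from_nat_into) auto
qed

text \<open>Enumerating the frequencies reduces sums over integer vectors to ordinary series; with
  absolute convergence the arbitrary order of the enumeration does not affect the value.\<close>

definition freq_summable :: "(int^'n \<Rightarrow> complex) \<Rightarrow> bool" where
  "freq_summable c \<longleftrightarrow> summable (\<lambda>k. norm (c (freq k)))"

definition fourier_series :: "(int^'n \<Rightarrow> complex) \<Rightarrow> complex^'n \<Rightarrow> complex" where
  "fourier_series c t = (\<Sum>k. c (freq k) * monomial (freq k) t)"

lemma freq_summable_mult:
  assumes c: "freq_summable c" and b: "\<And>\<alpha>. cmod (b \<alpha>) \<le> M"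
  shows "freq_summable (\<lambda>\<alpha>. c \<alpha> * b \<alpha>)"
  unfolding freq_summable_def
  by (rule summable_comparison_test' [OF summable_mult2 [OF c [unfolded freq_summable_def]], of 0 _ M])
     (auto simp: norm_mult b mult_left_mono)

context
  fixes c :: "int^'n \<Rightarrow> complex"
  assumes c: "freq_summable c"
begin

lemma fourier_series_summable:
  assumes "t \<in> torus"
  shows "summable (\<lambda>k. norm (c (freq k) * monomial (freq k) t))"
  using c assms by (simp add: norm_mult freq_summable_def)

lemma norm_fourier_series_le:
  assumes "t \<in> torus"
  shows "cmod (fourier_series c t) \<le> (\<Sum>k. norm (c (freq k)))"
  using summable_norm [OF fourier_series_summable [OF assms]] assms
  by (simp add: fourier_series_def norm_mult)

lemma fourier_series_measurable: "fourier_series c \<in> borel_measurable haar"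
  unfolding fourier_series_def [abs_def]
  by (intro borel_measurable_suminf borel_measurable_times borel_measurable_const)
     (simp add: borel_measurable_haar monomial_measurable)

lemma sq_integrable_fourier_series: "sq_integrable (fourier_series c)"
  by (rule sq_integrable_bounded [OF fourier_series_measurable norm_fourier_series_le])

text \<open>Termwise integration, justified because monomials have modulus 1. With \<open>u\<close>
  a conjugate monomial it recovers the coefficients; with \<open>u\<close> the conjugate of a square
  integrable function it evaluates convolutions and inner products.\<close>

lemma integral_fourier_series_mult:
  assumes u: "integrable haar u"
  shows "(\<lambda>k. c (freq k) * (LINT t|haar. monomial (freq k) t * u t)) sums (LINT t|haar. fourier_series c t * u t)"
proof -
  let ?g = "\<lambda>k t. c (freq k) * (monomial (freq k) t * u t)"
  have i: "integrable haar (\<lambda>t. monomial \<alpha> t * u t)" for \<alpha>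
  proof (rule Bochner_Integration.integrable_bound [OF u])
    have "u \<in> borel_measurable haar" using u by simp
    then show "(\<lambda>t. monomial \<alpha> t * u t) \<in> borel_measurable haar"
      by (intro borel_measurable_times) (simp_all add: borel_measurable_haar monomial_measurable)
  qed (auto simp: norm_mult intro!: AE_I2)
  have int_g: "integrable haar (?g k)" for k by (intro integrable_mult_right i)
  have "(\<lambda>k. LINT t|haar. ?g k t) sums (LINT t|haar. (\<Sum>k. ?g k t))"
  proof (rule sums_integral [OF int_g])
    have s: "summable (\<lambda>k. norm (c (freq k)))" using c by (simp add: freq_summable_def)
    show "AE t in haar. summable (\<lambda>k. norm (?g k t))"
      by (intro AE_I2) (simp add: norm_mult summable_mult2 [OF s])
    have "(LINT t|haar. norm (?g k t)) = norm (c (freq k)) * (LINT t|haar. norm (u t))" for k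
    proof -
      have "(LINT t|haar. norm (?g k t)) = (LINT t|haar. norm (c (freq k)) * norm (u t))"
        by (rule Bochner_Integration.integral_cong) (auto simp: norm_mult)
      then show ?thesis by simp
    qed
    then show "summable (\<lambda>k. LINT t|haar. norm (?g k t))" by (simp add: summable_mult2 [OF s])
  qed
  moreover have "(LINT t|haar. ?g k t) = c (freq k) * (LINT t|haar. monomial (freq k) t * u t)" for k
    by (rule integral_mult_right_zero)
  moreover have "(LINT t|haar. (\<Sum>k. ?g k t)) = (LINT t|haar. fourier_series c t * u t)"
  proof (rule Bochner_Integration.integral_cong)
    fix t :: "complex^'n" assume "t \<in> space haar"
    then have "summable (\<lambda>k. c (freq k) * monomial (freq k) t)"
      using fourier_series_summable [of t] by (simp add: summable_norm_cancel)
    from suminf_mult2 [OF this, of "u t"]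
    show "(\<Sum>k. ?g k t) = fourier_series c t * u t" by (simp add: fourier_series_def mult.assoc)
  qed simp
  ultimately show ?thesis by simp
qed

lemma fourier_fourier_series: "fourier (fourier_series c) \<alpha> = c \<alpha>"
proof -
  have "integrable haar (\<lambda>t. cnj (monomial \<alpha> t))"
    using sq_integrable_imp_integrable [OF sq_integrable_monomial] by simp
  from integral_fourier_series_mult [OF this]
  have s: "(\<lambda>k. c (freq k) * (LINT t|haar. monomial (freq k) t * cnj (monomial \<alpha> t))) sums fourier (fourier_series c) \<alpha>"
    by (simp add: fourier_def)
  obtain m where m: "freq m = \<alpha>" using bij_freq by (metis bij_pointE)
  have "(LINT t|haar. monomial (freq k) t * cnj (monomial \<alpha> t)) = (if k = m then 1 else 0)" for k
  proof -
    have "(LINT t|haar. monomial (freq k) t * cnj (monomial \<alpha> t)) = (LINT t|haar. monomial (freq k - \<alpha>) t)"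
    proof (rule Bochner_Integration.integral_cong)
      fix t :: "complex^'n" assume "t \<in> space haar"
      then have t: "t \<in> torus" by simp
      show "monomial (freq k) t * cnj (monomial \<alpha> t) = monomial (freq k - \<alpha>) t"
        using monomial_add [OF t, of "freq k" "- \<alpha>"] by (simp add: cnj_monomial [OF t])
    qed simp
    also have "\<dots> = (if k = m then 1 else 0)"
      using bij_freq [where 'n='n] m by (auto simp: integral_monomial bij_def inj_def)
    finally show ?thesis .
  qed
  then have s': "(\<lambda>k. if k = m then c \<alpha> else 0) sums fourier (fourier_series c) \<alpha>"
    using s m by (auto elim!: sums_cong [THEN iffD1, rotated])
  have "(\<lambda>k. if k = m then c \<alpha> else 0) sums c \<alpha>" by (rule sums_single)
  then show ?thesis using s' by (rule sums_unique2 [symmetric])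
qed

end

section \<open>The Fourier coefficients of \<open>\<phi>\<close>\<close>

text \<open>For r < 1 a summable majorant on the cone, for r > 1 the effect of a dilation on Fourier
  coefficients. The product form lets its sum factor into geometric series.\<close>

definition mass_coeff :: "real \<Rightarrow> int^'n \<Rightarrow> real" where
  "mass_coeff r \<alpha> = (if \<forall>i. \<alpha> $ i \<ge> 0 then \<Prod>i\<in>UNIV. r ^ nat (\<alpha> $ i) else 0)"

lemma mass_coeff_nonneg: "r \<ge> 0 \<Longrightarrow> mass_coeff r \<alpha> \<ge> 0"
  by (simp add: mass_coeff_def prod_nonneg)

text \<open>Any finite set of frequencies in the cone lies in a box, over which the sum is a product
  of n partial geometric series, each at most 1 / (1 - r).\<close>

lemma summable_mass_coeff:
  assumes r: "0 \<le> r" "r < 1"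
  shows "summable (\<lambda>k. mass_coeff r (freq k :: int^'n))"
proof (rule summableI_nonneg_bounded)
  show "0 \<le> mass_coeff r (freq k)" for k by (rule mass_coeff_nonneg [OF r(1)])
  fix N
  let ?A = "{\<alpha> \<in> freq ` {..<N} :: (int^'n) set. \<forall>i. \<alpha> $ i \<ge> 0}"
  have fin: "finite ?A" by simp
  obtain M where M: "\<And>\<alpha> i. \<alpha> \<in> ?A \<Longrightarrow> nat (\<alpha> $ i) \<le> M"
  proof -
    have "finite ((\<lambda>(\<alpha>, i). nat (\<alpha> $ i)) ` (?A \<times> UNIV))" using fin by simp
    then obtain M where "\<forall>x\<in>(\<lambda>(\<alpha>, i). nat (\<alpha> $ i)) ` (?A \<times> UNIV). x \<le> M"
      using finite_nat_set_iff_bounded_le by blast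
    then show thesis by (intro that [of M]) fastforce
  qed
  have "(\<Sum>k<N. mass_coeff r (freq k :: int^'n)) = (\<Sum>\<alpha>\<in>freq ` {..<N}. mass_coeff r (\<alpha> :: int^'n))"
    using bij_freq by (subst sum.reindex) (auto simp: bij_def intro: inj_on_subset)
  also have "\<dots> = (\<Sum>\<alpha>\<in>?A. mass_coeff r \<alpha>)"
    by (rule sum.mono_neutral_right) (auto simp: mass_coeff_def)
  also have "\<dots> = (\<Sum>\<alpha>\<in>?A. \<Prod>i\<in>UNIV. r ^ ((\<lambda>i. nat (\<alpha> $ i)) i))"
    by (rule sum.cong) (auto simp: mass_coeff_def)
  also have "\<dots> = (\<Sum>g\<in>(\<lambda>\<alpha> i. nat (\<alpha> $ i)) ` ?A. \<Prod>i\<in>UNIV. r ^ g i)"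
    by (subst sum.reindex) (auto simp: inj_on_def vec_eq_iff fun_eq_iff, metis eq_nat_nat_iff)
  also have "\<dots> \<le> (\<Sum>g\<in>PiE UNIV (\<lambda>_::'n. {..M}). \<Prod>i\<in>UNIV. r ^ g i)"
    by (rule sum_mono2) (use M r in \<open>auto simp: PiE_iff intro!: finite_PiE prod_nonneg\<close>)
  also have "\<dots> = (\<Prod>i\<in>(UNIV::'n set). \<Sum>m\<le>M. r ^ m)"
    by (rule prod_sum_PiE [symmetric]) auto
  also have "\<dots> \<le> (\<Prod>i\<in>(UNIV::'n set). 1 / (1 - r))"
  proof (rule prod_mono)
    have "(\<Sum>m\<le>M. r ^ m) \<le> (\<Sum>m. r ^ m)"
      using r by (intro sum_le_suminf summable_geometric) auto
    also have "\<dots> = 1 / (1 - r)" using r by (intro suminf_geometric) auto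
    finally show "0 \<le> (\<Sum>m\<le>M. r ^ m) \<and> (\<Sum>m\<le>M. r ^ m) \<le> 1 / (1 - r)"
      using r by (auto intro: sum_nonneg)
  qed
  finally show "(\<Sum>k<N. mass_coeff r (freq k :: int^'n)) \<le> (\<Prod>i\<in>(UNIV::'n set). 1 / (1 - r))" .
qed

definition phi_coeff :: "real \<Rightarrow> int^'n \<Rightarrow> real" where
  "phi_coeff lam \<alpha> =
    (if \<forall>i. \<alpha> $ i \<ge> 0
     then (2 * real CARD('n)) powi (- (\<Sum>i\<in>UNIV. \<alpha> $ i))
       * (Gamma (lam + of_int (\<Sum>i\<in>UNIV. \<alpha> $ i)) / Gamma lam)
       * (1 / (\<Prod>i\<in>UNIV. fact (nat (\<alpha> $ i))))
     else 0)"

lemma phi_coeff_eq_0: "\<not> (\<forall>i. \<alpha> $ i \<ge> 0) \<Longrightarrow> phi_coeff lam \<alpha> = 0"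
  unfolding phi_coeff_def by (rule if_not_P)

lemma mass_coeff_eq_0: "\<not> (\<forall>i. \<alpha> $ i \<ge> 0) \<Longrightarrow> mass_coeff q \<alpha> = 0"
  unfolding mass_coeff_def by (rule if_not_P)

lemma mass_coeff_eq:
  assumes "\<forall>i. \<alpha> $ i \<ge> 0"
  shows "mass_coeff q \<alpha> = q ^ nat (\<Sum>i\<in>UNIV. \<alpha> $ i)"
proof -
  have "(\<Sum>i\<in>UNIV. \<alpha> $ i) = (\<Sum>i\<in>UNIV. int (nat (\<alpha> $ i)))"
    using assms by (intro sum.cong) auto
  then have "nat (\<Sum>i\<in>UNIV. \<alpha> $ i) = (\<Sum>i\<in>UNIV. nat (\<alpha> $ i))"
    by (simp only: of_nat_sum [symmetric] nat_int)
  then show ?thesis using assms by (simp add: mass_coeff_def power_sum)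
qed

lemma phi_coeff_eq:
  fixes \<alpha> :: "int^'n"
  assumes nn: "\<forall>i. \<alpha> $ i \<ge> 0"
  shows "phi_coeff lam \<alpha> = mass_coeff (1 / (2 * real CARD('n))) \<alpha> *
    (Gamma (lam + of_int (\<Sum>i\<in>UNIV. \<alpha> $ i)) / Gamma lam) / (\<Prod>i\<in>UNIV. fact (nat (\<alpha> $ i)))"
proof -
  have "(\<Sum>i\<in>UNIV. \<alpha> $ i) \<ge> 0" using nn by (simp add: sum_nonneg)
  then have "(2 * real CARD('n)) powi (- (\<Sum>i\<in>UNIV. \<alpha> $ i)) = (1 / (2 * real CARD('n))) ^ nat (\<Sum>i\<in>UNIV. \<alpha> $ i)"
    by (simp add: power_int_minus power_int_def power_one_over inverse_eq_divide)
  then show ?thesis unfolding mass_coeff_eq [OF nn] using nn by (simp add: phi_coeff_def)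
qed

lemma phi_coeff_pos: "lam > 0 \<Longrightarrow> \<forall>i. \<alpha> $ i \<ge> 0 \<Longrightarrow> phi_coeff lam \<alpha> > 0"
  by (auto simp: phi_coeff_def intro!: mult_pos_pos divide_pos_pos prod_pos Gamma_real_pos zero_less_power_int add_pos_nonneg sum_nonneg)

lemma phi_coeff_nonneg: "lam > 0 \<Longrightarrow> phi_coeff lam \<alpha> \<ge> 0"
  by (cases "\<forall>i. \<alpha> $ i \<ge> 0") (auto simp: phi_coeff_def dest: phi_coeff_pos [THEN less_imp_le])

text \<open>The coefficients b_i of the linear form have moduli adding up to q/2, which is where q <
  2 comes from. q = 1 describes \<open>phi\<close> at shifted arguments; q = 3/2 provides the decay
  of the coefficients.\<close>

lemma integral_dilated_kernel:
  fixes t :: "complex^'n"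
  assumes lam: "lam > 0" and q: "0 \<le> q" "q < 2" and t: "t \<in> torus"
  shows "(LINT s|haar. (1 - (\<Sum>i\<in>UNIV. (of_real (q / (2 * real CARD('n))) * cnj (t $ i)) * s $ i)) powr (- of_real lam) * cnj (monomial \<alpha> s)) =
    of_real (mass_coeff q \<alpha> * phi_coeff lam \<alpha>) * cnj (monomial \<alpha> t)"
proof -
  let ?N = "2 * real CARD('n)"
  define b where "b = (\<chi> i. of_real (q / ?N) * cnj (t $ i))"
  have "cmod (b $ i) = q / ?N" for i
    using q torus_nth [OF t, of i] by (simp add: b_def norm_mult norm_divide)
  then have "(\<Sum>i\<in>UNIV. cmod (b $ i)) = q / 2" by simp
  then have b1: "(\<Sum>i\<in>UNIV. cmod (b $ i)) < 1" using q by simp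
  have "of_real (Gamma (lam + of_int (\<Sum>i\<in>UNIV. \<alpha> $ i)) / Gamma lam) * multi_coeff b \<alpha> =
      of_real (mass_coeff q \<alpha> * phi_coeff lam \<alpha>) * cnj (monomial \<alpha> t)"
  proof (cases "\<forall>i. \<alpha> $ i \<ge> 0")
    case True
    have p: "b $ i ^ k / fact k = (of_real (q ^ k) * of_real ((1 / ?N) ^ k) * cnj (t $ i ^ k)) * (1 / fact k)" for i k
      by (simp add: b_def power_mult_distrib power_divide)
    have m: "monomial \<alpha> t = (\<Prod>i\<in>UNIV. t $ i ^ nat (\<alpha> $ i))"
      unfolding monomial_def using True by (intro prod.cong) (auto simp: power_int_def)
    have "multi_coeff b \<alpha> = of_real (mass_coeff q \<alpha>) * of_real (mass_coeff (1 / ?N) \<alpha>) * cnj (monomial \<alpha> t) *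
        (1 / of_real (\<Prod>i\<in>UNIV. fact (nat (\<alpha> $ i))))"
      using True unfolding multi_coeff_def mass_coeff_def p prod.distrib m
      by (simp add: cnj_prod prod_dividef)
    then show ?thesis unfolding phi_coeff_eq [OF True] by (simp add: mult_ac)
  next
    case False
    then have "multi_coeff b \<alpha> = 0" "phi_coeff lam \<alpha> = 0"
      unfolding multi_coeff_def phi_coeff_def by (simp_all only: if_False)
    then show ?thesis by simp
  qed
  then show ?thesis using integral_torus_kernel [OF lam b1, of \<alpha>] by (simp add: b_def)
qed

text \<open>A Cauchy estimate: dilation by 3/2 multiplies the coefficient by (3/2)^|\<alpha>|, while
  the dilated kernel has base of modulus at least 1 - 3/4 and hence is bounded by 4^lam.\<close>

lemma norm_phi_coeff_le:
  fixes \<alpha> :: "int^'n"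
  assumes lam: "lam > 0"
  shows "phi_coeff lam \<alpha> \<le> 4 powr lam * mass_coeff (2/3) \<alpha>"
proof (cases "\<forall>i. \<alpha> $ i \<ge> 0")
  case True
  define e :: "complex^'n" where "e = (\<chi> i. 1)"
  have e: "e \<in> torus" by (simp add: e_def torus_def)
  let ?K = "\<lambda>s::complex^'n. (1 - (\<Sum>i\<in>UNIV. (of_real ((3/2) / (2 * real CARD('n))) * cnj (e $ i)) * s $ i)) powr (- of_real lam)"
  have K: "cmod (?K s) \<le> 4 powr lam" if s: "s \<in> torus" for s
  proof -
    let ?x = "1 - (\<Sum>i\<in>UNIV. (of_real ((3/2) / (2 * real CARD('n))) * cnj (e $ i)) * s $ i)"
    have "cmod (\<Sum>i\<in>UNIV. (of_real ((3/2) / (2 * real CARD('n))) * cnj (e $ i)) * s $ i) \<le>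
        (\<Sum>i\<in>(UNIV::'n set). (3/2) / (2 * real CARD('n)))"
      by (rule order.trans [OF norm_sum]) (simp add: norm_mult norm_divide torus_nth [OF s] e_def)
    also have "\<dots> = 3/4" by simp
    finally have "1/4 \<le> cmod ?x" using norm_triangle_ineq2 [of 1 "1 - ?x"] by simp
    then have "cmod ?x powr (- lam) \<le> (1/4) powr (- lam)"
      using lam by (intro powr_mono2') auto
    also have "\<dots> = 4 powr lam" by (simp add: powr_minus_divide powr_divide)
    finally show ?thesis by (subst norm_powr_real_powr') auto
  qed
  have "of_real (mass_coeff (3/2) \<alpha> * phi_coeff lam \<alpha>) = (LINT s|haar. ?K s * cnj (monomial \<alpha> s))"
    using integral_dilated_kernel [OF lam _ _ e, of "3/2" \<alpha>] by (simp add: e_def monomial_def)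
  then have "mass_coeff (3/2) \<alpha> * phi_coeff lam \<alpha> = cmod (LINT s|haar. ?K s * cnj (monomial \<alpha> s))"
    using phi_coeff_nonneg [OF lam, of \<alpha>] mass_coeff_nonneg [of "3/2" \<alpha>] by (metis abs_of_nonneg mult_nonneg_nonneg norm_of_real divide_nonneg_nonneg zero_le_numeral)
  also have "\<dots> \<le> 4 powr lam"
  proof (cases "integrable haar (\<lambda>s. ?K s * cnj (monomial \<alpha> s))")
    case True
    have "cmod (LINT s|haar. ?K s * cnj (monomial \<alpha> s)) \<le> (LINT s|haar. cmod (?K s * cnj (monomial \<alpha> s)))"
      by (rule integral_norm_bound)
    also have "\<dots> \<le> (LINT s::complex^'n|haar. 4 powr lam)"
      by (rule Bochner_Integration.integral_mono [OF integrable_norm [OF True]]) (use K in \<open>auto simp: norm_mult\<close>)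
    finally show ?thesis by simp
  qed (simp add: not_integrable_integral_eq)
  finally have "mass_coeff (2/3) \<alpha> * (mass_coeff (3/2) \<alpha> * phi_coeff lam \<alpha>) \<le> mass_coeff (2/3) \<alpha> * 4 powr lam"
    by (intro mult_left_mono mass_coeff_nonneg) auto
  moreover have "mass_coeff (2/3) \<alpha> * mass_coeff (3/2) \<alpha> = 1"
    unfolding mass_coeff_eq [OF True] by (simp add: power_mult_distrib [symmetric])
  ultimately show ?thesis unfolding mult.assoc [symmetric] by (simp only: mult_1_left mult.commute [of "4 powr lam"])
next
  case False
  then show ?thesis using phi_coeff_eq_0 [OF False, of lam] by (simp add: mass_coeff_nonneg)
qed

text \<open>Geometric decay survives the square root: the ratio 2/3 becomes sqrt (2/3), still below
  1. This puts \<omega> and the square root operator within reach of absolutely convergent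
  series.\<close>

lemma freq_summable_phi_coeff:
  assumes lam: "lam > 0"
  shows "freq_summable (\<lambda>\<alpha>::int^'n. of_real (phi_coeff lam \<alpha>))"
    and "freq_summable (\<lambda>\<alpha>::int^'n. of_real (sqrt (phi_coeff lam \<alpha>)))"
proof -
  show "freq_summable (\<lambda>\<alpha>::int^'n. of_real (phi_coeff lam \<alpha>))"
    unfolding freq_summable_def
    by (rule summable_comparison_test' [OF summable_mult [OF summable_mass_coeff [of "2/3", where 'n = 'n]], of 0 _ "4 powr lam"])
       (simp_all add: phi_coeff_nonneg [OF lam] norm_phi_coeff_le [OF lam])
  have "sqrt (phi_coeff lam \<alpha>) \<le> sqrt (4 powr lam) * mass_coeff (sqrt (2/3)) \<alpha>" for \<alpha> :: "int^'n"
  proof -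
    have "sqrt (phi_coeff lam \<alpha>) \<le> sqrt (4 powr lam * mass_coeff (2/3) \<alpha>)"
      using norm_phi_coeff_le [OF lam] by simp
    also have "\<dots> = sqrt (4 powr lam) * sqrt (mass_coeff (2/3) \<alpha>)" by (rule real_sqrt_mult)
    also have "sqrt (mass_coeff (2/3) \<alpha>) = mass_coeff (sqrt (2/3)) \<alpha>"
    proof (cases "\<forall>i. \<alpha> $ i \<ge> 0")
      case True
      show ?thesis unfolding mass_coeff_eq [OF True] by (rule real_sqrt_power)
    next
      case False
      show ?thesis unfolding mass_coeff_eq_0 [OF False] by simp
    qed
    finally show ?thesis .
  qed
  then show "freq_summable (\<lambda>\<alpha>::int^'n. of_real (sqrt (phi_coeff lam \<alpha>)))"
    unfolding freq_summable_def
    by (intro summable_comparison_test' [OF summable_mult [OF summable_mass_coeff [of "sqrt (2/3)", where 'n = 'n]], of 0 _ "sqrt (4 powr lam)"])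
       (simp_all add: phi_coeff_nonneg [OF lam])
qed

section \<open>Continuity of \<phi> and convolution with it\<close>

lemma half_le_phi_base:
  assumes "t \<in> torus"
  shows "1 / 2 \<le> Re (1 - (\<Sum>i\<in>UNIV. t $ i) / of_nat (2 * CARD('n::finite)))"
    and "1 / 2 \<le> cmod (1 - (\<Sum>i\<in>UNIV. (t :: complex^'n) $ i) / of_nat (2 * CARD('n)))"
proof -
  let ?z = "(\<Sum>i\<in>UNIV. t $ i) / of_nat (2 * CARD('n))"
  have "cmod (\<Sum>i\<in>UNIV. t $ i) \<le> (\<Sum>i\<in>(UNIV::'n set). 1)"
    by (rule order.trans [OF norm_sum]) (simp add: torus_nth [OF assms])
  then have "cmod ?z \<le> 1 / 2" by (simp add: norm_divide divide_le_eq norm_mult)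
  then have "Re ?z \<le> 1 / 2" using complex_Re_le_cmod [of ?z] by linarith
  then show re: "1 / 2 \<le> Re (1 - ?z)" by simp
  show "1 / 2 \<le> cmod (1 - ?z)" using re complex_Re_le_cmod [of "1 - ?z"] by linarith
qed

lemma continuous_on_phi: "continuous_on torus (phi lam :: complex^'n \<Rightarrow> complex)"
  unfolding phi_def [abs_def]
proof (rule continuous_on_powr_complex)
  show "torus \<subseteq> {t :: complex^'n. 0 \<le> Re (1 - (\<Sum>i\<in>UNIV. t $ i) / of_nat (2 * CARD('n))) \<or>
      Im (1 - (\<Sum>i\<in>UNIV. t $ i) / of_nat (2 * CARD('n))) \<noteq> 0}"
    using half_le_phi_base(1) by fastforce
  show "0 < Re (of_real (- lam))" if "t \<in> torus" "1 - (\<Sum>i\<in>UNIV. t $ i) / of_nat (2 * CARD('n)) = 0"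
    for t :: "complex^'n"
    using half_le_phi_base(1) [OF that(1)] unfolding that(2) by simp
qed (intro continuous_intros; simp)+

lemma integrable_phi: "integrable haar (phi lam :: complex^'n \<Rightarrow> complex)"
  by (rule sq_integrable_imp_integrable [OF sq_integrable_continuous [OF continuous_on_phi]])

lemma torus_divide: "t \<in> torus \<Longrightarrow> s \<in> torus \<Longrightarrow> (\<chi> i. t $ i / s $ i) \<in> torus"
  by (simp add: torus_def norm_divide)

text \<open>On the torus the conjugate of t_i / s_i is cnj t_i s_i. Conjugation thus makes the base
  affine linear in s, the form in which \<open>integral_dilated_kernel\<close> applies with q = 1;
  the base lies off the branch cut, so the principal power commutes with conjugation.\<close>

lemma cnj_phi_divide:
  fixes t s :: "complex^'n"
  assumes t: "t \<in> torus" and s: "s \<in> torus"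
  shows "cnj (phi lam (\<chi> i. t $ i / s $ i)) =
    (1 - (\<Sum>i\<in>UNIV. (of_real (1 / (2 * real CARD('n))) * cnj (t $ i)) * s $ i)) powr (- of_real lam)"
proof -
  have c: "cnj (t $ i / s $ i) = cnj (t $ i) * s $ i" for i
  proof -
    have "inverse (cnj (s $ i)) = s $ i"
      using torus_nth [OF s, of i] by (simp add: inverse_complex_def complex_eq_iff cmod_def)
    then show ?thesis by (simp add: divide_inverse)
  qed
  let ?x = "1 - (\<Sum>i\<in>UNIV. (\<chi> i. t $ i / s $ i) $ i) / of_nat (2 * CARD('n))"
  have "cnj (phi lam (\<chi> i. t $ i / s $ i)) = cnj ?x powr cnj (of_real (- lam))"
    unfolding phi_def using half_le_phi_base(1) [OF torus_divide [OF t s]] by (intro cnj_powr) simp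
  also have "cnj ?x = 1 - (\<Sum>i\<in>UNIV. (of_real (1 / (2 * real CARD('n))) * cnj (t $ i)) * s $ i)"
  proof -
    have "cnj ?x = 1 - (\<Sum>i\<in>UNIV. cnj (t $ i / s $ i)) / of_nat (2 * CARD('n))" by simp
    then show ?thesis unfolding c by (simp add: sum_divide_distrib)
  qed
  finally show ?thesis by simp
qed

lemma mass_coeff_1_phi_coeff: "mass_coeff 1 \<alpha> * phi_coeff lam \<alpha> = phi_coeff lam \<alpha>"
  by (cases "\<forall>i. \<alpha> $ i \<ge> 0") (simp_all add: mass_coeff_eq phi_coeff_eq_0)

lemma fourier_cnj_phi_divide:
  fixes t :: "complex^'n"
  assumes "lam > 0" "t \<in> torus"
  shows "fourier (\<lambda>s. cnj (phi lam (\<chi> i. t $ i / s $ i))) \<alpha> = of_real (phi_coeff lam \<alpha>) * cnj (monomial \<alpha> t)"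
proof -
  have "fourier (\<lambda>s. cnj (phi lam (\<chi> i. t $ i / s $ i))) \<alpha> =
      (LINT s|haar. (1 - (\<Sum>i\<in>UNIV. (of_real (1 / (2 * real CARD('n))) * cnj (t $ i)) * s $ i)) powr (- of_real lam) * cnj (monomial \<alpha> s))"
    unfolding fourier_def by (intro Bochner_Integration.integral_cong) (simp_all add: cnj_phi_divide assms(2))
  then show ?thesis
    using integral_dilated_kernel [OF assms(1) _ _ assms(2), of 1 \<alpha>] by (simp add: mass_coeff_1_phi_coeff)
qed

lemma fourier_phi:
  assumes lam: "lam > 0"
  shows "fourier (phi lam) \<alpha> = of_real (phi_coeff lam \<alpha>)"
proof -
  define e :: "complex^'a" where "e = (\<chi> i. 1)"
  have "(1 - (\<Sum>i\<in>UNIV. (of_real (1 / (2 * real CARD('a))) * cnj (e $ i)) * s $ i)) powr (- of_real lam) = phi lam s" for s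
    by (simp add: phi_def e_def sum_divide_distrib)
  moreover have "e \<in> torus" by (simp add: e_def torus_def)
  ultimately show ?thesis
    using integral_dilated_kernel [OF lam _ _ \<open>e \<in> torus\<close>, of 1 \<alpha>]
    by (simp add: fourier_def mass_coeff_1_phi_coeff) (simp add: e_def monomial_def)
qed

lemma continuous_on_phi_divide:
  assumes t: "t \<in> torus"
  shows "continuous_on torus (\<lambda>s. phi lam (\<chi> i. t $ i / s $ i))"
  by (rule continuous_on_compose2 [OF continuous_on_phi])
     (auto intro!: continuous_intros continuous_on_vec_lambda simp: torus_nth_nonzero torus_divide [OF t])

text \<open>
  Both \<open>s \<mapsto> \<phi>(t/s)\<close> and the corresponding Fourier series have the same Fourier coefficients, so
  they may be exchanged under the integral sign for every single \<open>t\<close>.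
\<close>

lemma conv_phi:
  fixes g :: "complex^'n \<Rightarrow> complex"
  assumes lam: "lam > 0" and g: "sq_integrable g" and t: "t \<in> torus"
  shows "conv g (phi lam) t = fourier_series (\<lambda>\<alpha>. of_real (phi_coeff lam \<alpha>) * fourier g \<alpha>) t"
proof -
  let ?k = "\<lambda>s. cnj (phi lam (\<chi> i. t $ i / s $ i))"
  let ?c = "\<lambda>\<alpha>. of_real (phi_coeff lam \<alpha>) * cnj (monomial \<alpha> t)"
  have k: "sq_integrable ?k"
    by (intro sq_integrable_continuous continuous_on_cnj continuous_on_phi_divide t)
  have c: "freq_summable ?c"
    by (rule freq_summable_mult [OF freq_summable_phi_coeff(1) [OF lam], of _ 1]) (simp add: t)
  have "AE s in haar. ?k s = fourier_series ?c s"
    by (rule fourier_unique_AE [OF k sq_integrable_fourier_series [OF c]])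
       (simp add: fourier_fourier_series [OF c] fourier_cnj_phi_divide [OF lam t])
  then have ae: "AE s in haar. ?k s * cnj (g s) = fourier_series ?c s * cnj (g s)" by auto
  have gi: "integrable haar (\<lambda>s. cnj (g s))" using sq_integrable_imp_integrable [OF g] by simp
  have "cnj (conv g (phi lam) t) = (LINT s|haar. cnj (g s * phi lam (\<chi> i. t $ i / s $ i)))"
    unfolding conv_def by (rule Bochner_Integration.integral_cnj [symmetric])
  also have "\<dots> = (LINT s|haar. ?k s * cnj (g s))" by (simp add: mult.commute)
  also have "\<dots> = (LINT s|haar. fourier_series ?c s * cnj (g s))"
  proof (rule integral_cong_AE [OF _ _ ae])
    show "(\<lambda>s. ?k s * cnj (g s)) \<in> borel_measurable haar"
      using sq_integrable_mult_cnj [OF k g] by (rule borel_measurable_integrable)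
    show "(\<lambda>s. fourier_series ?c s * cnj (g s)) \<in> borel_measurable haar"
      using sq_integrable_mult_cnj [OF sq_integrable_fourier_series [OF c] g] by (rule borel_measurable_integrable)
  qed
  finally have e: "cnj (conv g (phi lam) t) = (LINT s|haar. fourier_series ?c s * cnj (g s))" .
  have coeff: "(LINT s|haar. monomial \<alpha> s * cnj (g s)) = cnj (fourier g \<alpha>)" for \<alpha>
  proof -
    have "cnj (fourier g \<alpha>) = (LINT s|haar. cnj (g s * cnj (monomial \<alpha> s)))"
      unfolding fourier_def by (rule Bochner_Integration.integral_cnj [symmetric])
    then show ?thesis by (simp add: mult.commute)
  qed
  have "(\<lambda>k. cnj (?c (freq k) * cnj (fourier g (freq k)))) sums cnj (cnj (conv g (phi lam) t))"
    using integral_fourier_series_mult [OF c gi] unfolding e coeff by (simp only: sums_cnj)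
  then show ?thesis by (simp add: fourier_series_def sums_iff mult_ac)
qed

section \<open>Equivariant functions\<close>

text \<open>An angle in units of a full turn. The case split makes it Borel: \<open>Arg\<close> is
  continuous off the closed negative axis, and the constant 1/2 on the axis is the right angle of
  -1, the only point of the unit circle there.\<close>

definition unit_angle :: "complex \<Rightarrow> real" where
  "unit_angle z = (if z \<in> \<real>\<^sub>\<le>\<^sub>0 then 1 / 2 else Arg z / (2 * pi))"

lemma unit_angle_measurable [measurable]: "unit_angle \<in> borel_measurable borel"
  unfolding unit_angle_def [abs_def]
  by (rule borel_measurable_continuous_on_if)
     (auto intro!: continuous_intros continuous_at_imp_continuous_on continuous_at_Arg simp: borel_closed)

lemma cis_unit_angle:
  assumes "cmod z = 1"
  shows "cis (2 * pi * unit_angle z) = z"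
proof (cases "z \<in> \<real>\<^sub>\<le>\<^sub>0")
  case True
  then have "Im z = 0" "Re z \<le> 0" by (auto simp: complex_nonpos_Reals_iff)
  moreover from this assms have "Re z = - 1" by (simp add: cmod_eq_Re)
  ultimately have "z = - 1" by (simp add: complex_eq_iff)
  then show ?thesis by (simp add: unit_angle_def)
next
  case False
  then show ?thesis using rcis_cmod_Arg [of z] assms by (simp add: unit_angle_def rcis_def)
qed

text \<open>A Borel section of \<open>Etilde\<close> over the torus, obtained by solving the
  defining equation of \<open>Etilde\<close> for x. It is needed to carry measurability from
  \<open>Etilde\<close> down to the torus.\<close>

definition section_angle :: "complex^'n \<Rightarrow> real" where
  "section_angle t = - unit_angle (\<Prod>i\<in>UNIV. t $ i) / (real CARD('n) + 1)"

lemma Etilde_section: "t \<in> torus \<Longrightarrow> (t, section_angle t) \<in> Etilde"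
proof -
  assume t: "t \<in> torus"
  let ?p = "\<Prod>i\<in>UNIV. t $ i"
  have p: "cmod ?p = 1" by (simp add: prod_norm [symmetric] torus_nth [OF t])
  define N where "N = real CARD('a) + 1"
  have "N \<noteq> 0" unfolding N_def by (smt (verit) of_nat_0_le_iff)
  then have "2 * pi * N * section_angle t = - (2 * pi * unit_angle ?p)"
    by (simp add: section_angle_def N_def [symmetric])
  then have "cis (2 * pi * N * section_angle t) * ?p = cis (- (2 * pi * unit_angle ?p)) * cis (2 * pi * unit_angle ?p)"
    by (simp only: cis_unit_angle [OF p])
  also have "\<dots> = 1" by (simp only: cis_mult) simp
  finally show ?thesis using t unfolding N_def by (simp add: Etilde_def)
qed

lemma Etilde_torus: "(t, x) \<in> Etilde \<Longrightarrow> t \<in> torus"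
  by (simp add: Etilde_def)

lemma section_measurable:
  "(\<lambda>t. (t, section_angle t)) \<in> restrict_space borel torus \<rightarrow>\<^sub>M restrict_space borel (Etilde :: ((complex^'n) \<times> real) set)"
proof (rule measurable_restrict_space2)
  have [measurable]: "(\<lambda>t::complex^'n. \<Prod>i\<in>UNIV. t $ i) \<in> borel_measurable borel"
    by (intro borel_measurable_continuous_onI continuous_intros)
  have "section_angle \<in> borel_measurable (borel :: (complex^'n) measure)"
    unfolding section_angle_def [abs_def] by measurable
  then show "(\<lambda>t. (t, section_angle t)) \<in> borel_measurable (restrict_space borel (torus :: (complex^'n) set))"
    by (intro borel_measurable_Pair measurable_restrict_space1) auto
qed (auto simp: space_restrict_space Etilde_section)

text \<open>The inverse of \<open>tilde\<close>, up to values off the torus and off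
  \<open>Etilde\<close>; it identifies square integrable functions on the torus with
  \<open>L2chi\<close>.\<close>

definition lift :: "real \<Rightarrow> (complex^'n \<Rightarrow> complex) \<Rightarrow> (complex^'n) \<times> real \<Rightarrow> complex" where
  "lift lam g = (\<lambda>(t, x). cis (- 2 * pi * lam * x) * g t)"

lemma restr_eq_lift:
  "restr lam f = lift lam (\<lambda>t. f (\<chi> i. t $ i / of_real (sqrt (2 * real CARD('n)))))"
  for f :: "complex^'n \<Rightarrow> complex"
  by (simp add: restr_def lift_def)

lemma L2chi_measurable: "f \<in> vecs (L2chi lam) \<Longrightarrow> f \<in> borel_measurable (restrict_space borel Etilde)"
  by (simp add: L2chi_def)

lemma L2chi_equivariant:
  fixes f :: "(complex^'n) \<times> real \<Rightarrow> complex"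
  assumes "f \<in> vecs (L2chi lam)" "(t, x) \<in> Etilde"
  shows "f (t, x + of_int m / (real CARD('n) + 1)) = cis (- 2 * pi * lam * of_int m / (real CARD('n) + 1)) * f (t, x)"
  using assms unfolding L2chi_def by force

lemma L2chi_eq_tilde:
  assumes f: "f \<in> vecs (L2chi lam)" and tx: "(t, x) \<in> Etilde"
  shows "f (t, x) = cis (- 2 * pi * lam * x) * tilde lam f t"
  unfolding tilde_eq [OF f tx] mult.assoc [symmetric] cis_mult by simp

lemma descend_constant:
  assumes "t \<in> torus" "\<And>x. (t, x) \<in> Etilde \<Longrightarrow> F (t, x) = w"
  shows "descend F t = w"
  using descend_eq [OF Etilde_section [OF assms(1)], of F] assms(2) Etilde_section [OF assms(1)] by metis

lemma sq_integrable_tilde: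
  assumes f: "f \<in> vecs (L2chi lam)"
  shows "sq_integrable (tilde lam f)"
  unfolding sq_integrable_def
proof
  \<comment> \<open>\<open>descend\<close> is a definite description and yields no measurability by
    itself; composition with the Borel section does.\<close>
  have "(\<lambda>t. cis (2 * pi * lam * section_angle t) * f (t, section_angle t)) \<in> borel_measurable haar"
  proof -
    have "(\<lambda>p. cis (2 * pi * lam * snd p) * f p) \<in> borel_measurable (restrict_space borel Etilde)"
      by (intro borel_measurable_times L2chi_measurable [OF f] measurable_restrict_space1
          borel_measurable_continuous_onI continuous_intros)
    from measurable_compose [OF section_measurable this] show ?thesis by (simp add: borel_measurable_haar)
  qed
  then show "tilde lam f \<in> borel_measurable haar"
    by (subst measurable_cong [where g = "\<lambda>t. cis (2 * pi * lam * section_angle t) * f (t, section_angle t)"])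
       (auto simp: tilde_eq [OF f Etilde_section])
  have "descend (\<lambda>p. cmod (f p)) t = cmod (tilde lam f t)" if "t \<in> torus" for t
    by (rule descend_constant [OF that]) (simp add: L2chi_eq_tilde [OF f] norm_mult)
  moreover have "integrable haar (\<lambda>t. (descend (\<lambda>p. cmod (f p)) t)\<^sup>2)" using f by (simp add: L2chi_def)
  ultimately show "integrable haar (\<lambda>t. (cmod (tilde lam f t))\<^sup>2)"
    by (subst Bochner_Integration.integrable_cong [OF refl]) auto
qed

lemma L2chi_I:
  fixes f :: "(complex^'n) \<times> real \<Rightarrow> complex"
  assumes "f \<in> borel_measurable (restrict_space borel Etilde)"
    and "\<And>t x m. (t, x) \<in> Etilde \<Longrightarrow>
      f (t, x + of_int m / (real CARD('n) + 1)) = cis (- 2 * pi * lam * of_int m / (real CARD('n) + 1)) * f (t, x)"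
    and g: "sq_integrable g" and fg: "\<And>t x. (t, x) \<in> Etilde \<Longrightarrow> cmod (f (t, x)) = cmod (g t)"
  shows "f \<in> vecs (L2chi lam)"
proof -
  have "descend (\<lambda>p. cmod (f p)) t = cmod (g t)" if "t \<in> torus" for t
    by (rule descend_constant [OF that]) (simp add: fg)
  moreover have "integrable haar (\<lambda>t. (cmod (g t))\<^sup>2)" using g by (simp add: sq_integrable_def)
  ultimately have "integrable haar (\<lambda>t. (descend (\<lambda>p. cmod (f p)) t)\<^sup>2)"
    by (subst Bochner_Integration.integrable_cong [OF refl]) auto
  then show ?thesis using assms(1,2) unfolding L2chi_def by auto
qed

lemma lift_in_L2chi:
  fixes g :: "complex^'n \<Rightarrow> complex"
  assumes g: "sq_integrable g"
  shows "lift lam g \<in> vecs (L2chi lam)"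
proof (rule L2chi_I [OF _ _ g])
  have gm: "g \<in> borel_measurable (restrict_space borel torus)"
    using g by (simp add: sq_integrable_def borel_measurable_haar)
  have "fst \<in> restrict_space borel Etilde \<rightarrow>\<^sub>M restrict_space borel (torus :: (complex^'n) set)"
    by (intro measurable_restrict_space2 measurable_restrict_space1 borel_measurable_continuous_onI continuous_intros)
       (auto simp: space_restrict_space Etilde_torus)
  from measurable_compose [OF this gm]
  have "(\<lambda>p. g (fst p)) \<in> borel_measurable (restrict_space borel Etilde)" .
  then show "lift lam g \<in> borel_measurable (restrict_space borel Etilde)"
    unfolding lift_def case_prod_beta'
    by (intro borel_measurable_times measurable_restrict_space1 [of "\<lambda>p. cis (- 2 * pi * lam * snd p)"]
        borel_measurable_continuous_onI continuous_intros)
  show "lift lam g (t, x + of_int m / (real CARD('n) + 1)) =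
      cis (- 2 * pi * lam * of_int m / (real CARD('n) + 1)) * lift lam g (t, x)" for t x m
    unfolding lift_def prod.case mult.assoc [symmetric] cis_mult by (simp add: algebra_simps)
qed (simp add: lift_def norm_mult)

lemma tilde_lift:
  assumes t: "t \<in> torus"
  shows "tilde lam (lift lam g) t = g t"
  unfolding tilde_def
  by (rule descend_constant [OF t]) (simp add: lift_def mult.assoc [symmetric] cis_mult)

lemma L2chi_lincomb:
  fixes f g :: "(complex^'n) \<times> real \<Rightarrow> complex"
  assumes f: "f \<in> vecs (L2chi lam)" and g: "g \<in> vecs (L2chi lam)"
  shows "(\<lambda>p. a * f p + b * g p) \<in> vecs (L2chi lam)"
proof (rule L2chi_I)
  show "(\<lambda>p. a * f p + b * g p) \<in> borel_measurable (restrict_space borel Etilde)"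
    using L2chi_measurable [OF f] L2chi_measurable [OF g] by measurable
  show "sq_integrable (\<lambda>t. a * tilde lam f t + b * tilde lam g t)"
    by (intro sq_integrable_add sq_integrable_cmult sq_integrable_tilde f g)
next
  fix t x m assume "(t :: complex^'n, x) \<in> Etilde"
  then show "a * f (t, x + of_int m / (real CARD('n) + 1)) + b * g (t, x + of_int m / (real CARD('n) + 1)) =
      cis (- 2 * pi * lam * of_int m / (real CARD('n) + 1)) * (a * f (t, x) + b * g (t, x))"
    unfolding L2chi_equivariant [OF f \<open>(t, x) \<in> Etilde\<close>] L2chi_equivariant [OF g \<open>(t, x) \<in> Etilde\<close>]
    by (simp add: distrib_left mult.left_commute)
next
  fix t x assume "(t :: complex^'n, x) \<in> Etilde"
  then have "a * f (t, x) + b * g (t, x) = cis (- 2 * pi * lam * x) * (a * tilde lam f t + b * tilde lam g t)"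
    unfolding L2chi_eq_tilde [OF f \<open>(t, x) \<in> Etilde\<close>] L2chi_eq_tilde [OF g \<open>(t, x) \<in> Etilde\<close>]
    by (simp add: distrib_left mult.left_commute)
  then show "cmod (a * f (t, x) + b * g (t, x)) = cmod (a * tilde lam f t + b * tilde lam g t)"
    by (simp add: norm_mult)
qed

lemma tilde_lincomb:
  assumes f: "f \<in> vecs (L2chi lam)" and g: "g \<in> vecs (L2chi lam)" and t: "t \<in> torus"
  shows "tilde lam (\<lambda>p. a * f p + b * g p) t = a * tilde lam f t + b * tilde lam g t"
  using tilde_eq [OF L2chi_lincomb [OF f g] Etilde_section [OF t]]
    tilde_eq [OF f Etilde_section [OF t]] tilde_eq [OF g Etilde_section [OF t]]
  by (simp add: distrib_left mult.left_commute)

lemma ip_L2chi: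
  assumes f: "f \<in> vecs (L2chi lam)" and g: "g \<in> vecs (L2chi lam)"
  shows "ip (L2chi lam) f g = (LINT t|haar. tilde lam f t * cnj (tilde lam g t))"
proof -
  have "descend (\<lambda>p. f p * cnj (g p)) t = tilde lam f t * cnj (tilde lam g t)" if t: "t \<in> torus" for t
  proof (rule descend_constant [OF t])
    fix x assume tx: "(t, x) \<in> Etilde"
    define c where "c = cis (- 2 * pi * lam * x)"
    have c: "c * cnj c = 1" by (simp add: c_def cis_cnj cis_mult)
    have "f (t, x) * cnj (g (t, x)) = (c * cnj c) * (tilde lam f t * cnj (tilde lam g t))"
      unfolding L2chi_eq_tilde [OF f tx] L2chi_eq_tilde [OF g tx] complex_cnj_mult c_def [symmetric]
      by (simp only: mult_ac)
    then show "f (t, x) * cnj (g (t, x)) = tilde lam f t * cnj (tilde lam g t)" by (simp only: c mult_1_left)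
  qed
  then show ?thesis unfolding L2chi_def ip_space.simps
    by (intro Bochner_Integration.integral_cong) auto
qed

lemma nrm_L2chi:
  assumes f: "f \<in> vecs (L2chi lam)"
  shows "nrm (L2chi lam) f = sqrt (LINT t|haar. (cmod (tilde lam f t))\<^sup>2)"
proof -
  have "ip (L2chi lam) f f = (LINT t|haar. complex_of_real ((cmod (tilde lam f t))\<^sup>2))"
    unfolding ip_L2chi [OF f f] by (simp only: complex_norm_square)
  also have "\<dots> = of_real (LINT t|haar. (cmod (tilde lam f t))\<^sup>2)" by (rule integral_complex_of_real)
  finally show ?thesis by (simp add: nrm_def)
qed

section \<open>Positive square roots\<close>

text \<open>Only a semi-inner product, since functions that agree almost everywhere are different
  vectors at distance 0. Equality of vectors is replaced by \<open>same_in\<close> or by equality of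
  inner products.\<close>

locale semi_inner_product =
  fixes H :: "'a ip_space"
  assumes vecs_lincomb: "f \<in> vecs H \<Longrightarrow> g \<in> vecs H \<Longrightarrow> (\<lambda>p. a * f p + b * g p) \<in> vecs H"
    and ip_lincomb: "f \<in> vecs H \<Longrightarrow> g \<in> vecs H \<Longrightarrow> h \<in> vecs H \<Longrightarrow>
      ip H (\<lambda>p. a * f p + b * g p) h = a * ip H f h + b * ip H g h"
    and ip_cnj: "f \<in> vecs H \<Longrightarrow> g \<in> vecs H \<Longrightarrow> cnj (ip H f g) = ip H g f"
    and ip_nonneg: "f \<in> vecs H \<Longrightarrow> 0 \<le> Re (ip H f f)"
begin

lemma vecs_diff: "f \<in> vecs H \<Longrightarrow> g \<in> vecs H \<Longrightarrow> (\<lambda>p. f p - g p) \<in> vecs H"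
  using vecs_lincomb [of f g 1 "- 1"] by simp

lemma ip_diff: "f \<in> vecs H \<Longrightarrow> g \<in> vecs H \<Longrightarrow> h \<in> vecs H \<Longrightarrow>
    ip H (\<lambda>p. f p - g p) h = ip H f h - ip H g h"
  using ip_lincomb [of f g h 1 "- 1"] by simp

lemma ip_lincomb_right:
  assumes "f \<in> vecs H" "g \<in> vecs H" "h \<in> vecs H"
  shows "ip H h (\<lambda>p. a * f p + b * g p) = cnj a * ip H h f + cnj b * ip H h g"
proof -
  have "cnj (ip H (\<lambda>p. a * f p + b * g p) h) = cnj (a * ip H f h + b * ip H g h)"
    using ip_lincomb assms by simp
  then show ?thesis using assms by (simp add: ip_cnj vecs_lincomb)
qed

lemma ip_self: "f \<in> vecs H \<Longrightarrow> ip H f f = of_real ((nrm H f)\<^sup>2)"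
  using ip_cnj [of f f] ip_nonneg [of f] by (simp add: nrm_def complex_eq_iff)

lemma nrm_nonneg: "f \<in> vecs H \<Longrightarrow> 0 \<le> nrm H f"
  using ip_nonneg by (simp add: nrm_def)

lemma Cauchy_Schwarz:
  assumes f: "f \<in> vecs H" and g: "g \<in> vecs H"
  shows "cmod (ip H f g) \<le> nrm H f * nrm H g"
proof -
  define c where "c = ip H f g"
  define A where "A = (nrm H f)\<^sup>2"
  define B where "B = (nrm H g)\<^sup>2"
  \<comment> \<open>The squared norm of f - r c g for real r; for B > 0 its minimum is at r =
    1/B.\<close>
  have key: "0 \<le> A - 2 * r * (cmod c)\<^sup>2 + r\<^sup>2 * (cmod c)\<^sup>2 * B" for r :: real
  proof -
    let ?a = "- (of_real r * c)"
    have gf: "ip H g f = cnj c" using ip_cnj [OF f g] by (simp add: c_def)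
    have "ip H (\<lambda>p. 1 * f p + ?a * g p) (\<lambda>p. 1 * f p + ?a * g p) =
        of_real A + ?a * cnj c + cnj ?a * (c + ?a * of_real B)"
      by (simp only: ip_lincomb [OF f g vecs_lincomb [OF f g]] ip_lincomb_right [OF f g f] ip_lincomb_right [OF f g g]
          ip_self [OF f] ip_self [OF g] gf c_def [symmetric] A_def [symmetric] B_def [symmetric] complex_cnj_one)
        (simp add: algebra_simps)
    also have "\<dots> = of_real (A - 2 * r * (cmod c)\<^sup>2 + r\<^sup>2 * (cmod c)\<^sup>2 * B)"
    proof -
      have "of_real A + ?a * cnj c + cnj ?a * (c + ?a * of_real B) =
          of_real A - 2 * of_real r * (c * cnj c) + (of_real r)\<^sup>2 * (c * cnj c) * of_real B"
        by (simp add: algebra_simps power2_eq_square)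
      also have "c * cnj c = of_real ((cmod c)\<^sup>2)" by (rule complex_norm_square [symmetric])
      finally show ?thesis by simp
    qed
    finally show ?thesis using ip_nonneg [OF vecs_lincomb [OF f g, of 1 ?a]] by simp
  qed
  have "(cmod c)\<^sup>2 \<le> A * B"
  proof (cases "B = 0")
    case True
    have "(cmod c)\<^sup>2 = 0"
    proof (rule ccontr)
      assume "(cmod c)\<^sup>2 \<noteq> 0"
      \<comment> \<open>For B = 0 the form is affine in r, and this r gives it the value -1.\<close>
      then show False using key [of "(A + 1) / (2 * (cmod c)\<^sup>2)"] True by simp
    qed
    then show ?thesis using True by simp
  next
    case False
    then have B: "B > 0" by (simp add: B_def)
    have "0 \<le> (A - 2 * (1 / B) * (cmod c)\<^sup>2 + (1 / B)\<^sup>2 * (cmod c)\<^sup>2 * B) * B"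
      using key [of "1 / B"] B by (intro mult_nonneg_nonneg) auto
    also have "\<dots> = A * B - (cmod c)\<^sup>2" using B by (simp add: field_simps power2_eq_square)
    finally show ?thesis by simp
  qed
  also have "A * B = (nrm H f * nrm H g)\<^sup>2" by (simp add: A_def B_def power_mult_distrib)
  finally show ?thesis unfolding c_def
    by (rule power2_le_imp_le) (intro mult_nonneg_nonneg nrm_nonneg f g)
qed

lemma same_in_ip:
  assumes "same_in H f g" "f \<in> vecs H" "g \<in> vecs H" "h \<in> vecs H"
  shows "ip H f h = ip H g h"
proof -
  have "cmod (ip H (\<lambda>p. f p - g p) h) \<le> 0"
    using Cauchy_Schwarz [OF vecs_diff [OF assms(2,3)] assms(4)] assms(1) by (simp add: same_in_def)
  then show ?thesis using ip_diff assms by simp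
qed

text \<open>Complex polarisation: the form \<open>b\<close> measures the failure of symmetry and
  vanishes on the diagonal because <S h, h> is real. Testing it on f + g and f + i g forces b f g =
  0.\<close>

lemma positive_imp_symmetric:
  assumes S: "bounded_op H H S" and real: "\<And>f. f \<in> vecs H \<Longrightarrow> ip H (S f) f \<in> \<real>"
    and f: "f \<in> vecs H" and g: "g \<in> vecs H"
  shows "ip H (S f) g = ip H f (S g)"
proof -
  have Sv: "S h \<in> vecs H" if "h \<in> vecs H" for h using S that by (simp add: bounded_op_def)
  define b where "b u v = ip H (S u) v - ip H u (S v)" for u v
  have diag: "b h h = 0" if h: "h \<in> vecs H" for h
  proof -
    have "cnj (ip H (S h) h) = ip H (S h) h" using real [OF h] by (simp add: Reals_cnj_iff)
    then show ?thesis using ip_cnj [OF Sv [OF h] h] by (simp add: b_def)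
  qed
  have expand: "b (\<lambda>p. 1 * f p + a * g p) (\<lambda>p. 1 * f p + a * g p) = cnj a * b f g + a * b g f" for a
  proof -
    let ?h = "\<lambda>p. 1 * f p + a * g p"
    have h: "?h \<in> vecs H" by (rule vecs_lincomb [OF f g])
    have Sh: "(\<lambda>p. 1 * S f p + a * S g p) \<in> vecs H" by (intro vecs_lincomb Sv f g)
    \<comment> \<open>\<open>S\<close> is linear only up to null vectors, so linearity is used
      inside \<open>ip\<close>, which does not see them.\<close>
    have same: "same_in H (S ?h) (\<lambda>p. 1 * S f p + a * S g p)"
      using S f g unfolding bounded_op_def by blast
    have 1: "ip H (S ?h) ?h = ip H (\<lambda>p. 1 * S f p + a * S g p) ?h"
      by (rule same_in_ip [OF same Sv [OF h] Sh h])
    have 2: "ip H ?h (S ?h) = ip H ?h (\<lambda>p. 1 * S f p + a * S g p)"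
      using same_in_ip [OF same Sv [OF h] Sh h] ip_cnj [OF Sv [OF h] h] ip_cnj [OF Sh h] by simp
    have "b ?h ?h = b f f + cnj a * b f g + a * b g f + a * cnj a * b g g"
      unfolding b_def 1 2
      by (simp only: ip_lincomb [OF Sv [OF f] Sv [OF g] h] ip_lincomb [OF f g Sh]
          ip_lincomb_right [OF f g Sv [OF f]] ip_lincomb_right [OF f g Sv [OF g]]
          ip_lincomb_right [OF Sv [OF f] Sv [OF g] f] ip_lincomb_right [OF Sv [OF f] Sv [OF g] g])
        (simp add: algebra_simps)
    then show ?thesis using diag [OF f] diag [OF g] by simp
  qed
  have "cnj 1 * b f g + 1 * b g f = 0" "cnj \<i> * b f g + \<i> * b g f = 0"
    using expand [of 1] expand [of \<i>] diag [OF vecs_lincomb [OF f g]] by metis+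
  then have "b f g + b g f = 0" "\<i> * (b g f - b f g) = 0" by (simp_all add: algebra_simps)
  then have "b f g = 0" by simp
  then show ?thesis by (simp add: b_def)
qed

text \<open>
  With \<open>u = S v - \<surd>c v\<close>, the vector \<open>S u + \<surd>c u = S\<^sup>2 v - c v\<close> vanishes; as \<open>S \<ge> 0\<close>, this forces
  \<open>u = 0\<close> if \<open>c > 0\<close>.
\<close>

lemma positive_sqrt_eigenvector:
  assumes S: "bounded_op H H S"
    and pos: "\<And>f. f \<in> vecs H \<Longrightarrow> ip H (S f) f \<in> \<real> \<and> 0 \<le> Re (ip H (S f) f)"
    and v: "v \<in> vecs H" and c: "c \<ge> 0" and eig: "same_in H (S (S v)) (\<lambda>p. of_real c * v p)"
    and f: "f \<in> vecs H"
  shows "ip H (S v) f = of_real (sqrt c) * ip H v f"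
proof -
  have Sv: "S h \<in> vecs H" if "h \<in> vecs H" for h using S that by (simp add: bounded_op_def)
  have sym: "ip H (S h) h' = ip H h (S h')" if "h \<in> vecs H" "h' \<in> vecs H" for h h'
    by (rule positive_imp_symmetric [OF S _ that]) (use pos in blast)
  define q where "q = sqrt c"
  have q: "q \<ge> 0" "of_real c = complex_of_real q * of_real q" using c by (simp_all add: q_def flip: of_real_mult)
  define u where "u = (\<lambda>p. 1 * S v p + (- of_real q) * v p)"
  have u: "u \<in> vecs H" unfolding u_def by (intro vecs_lincomb Sv v)
  have cv: "(\<lambda>p. of_real c * v p) \<in> vecs H" using vecs_lincomb [OF v v, of "of_real c" 0] by simp
  have SSv: "ip H (S (S v)) h = of_real c * ip H v h" if "h \<in> vecs H" for h
    using same_in_ip [OF eig Sv [OF Sv [OF v]] cv that] ip_lincomb [OF v v that, of "of_real c" 0] by simp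
  have "ip H (S u) u = ip H u (S u)" by (rule sym [OF u u])
  have Su: "ip H (S u) h = - of_real q * ip H u h" if h: "h \<in> vecs H" for h
  proof -
    have "ip H (S u) h = ip H u (S h)" by (rule sym [OF u h])
    also have "\<dots> = ip H (S v) (S h) + (- of_real q) * ip H v (S h)"
      unfolding u_def using ip_lincomb [OF Sv [OF v] v Sv [OF h], of 1 "- of_real q"] by simp
    also have "\<dots> = of_real c * ip H v h + (- of_real q) * ip H (S v) h"
      using sym [OF Sv [OF v] h] SSv [OF h] sym [OF v h] by simp
    also have "\<dots> = - of_real q * (ip H (S v) h + (- of_real q) * ip H v h)"
      unfolding q(2) by (simp add: algebra_simps)
    also have "ip H (S v) h + (- of_real q) * ip H v h = ip H u h"
      unfolding u_def using ip_lincomb [OF Sv [OF v] v h, of 1 "- of_real q"] by simp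
    finally show ?thesis .
  qed
  have "nrm H u = 0"
  proof (cases "q = 0")
    case True
    \<comment> \<open>For q = 0 positivity of \<open>S\<close> yields nothing; here u = S v, and
      symmetry reduces its norm to <S (S v), v> = 0.\<close>
    have "ip H u u = ip H (S v) (S v)" by (simp add: u_def True)
    also have "\<dots> = ip H (S (S v)) v" using sym [OF Sv [OF v] v] by simp
    also have "\<dots> = 0" using SSv [OF v] q(2) True by simp
    finally show ?thesis using ip_self [OF u] by simp
  next
    case False
    have "ip H (S u) u = of_real (- q * (nrm H u)\<^sup>2)" using Su [OF u] ip_self [OF u] by simp
    then have "0 \<le> - q * (nrm H u)\<^sup>2" using pos [OF u] by simp
    then show ?thesis using False q(1) by (simp add: mult_le_0_iff)
  qed
  then have "ip H u f = 0" using Cauchy_Schwarz [OF u f] by simp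
  then show ?thesis
    unfolding u_def using ip_lincomb [OF Sv [OF v] v f, of 1 "- of_real q"] by (simp add: q_def)
qed

end

lemma integral_cnj_mult_swap:
  "cnj (LINT t|M. f t * cnj (g t)) = (LINT t|M. g t * cnj (f t))"
proof -
  have "cnj (LINT t|M. f t * cnj (g t)) = (LINT t|M. cnj (f t * cnj (g t)))"
    by (rule Bochner_Integration.integral_cnj [symmetric])
  then show ?thesis by (simp add: mult.commute)
qed

lemma semi_inner_product_L2chi: "semi_inner_product (L2chi lam :: ((complex^'n) \<times> real) ip_space)"
proof
  fix f g h :: "(complex^'n) \<times> real \<Rightarrow> complex" and a b
  assume f: "f \<in> vecs (L2chi lam)" and g: "g \<in> vecs (L2chi lam)"
  show fg: "(\<lambda>p. a * f p + b * g p) \<in> vecs (L2chi lam)" by (rule L2chi_lincomb [OF f g])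
  show "cnj (ip (L2chi lam) f g) = ip (L2chi lam) g f"
    unfolding ip_L2chi [OF f g] ip_L2chi [OF g f] by (rule integral_cnj_mult_swap)
  assume h: "h \<in> vecs (L2chi lam)"
  have "ip (L2chi lam) (\<lambda>p. a * f p + b * g p) h =
      (LINT t|haar. a * (tilde lam f t * cnj (tilde lam h t)) + b * (tilde lam g t * cnj (tilde lam h t)))"
    unfolding ip_L2chi [OF fg h]
    by (intro Bochner_Integration.integral_cong) (simp_all add: tilde_lincomb [OF f g] algebra_simps)
  also have "\<dots> = (LINT t|haar. a * (tilde lam f t * cnj (tilde lam h t))) + (LINT t|haar. b * (tilde lam g t * cnj (tilde lam h t)))"
    by (intro Bochner_Integration.integral_add integrable_mult_right sq_integrable_mult_cnj sq_integrable_tilde f g h)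
  finally show "ip (L2chi lam) (\<lambda>p. a * f p + b * g p) h = a * ip (L2chi lam) f h + b * ip (L2chi lam) g h"
    unfolding ip_L2chi [OF f h] ip_L2chi [OF g h] by simp
next
  fix f :: "(complex^'n) \<times> real \<Rightarrow> complex"
  assume f: "f \<in> vecs (L2chi lam)"
  have "(LINT t|haar. tilde lam f t * cnj (tilde lam f t)) = (LINT t|haar. complex_of_real ((cmod (tilde lam f t))\<^sup>2))"
    by (simp only: complex_norm_square)
  also have "\<dots> = of_real (LINT t|haar. (cmod (tilde lam f t))\<^sup>2)" by (rule integral_complex_of_real)
  finally show "0 \<le> Re (ip (L2chi lam) f f)"
    unfolding ip_L2chi [OF f f] by (simp add: Bochner_Integration.integral_nonneg)
qed

lemma fourier_cong: "(\<And>t. t \<in> torus \<Longrightarrow> f t = g t) \<Longrightarrow> fourier f \<alpha> = fourier g \<alpha>"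
  unfolding fourier_def by (intro Bochner_Integration.integral_cong) auto

lemma fourier_tilde_lift: "fourier (tilde lam (lift lam g)) \<alpha> = fourier g \<alpha>"
  by (rule fourier_cong) (rule tilde_lift)

text \<open>Makes Fourier coefficients inner products with unit vectors, so that the abstract
  results on operators apply to them.\<close>

lemma ip_lift_monomial:
  assumes f: "f \<in> vecs (L2chi lam)"
  shows "ip (L2chi lam) f (lift lam (monomial \<alpha>)) = fourier (tilde lam f) \<alpha>"
  unfolding ip_L2chi [OF f lift_in_L2chi [OF sq_integrable_monomial]] fourier_def
  by (intro Bochner_Integration.integral_cong) (simp_all add: tilde_lift)

lemma fourier_tilde_lincomb:
  assumes "f \<in> vecs (L2chi lam)" "g \<in> vecs (L2chi lam)"
  shows "fourier (tilde lam (\<lambda>p. a * f p + b * g p)) \<alpha> = a * fourier (tilde lam f) \<alpha> + b * fourier (tilde lam g) \<alpha>"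
  using semi_inner_product.ip_lincomb [OF semi_inner_product_L2chi assms lift_in_L2chi [OF sq_integrable_monomial [of \<alpha>]], where a = a and b = b]
  by (simp add: ip_lift_monomial assms L2chi_lincomb)

lemma same_in_L2chi:
  assumes f: "f \<in> vecs (L2chi lam)" and g: "g \<in> vecs (L2chi lam)"
    and eq: "\<And>\<alpha>. fourier (tilde lam f) \<alpha> = fourier (tilde lam g) \<alpha>"
  shows "same_in (L2chi lam) f g"
proof -
  have d: "(\<lambda>p. f p - g p) \<in> vecs (L2chi lam)"
    using L2chi_lincomb [OF f g, of 1 "- 1"] by simp
  have "fourier (tilde lam (\<lambda>p. f p - g p)) \<alpha> = 0" for \<alpha>
    using fourier_tilde_lincomb [OF f g, of 1 "- 1" \<alpha>] eq [of \<alpha>] by simp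
  then show ?thesis
    unfolding same_in_def nrm_L2chi [OF d] using fourier_unique [OF sq_integrable_tilde [OF d]] by simp
qed

lemma nrm_lift_monomial: "nrm (L2chi lam) (lift lam (monomial \<alpha>)) = 1"
proof -
  have "(LINT t|haar. (cmod (tilde lam (lift lam (monomial \<alpha>)) t))\<^sup>2) = (LINT t::complex^'a|haar. 1)"
    by (rule Bochner_Integration.integral_cong) (simp_all add: tilde_lift)
  then show ?thesis by (simp add: nrm_L2chi [OF lift_in_L2chi [OF sq_integrable_monomial]])
qed

text \<open>The variance of |f| on a probability space is nonnegative.\<close>

lemma integral_norm_le_sqrt:
  assumes M: "finite_measure M" and one: "measure M (space M) = 1"
    and f: "integrable M f" "integrable M (\<lambda>x. (cmod (f x))\<^sup>2)"
  shows "(LINT x|M. cmod (f x)) \<le> sqrt (LINT x|M. (cmod (f x))\<^sup>2)"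
proof -
  interpret finite_measure M by (rule M)
  define m where "m = (LINT x|M. cmod (f x))"
  have "0 \<le> (LINT x|M. (cmod (f x) - m)\<^sup>2)" by (rule Bochner_Integration.integral_nonneg) simp
  also have "(LINT x|M. (cmod (f x) - m)\<^sup>2) = (LINT x|M. ((cmod (f x))\<^sup>2 - (2 * m) * cmod (f x)) + m\<^sup>2)"
    by (rule Bochner_Integration.integral_cong) (simp_all add: power2_diff algebra_simps)
  also have "\<dots> = (LINT x|M. (cmod (f x))\<^sup>2 - (2 * m) * cmod (f x)) + (LINT x|M. m\<^sup>2)"
    by (intro Bochner_Integration.integral_add Bochner_Integration.integrable_diff integrable_mult_right integrable_norm f integrable_const)
  also have "(LINT x|M. (cmod (f x))\<^sup>2 - (2 * m) * cmod (f x)) = (LINT x|M. (cmod (f x))\<^sup>2) - (LINT x|M. (2 * m) * cmod (f x))"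
    by (intro Bochner_Integration.integral_diff integrable_mult_right integrable_norm f)
  finally have "m\<^sup>2 \<le> (LINT x|M. (cmod (f x))\<^sup>2)"
    using one by (simp add: m_def [symmetric] power2_eq_square)
  then show ?thesis unfolding m_def by (rule real_le_rsqrt)
qed

lemma integral_norm_tilde_le:
  assumes f: "f \<in> vecs (L2chi lam)"
  shows "(LINT t|haar. cmod (tilde lam f t)) \<le> nrm (L2chi lam) f"
  unfolding nrm_L2chi [OF f]
  by (rule integral_norm_le_sqrt)
     (use sq_integrable_tilde [OF f] in \<open>auto simp: sq_integrable_imp_integrable sq_integrable_def haar.finite_measure_axioms\<close>)

section \<open>The square root\<close>

text \<open>A concrete positive square root. \<open>op_sqrt\<close> is a choice and says nothing
  unless some operator meets its specification.\<close>

definition sqrt_op :: "real \<Rightarrow> ((complex^'n) \<times> real \<Rightarrow> complex) \<Rightarrow> (complex^'n) \<times> real \<Rightarrow> complex" where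
  "sqrt_op lam f = lift lam (fourier_series (\<lambda>\<alpha>. of_real (sqrt (phi_coeff lam \<alpha>)) * fourier (tilde lam f) \<alpha>))"

context
  fixes lam :: real
  assumes lam: "lam > 0"
begin

lemma freq_summable_sqrt:
  assumes f: "f \<in> vecs (L2chi lam)"
  shows "freq_summable (\<lambda>\<alpha>. of_real (sqrt (phi_coeff lam \<alpha>)) * fourier (tilde lam f) \<alpha>)"
  by (rule freq_summable_mult [OF freq_summable_phi_coeff(2) [OF lam]])
     (rule norm_fourier_le [OF sq_integrable_imp_integrable [OF sq_integrable_tilde [OF f]]])

lemma sqrt_op_vecs:
  assumes f: "f \<in> vecs (L2chi lam)"
  shows "sqrt_op lam f \<in> vecs (L2chi lam)"
  unfolding sqrt_op_def by (intro lift_in_L2chi sq_integrable_fourier_series freq_summable_sqrt f)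

lemma fourier_sqrt_op:
  assumes f: "f \<in> vecs (L2chi lam)"
  shows "fourier (tilde lam (sqrt_op lam f)) \<alpha> = of_real (sqrt (phi_coeff lam \<alpha>)) * fourier (tilde lam f) \<alpha>"
  unfolding sqrt_op_def fourier_tilde_lift by (rule fourier_fourier_series [OF freq_summable_sqrt [OF f]])

text \<open>Every Fourier coefficient of f is at most the L^1 norm, hence at most the L^2 norm. The
  series is therefore bounded pointwise by \<open>C\<close> times the norm, where \<open>C\<close>
  is the sum of the multipliers, and Haar measure has mass 1.\<close>

lemma bounded_sqrt_op: "bounded_op (L2chi lam) (L2chi lam) (sqrt_op lam :: ((complex^'n) \<times> real \<Rightarrow> complex) \<Rightarrow> _)"
  unfolding bounded_op_def
proof (intro conjI ballI allI)
  fix f g :: "(complex^'n) \<times> real \<Rightarrow> complex" and a b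
  assume f: "f \<in> vecs (L2chi lam)"
  show "sqrt_op lam f \<in> vecs (L2chi lam)" by (rule sqrt_op_vecs [OF f])
  assume g: "g \<in> vecs (L2chi lam)"
  show "same_in (L2chi lam) (sqrt_op lam (\<lambda>p. a * f p + b * g p)) (\<lambda>q. a * sqrt_op lam f q + b * sqrt_op lam g q)"
    by (rule same_in_L2chi)
       (simp_all add: sqrt_op_vecs L2chi_lincomb f g fourier_sqrt_op fourier_tilde_lincomb algebra_simps)
next
  let ?c = "\<lambda>\<alpha>::int^'n. complex_of_real (sqrt (phi_coeff lam \<alpha>))"
  define C where "C = (\<Sum>k. norm (?c (freq k)))"
  have sc: "summable (\<lambda>k. norm (?c (freq k)))"
    using freq_summable_phi_coeff(2) [OF lam, where 'n = 'n] by (simp only: freq_summable_def)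
  have C: "C \<ge> 0" unfolding C_def by (rule suminf_nonneg [OF sc]) simp
  have "nrm (L2chi lam) (sqrt_op lam f) \<le> C * nrm (L2chi lam) f" if f: "f \<in> vecs (L2chi lam)"
    for f :: "(complex^'n) \<times> real \<Rightarrow> complex"
  proof -
    have n0: "nrm (L2chi lam) f \<ge> 0" by (rule semi_inner_product.nrm_nonneg [OF semi_inner_product_L2chi f])
    have fn: "cmod (fourier (tilde lam f) \<alpha>) \<le> nrm (L2chi lam) f" for \<alpha>
      using norm_fourier_le [OF sq_integrable_imp_integrable [OF sq_integrable_tilde [OF f]]] integral_norm_tilde_le [OF f]
      by (rule order.trans)
    have pt: "cmod (tilde lam (sqrt_op lam f) t) \<le> C * nrm (L2chi lam) f" if t: "t \<in> torus" for t
    proof -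
      have "cmod (tilde lam (sqrt_op lam f) t) \<le> (\<Sum>k. norm (?c (freq k) * fourier (tilde lam f) (freq k)))"
        unfolding sqrt_op_def tilde_lift [OF t] by (rule norm_fourier_series_le [OF freq_summable_sqrt [OF f] t])
      also have "\<dots> \<le> (\<Sum>k. norm (?c (freq k)) * nrm (L2chi lam) f)"
        using freq_summable_sqrt [OF f] unfolding freq_summable_def
        by (intro suminf_le summable_mult2 sc) (auto simp: norm_mult fn mult_left_mono)
      also have "\<dots> = C * nrm (L2chi lam) f" unfolding C_def by (rule suminf_mult2 [OF sc, symmetric])
      finally show ?thesis .
    qed
    have "(LINT t|haar. (cmod (tilde lam (sqrt_op lam f) t))\<^sup>2) \<le> (LINT t::complex^'n|haar. (C * nrm (L2chi lam) f)\<^sup>2)"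
      by (rule Bochner_Integration.integral_mono)
         (use sq_integrable_tilde [OF sqrt_op_vecs [OF f]] pt in \<open>auto simp: sq_integrable_def intro!: power_mono\<close>)
    then show ?thesis unfolding nrm_L2chi [OF sqrt_op_vecs [OF f]]
      using C n0 by (simp add: real_le_lsqrt)
  qed
  then show "\<exists>C. \<forall>f\<in>vecs (L2chi lam). nrm (L2chi lam) (sqrt_op lam f) \<le> C * nrm (L2chi lam) (f :: (complex^'n) \<times> real \<Rightarrow> complex)"
    by blast
qed

text \<open>Termwise integration writes the inner product as a series of the nonnegative numbers
  sqrt c_\<alpha> |f^(\<alpha>)|^2.\<close>

lemma sqrt_op_positive:
  assumes f: "f \<in> vecs (L2chi lam)"
  shows "ip (L2chi lam) (sqrt_op lam f) f \<in> \<real> \<and> 0 \<le> Re (ip (L2chi lam) (sqrt_op lam f) f)"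
proof -
  let ?c = "\<lambda>\<alpha>. complex_of_real (sqrt (phi_coeff lam \<alpha>)) * fourier (tilde lam f) \<alpha>"
  let ?r = "\<lambda>\<alpha>. sqrt (phi_coeff lam \<alpha>) * (cmod (fourier (tilde lam f) \<alpha>))\<^sup>2"
  have gi: "integrable haar (\<lambda>s. cnj (tilde lam f s))"
    using sq_integrable_imp_integrable [OF sq_integrable_tilde [OF f]] by simp
  have coeff: "(LINT s|haar. monomial \<alpha> s * cnj (tilde lam f s)) = cnj (fourier (tilde lam f) \<alpha>)" for \<alpha>
    unfolding fourier_def by (rule integral_cnj_mult_swap [symmetric])
  have "ip (L2chi lam) (sqrt_op lam f) f = (LINT s|haar. fourier_series ?c s * cnj (tilde lam f s))"
    unfolding ip_L2chi [OF sqrt_op_vecs [OF f] f] unfolding sqrt_op_def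
    by (intro Bochner_Integration.integral_cong) (simp_all add: tilde_lift)
  then have "(\<lambda>k. ?c (freq k) * cnj (fourier (tilde lam f) (freq k))) sums ip (L2chi lam) (sqrt_op lam f) f"
    using integral_fourier_series_mult [OF freq_summable_sqrt [OF f] gi] by (simp only: coeff)
  moreover have "?c \<alpha> * cnj (fourier (tilde lam f) \<alpha>) = of_real (?r \<alpha>)" for \<alpha>
    by (simp only: mult.assoc complex_norm_square of_real_mult)
  ultimately have s: "(\<lambda>k. complex_of_real (?r (freq k))) sums ip (L2chi lam) (sqrt_op lam f) f" by simp
  have r: "(\<lambda>k. ?r (freq k)) sums Re (ip (L2chi lam) (sqrt_op lam f) f)"
    using sums_Re [OF s] by simp
  have "0 \<le> Re (ip (L2chi lam) (sqrt_op lam f) f)"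
    by (rule sums_le [OF _ sums_zero r]) (simp add: phi_coeff_nonneg [OF lam])
  moreover have "(\<lambda>k. Im (complex_of_real (?r (freq k)))) sums Im (ip (L2chi lam) (sqrt_op lam f) f)"
    by (rule sums_Im [OF s])
  then have "Im (ip (L2chi lam) (sqrt_op lam f) f) = 0" using sums_unique2 [OF _ sums_zero] by fastforce
  ultimately show ?thesis by (simp add: complex_is_Real_iff)
qed

text \<open>The operator \<open>T\<close> below is \<open>R R\<^sup>*\<close>; only its description as a convolution matters.\<close>

lemma fourier_op_sqrt:
  fixes T :: "((complex^'n) \<times> real \<Rightarrow> complex) \<Rightarrow> (complex^'n) \<times> real \<Rightarrow> complex"
  assumes T: "\<And>g. g \<in> vecs (L2chi lam) \<Longrightarrow> T g \<in> vecs (L2chi lam)"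
    and conv: "\<And>g t. g \<in> vecs (L2chi lam) \<Longrightarrow> t \<in> torus \<Longrightarrow> tilde lam (T g) t = conv (tilde lam g) (phi lam) t"
    and f: "f \<in> vecs (L2chi lam)"
  shows "op_sqrt (L2chi lam) T f \<in> vecs (L2chi lam)"
    and "fourier (tilde lam (op_sqrt (L2chi lam) T f)) \<alpha> = of_real (sqrt (phi_coeff lam \<alpha>)) * fourier (tilde lam f) \<alpha>"
proof -
  interpret semi_inner_product "L2chi lam :: ((complex^'n) \<times> real) ip_space"
    by (rule semi_inner_product_L2chi)
  have FT: "fourier (tilde lam (T g)) \<beta> = of_real (phi_coeff lam \<beta>) * fourier (tilde lam g) \<beta>"
    if g: "g \<in> vecs (L2chi lam)" for g \<beta>
  proof -
    have "fourier (tilde lam (T g)) \<beta> = fourier (fourier_series (\<lambda>\<alpha>. of_real (phi_coeff lam \<alpha>) * fourier (tilde lam g) \<alpha>)) \<beta>"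
      by (rule fourier_cong) (simp add: conv [OF g] conv_phi [OF lam sq_integrable_tilde [OF g]])
    also have "\<dots> = of_real (phi_coeff lam \<beta>) * fourier (tilde lam g) \<beta>"
      by (rule fourier_fourier_series, rule freq_summable_mult [OF freq_summable_phi_coeff(1) [OF lam]])
         (rule norm_fourier_le [OF sq_integrable_imp_integrable [OF sq_integrable_tilde [OF g]]])
    finally show ?thesis .
  qed
  let ?is_sqrt = "\<lambda>S. bounded_op (L2chi lam) (L2chi lam) S \<and>
        (\<forall>f\<in>vecs (L2chi lam). ip (L2chi lam) (S f) f \<in> \<real> \<and> 0 \<le> Re (ip (L2chi lam) (S f) f)) \<and>
        (\<forall>f\<in>vecs (L2chi lam). same_in (L2chi lam) (S (S f)) (T f))"
  have sq: "complex_of_real (sqrt (phi_coeff lam \<beta>)) * of_real (sqrt (phi_coeff lam \<beta>)) = of_real (phi_coeff lam \<beta>)" for \<beta> :: "int^'n"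
    using phi_coeff_nonneg [OF lam, of \<beta>] by (simp flip: of_real_mult)
  \<comment> \<open>With one square root exhibited, the chosen one satisfies the specification too;
    from here on only the specification is used.\<close>
  have "?is_sqrt (sqrt_op lam)"
  proof (intro conjI ballI)
    fix f :: "(complex^'n) \<times> real \<Rightarrow> complex" assume f: "f \<in> vecs (L2chi lam)"
    show "same_in (L2chi lam) (sqrt_op lam (sqrt_op lam f)) (T f)"
      by (rule same_in_L2chi)
         (simp_all add: sqrt_op_vecs f T fourier_sqrt_op FT mult.assoc [symmetric] sq)
  qed (use bounded_sqrt_op sqrt_op_positive in auto)
  then have S: "?is_sqrt (op_sqrt (L2chi lam) T)" unfolding op_sqrt_def by (rule someI [of ?is_sqrt])
  let ?S = "op_sqrt (L2chi lam) T"
  show Sf: "?S f \<in> vecs (L2chi lam)" using S f by (simp add: bounded_op_def)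
  define v where "v = lift lam (monomial \<alpha> :: complex^'n \<Rightarrow> complex)"
  have v: "v \<in> vecs (L2chi lam)" unfolding v_def by (rule lift_in_L2chi [OF sq_integrable_monomial])
  have cv: "(\<lambda>p. of_real (phi_coeff lam \<alpha>) * v p) \<in> vecs (L2chi lam)"
    using L2chi_lincomb [OF v v, of "of_real (phi_coeff lam \<alpha>)" 0] by simp
  have Fv: "fourier (tilde lam v) \<beta> = (if \<alpha> = \<beta> then 1 else 0)" for \<beta>
  proof -
    have "fourier (tilde lam v) \<beta> = (LINT t|haar. monomial (\<alpha> - \<beta>) (t::complex^'n))"
      unfolding v_def fourier_tilde_lift unfolding fourier_def
    proof (rule Bochner_Integration.integral_cong)
      fix t :: "complex^'n" assume "t \<in> space haar"
      then have t: "t \<in> torus" by simp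
      show "monomial \<alpha> t * cnj (monomial \<beta> t) = monomial (\<alpha> - \<beta>) t"
        using monomial_add [OF t, of \<alpha> "- \<beta>"] by (simp add: cnj_monomial [OF t])
    qed simp
    then show ?thesis by (simp add: integral_monomial)
  qed
  \<comment> \<open>Monomials are eigenvectors of the convolution operator, so the eigenvector lemma
    determines any positive root on them.\<close>
  have "same_in (L2chi lam) (T v) (\<lambda>p. of_real (phi_coeff lam \<alpha>) * v p)"
  proof (rule same_in_L2chi [OF T [OF v] cv])
    fix \<beta>
    have "fourier (tilde lam (\<lambda>p. of_real (phi_coeff lam \<alpha>) * v p)) \<beta> = of_real (phi_coeff lam \<alpha>) * fourier (tilde lam v) \<beta>"
      using fourier_tilde_lincomb [OF v v, of "of_real (phi_coeff lam \<alpha>)" 0 \<beta>] by simp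
    then show "fourier (tilde lam (T v)) \<beta> = fourier (tilde lam (\<lambda>p. of_real (phi_coeff lam \<alpha>) * v p)) \<beta>"
      by (simp add: FT [OF v] Fv)
  qed
  moreover have SSv: "same_in (L2chi lam) (?S (?S v)) (T v)" and SSvv: "?S (?S v) \<in> vecs (L2chi lam)"
    using S v by (auto simp: bounded_op_def)
  ultimately have "same_in (L2chi lam) (?S (?S v)) (\<lambda>p. of_real (phi_coeff lam \<alpha>) * v p)"
  proof -
    assume a: "same_in (L2chi lam) (T v) (\<lambda>p. of_real (phi_coeff lam \<alpha>) * v p)"
    show ?thesis
      by (rule same_in_L2chi [OF SSvv cv])
         (simp only: ip_lift_monomial [symmetric] SSvv cv T [OF v] same_in_ip [OF SSv SSvv T [OF v] lift_in_L2chi [OF sq_integrable_monomial]]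
           same_in_ip [OF a T [OF v] cv lift_in_L2chi [OF sq_integrable_monomial]])
  qed
  then have eig: "ip (L2chi lam) (?S v) f = of_real (sqrt (phi_coeff lam \<alpha>)) * ip (L2chi lam) v f"
    using S by (intro positive_sqrt_eigenvector v f phi_coeff_nonneg [OF lam]) auto
  \<comment> \<open>Symmetry moves the root from f to the monomial, where it is known; the
    eigenvalue is real, so conjugation leaves it alone.\<close>
  have "fourier (tilde lam (?S f)) \<alpha> = ip (L2chi lam) (?S f) v"
    unfolding v_def by (rule ip_lift_monomial [OF Sf, symmetric])
  also have "\<dots> = ip (L2chi lam) f (?S v)"
    by (rule positive_imp_symmetric [OF _ _ f v]) (use S in auto)
  also have "\<dots> = cnj (ip (L2chi lam) (?S v) f)"
    using S v f by (intro ip_cnj [symmetric]) (auto simp: bounded_op_def)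
  also have "\<dots> = of_real (sqrt (phi_coeff lam \<alpha>)) * ip (L2chi lam) f v"
    unfolding eig using ip_cnj [OF v f] by simp
  also have "ip (L2chi lam) f v = fourier (tilde lam f) \<alpha>"
    unfolding v_def by (rule ip_lift_monomial [OF f])
  finally show "fourier (tilde lam (?S f)) \<alpha> = of_real (sqrt (phi_coeff lam \<alpha>)) * fourier (tilde lam f) \<alpha>" .
qed

end

section \<open>The restriction operator\<close>

definition bergman_kernel :: "real \<Rightarrow> complex^'n \<Rightarrow> complex^'n \<Rightarrow> complex" where
  "bergman_kernel lam z w = (1 - herm z w) powr (- of_real lam)"

definition base_point :: "complex^'n \<Rightarrow> complex^'n" where
  "base_point t = (\<chi> i. t $ i / of_real (sqrt (2 * real CARD('n))))"

lemma restr_eq_lift_base_point: "restr lam f = lift lam (\<lambda>t. f (base_point t))"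
  by (simp add: restr_eq_lift base_point_def)

lemma norm_base_point:
  fixes t :: "complex^'n"
  assumes t: "t \<in> torus"
  shows "norm (base_point t) = sqrt (1 / 2)"
proof -
  have "(\<Sum>i\<in>(UNIV::'n set). (cmod (base_point t $ i))\<^sup>2) = (\<Sum>i\<in>(UNIV::'n set). 1 / (2 * real CARD('n)))"
    by (intro sum.cong) (simp_all add: base_point_def norm_divide torus_nth [OF t] power_divide)
  then show ?thesis by (simp add: norm_vec_def L2_set_def)
qed

lemma norm_base_point_less: "t \<in> torus \<Longrightarrow> norm (base_point t) < 1"
  by (simp add: norm_base_point)

lemma continuous_on_base_point [continuous_intros]: "continuous_on S base_point"
  unfolding base_point_def by (intro continuous_on_vec_lambda continuous_intros) simp

text \<open>A lower bound for Re (1 - <z,w>) when |z| <= 1 and |w| <= sqrt (1/2), the latter being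
  the norm of every orbit point. It keeps the kernel bounded and off the branch cut.\<close>

definition half_plane_gap :: real where
  "half_plane_gap = 1 - sqrt (1 / 2)"

lemma half_plane_gap_pos: "half_plane_gap > 0"
  by (simp add: half_plane_gap_def)

lemma Re_one_minus_herm:
  assumes "norm z \<le> 1" "norm w \<le> sqrt (1 / 2)"
  shows "half_plane_gap \<le> Re (1 - herm z w)" "half_plane_gap \<le> Re (1 - herm w z)"
proof -
  have "norm z * norm w \<le> 1 * sqrt (1 / 2)" using assms by (intro mult_mono) auto
  then have "cmod (herm z w) \<le> sqrt (1 / 2)" "cmod (herm w z) \<le> sqrt (1 / 2)"
    using norm_herm_le [of z w] norm_herm_le [of w z] by (simp_all add: mult.commute)
  then show "half_plane_gap \<le> Re (1 - herm z w)" "half_plane_gap \<le> Re (1 - herm w z)"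
    using complex_Re_le_cmod [of "herm z w"] complex_Re_le_cmod [of "herm w z"]
    by (simp_all add: half_plane_gap_def)
qed

lemma cnj_bergman_kernel:
  assumes "norm z \<le> 1" "norm w \<le> sqrt (1 / 2)"
  shows "cnj (bergman_kernel lam z w) = bergman_kernel lam w z"
    and "cnj (bergman_kernel lam w z) = bergman_kernel lam z w"
proof -
  have "cnj (bergman_kernel lam z w) = cnj (1 - herm z w) powr cnj (- of_real lam)"
    unfolding bergman_kernel_def
    using Re_one_minus_herm(1) [OF assms] half_plane_gap_pos by (intro cnj_powr) linarith
  then show *: "cnj (bergman_kernel lam z w) = bergman_kernel lam w z"
    by (simp add: bergman_kernel_def herm_simps)
  show "cnj (bergman_kernel lam w z) = bergman_kernel lam z w"
    unfolding * [symmetric] by simp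
qed

lemma norm_powr_half_plane_le:
  assumes "a > 0" "half_plane_gap \<le> Re x"
  shows "cmod (x powr (- of_real a)) \<le> half_plane_gap powr (- a)"
proof -
  have "cmod (x powr (- of_real a)) = cmod x powr (- a)" by (subst norm_powr_real_powr') auto
  also have "\<dots> \<le> half_plane_gap powr (- a)"
    using assms half_plane_gap_pos complex_Re_le_cmod [of x] by (intro powr_mono2') auto
  finally show ?thesis .
qed

lemma norm_bergman_kernel_le:
  assumes "lam > 0" "norm z \<le> 1" "norm w \<le> sqrt (1 / 2)"
  shows "cmod (bergman_kernel lam z w) \<le> half_plane_gap powr (- lam)"
    and "cmod (bergman_kernel lam w z) \<le> half_plane_gap powr (- lam)"
  unfolding bergman_kernel_def
  by (intro norm_powr_half_plane_le assms Re_one_minus_herm)+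

text \<open>A second order estimate with one constant for the whole half plane, which is convex and
  carries a bound for the second derivative. \<open>complex_Taylor\<close> at order 1 divides by 1!,
  hence no factor 1/2.\<close>

lemma powr_Taylor:
  assumes lam: "lam > 0" and x: "half_plane_gap \<le> Re x" and y: "half_plane_gap \<le> Re y"
  shows "cmod (y powr (- of_real lam) - x powr (- of_real lam) - (- of_real lam) * x powr (- of_real (lam + 1)) * (y - x)) \<le>
    lam * (lam + 1) * half_plane_gap powr (- (lam + 2)) * (cmod (y - x))\<^sup>2"
proof -
  let ?S = "{z. half_plane_gap \<le> Re z}"
  define P :: "nat \<Rightarrow> complex \<Rightarrow> complex" where "P k z = (if k = 0 then z powr (- of_real lam)
      else if k = 1 then (- of_real lam) * z powr (- of_real (lam + 1))
      else of_real (lam * (lam + 1)) * z powr (- of_real (lam + 2)))" for k z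
  have nr: "z \<notin> \<real>\<^sub>\<le>\<^sub>0" if "z \<in> ?S" for z
    using that half_plane_gap_pos by (auto simp: complex_nonpos_Reals_iff)
  have P0: "P 0 z = z powr (- of_real lam)" and P1: "P (Suc 0) z = (- of_real lam) * z powr (- of_real (lam + 1))"
    and P2: "P (Suc (Suc 0)) z = of_real (lam * (lam + 1)) * z powr (- of_real (lam + 2))" for z
    by (simp_all add: P_def)
  have "cmod (P 0 y - (\<Sum>i\<le>1. P i x * (y - x) ^ i / fact i)) \<le>
      (lam * (lam + 1) * half_plane_gap powr (- (lam + 2))) * cmod (y - x) ^ Suc 1 / fact 1"
  proof (rule complex_Taylor [of ?S 1 P])
    show "convex ?S" by (rule convex_halfspace_Re_ge)
    fix i :: nat and z assume z: "z \<in> ?S" and "i \<le> 1"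
    then consider "i = 0" | "i = Suc 0" by linarith
    then show "(P i has_field_derivative P (Suc i) z) (at z within ?S)"
    proof cases
      case 1
      have "((\<lambda>z. z powr (- of_real lam)) has_field_derivative (- of_real lam) * z powr (- of_real lam - 1)) (at z within ?S)"
        by (rule has_field_derivative_at_within [OF has_field_derivative_powr [OF nr [OF z]]])
      moreover have "- complex_of_real lam - 1 = - of_real (lam + 1)" by simp
      ultimately show ?thesis unfolding 1 P0 [abs_def] P1 by (simp only:)
    next
      case 2
      have "((\<lambda>z. (- of_real lam) * z powr (- of_real (lam + 1))) has_field_derivative
          (- of_real lam) * ((- of_real (lam + 1)) * z powr (- of_real (lam + 1) - 1))) (at z within ?S)"
        by (intro DERIV_cmult has_field_derivative_at_within [OF has_field_derivative_powr [OF nr [OF z]]])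
      moreover have "- complex_of_real (lam + 1) - 1 = - of_real (lam + 2)" by simp
      moreover have "(- complex_of_real lam) * ((- of_real (lam + 1)) * x) = of_real (lam * (lam + 1)) * x" for x
        by (simp only: of_real_mult minus_mult_left [symmetric] minus_mult_right [symmetric] mult.assoc minus_minus)
      ultimately show ?thesis unfolding 2 P1 [abs_def] P2 by (simp only:)
    qed
  next
    fix z assume z: "z \<in> ?S"
    have "cmod (z powr (- of_real (lam + 2))) \<le> half_plane_gap powr (- (lam + 2))"
      by (rule norm_powr_half_plane_le) (use lam z in auto)
    then show "cmod (P (Suc 1) z) \<le> lam * (lam + 1) * half_plane_gap powr (- (lam + 2))"
      using lam unfolding One_nat_def P2 norm_mult norm_of_real by (intro mult_mono) auto
  qed (use x y in auto)
  moreover have "P 0 y - (\<Sum>i\<le>1. P i x * (y - x) ^ i / fact i) =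
      y powr (- of_real lam) - x powr (- of_real lam) - (- of_real lam) * x powr (- of_real (lam + 1)) * (y - x)"
    by (simp add: P0 P1 del: of_real_add)
  ultimately show ?thesis by (simp add: power2_eq_square)
qed

lemma continuous_on_bergman_kernel_torus:
  assumes z: "norm z \<le> 1"
  shows "continuous_on torus (\<lambda>t. (1 - herm z (base_point t)) powr a)"
    and "continuous_on torus (\<lambda>t. (1 - herm (base_point t) z) powr a)"
proof -
  have "half_plane_gap \<le> Re (1 - herm z (base_point t))" "half_plane_gap \<le> Re (1 - herm (base_point t) z)"
    if "t \<in> torus" for t
    using Re_one_minus_herm [OF z] norm_base_point [OF that] by auto
  then have pos: "0 < Re (1 - herm z (base_point t))" "0 < Re (1 - herm (base_point t) z)" if "t \<in> torus" for t
    using half_plane_gap_pos that by (meson less_le_trans)+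
  show "continuous_on torus (\<lambda>t. (1 - herm z (base_point t)) powr a)"
  proof (rule continuous_on_powr_complex)
    show "torus \<subseteq> {t. 0 \<le> Re (1 - herm z (base_point t)) \<or> Im (1 - herm z (base_point t)) \<noteq> 0}"
      using pos(1) by (auto simp: less_imp_le)
    show "0 < Re a" if "t \<in> torus" "1 - herm z (base_point t) = 0" for t
      using pos(1) [OF that(1)] unfolding that(2) by simp
  qed (intro continuous_intros)+
  show "continuous_on torus (\<lambda>t. (1 - herm (base_point t) z) powr a)"
  proof (rule continuous_on_powr_complex)
    show "torus \<subseteq> {t. 0 \<le> Re (1 - herm (base_point t) z) \<or> Im (1 - herm (base_point t) z) \<noteq> 0}"
      using pos(2) by (auto simp: less_imp_le)
    show "0 < Re a" if "t \<in> torus" "1 - herm (base_point t) z = 0" for t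
      using pos(2) [OF that(1)] unfolding that(2) by simp
  qed (intro continuous_intros)+
qed

lemma integrable_mult_bounded:
  fixes u :: "complex^'n \<Rightarrow> complex"
  assumes u: "integrable haar u" and k: "k \<in> borel_measurable haar" "\<And>t. t \<in> torus \<Longrightarrow> cmod (k t) \<le> B"
  shows "integrable haar (\<lambda>t. u t * k t)"
proof (rule Bochner_Integration.integrable_bound [OF integrable_mult_left [of "of_real B", OF u]])
  show "(\<lambda>t. u t * k t) \<in> borel_measurable haar" using u k(1) by measurable
  have "norm (u t * k t) \<le> norm (u t * of_real B)" if t: "t \<in> torus" for t
  proof -
    have "cmod (k t) \<le> \<bar>B\<bar>" using k(2) [OF t] by linarith
    then show ?thesis by (simp add: norm_mult mult_left_mono)
  qed
  then show "AE t in haar. norm (u t * k t) \<le> norm (u t * of_real B)" by (intro AE_I2) simp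
qed

text \<open>The explicit adjoint: kernels at the orbit points superposed with density
  \<open>u\<close>. Applied to \<open>tilde lam g\<close> it is the witness for
  \<open>restr_adj\<close>.\<close>

definition kernel_integral :: "real \<Rightarrow> (complex^'n \<Rightarrow> complex) \<Rightarrow> complex^'n \<Rightarrow> complex" where
  "kernel_integral lam u z = (LINT t|haar. u t * bergman_kernel lam z (base_point t))"

lemma bergman_kernel_measurable:
  assumes "norm z \<le> 1"
  shows "(\<lambda>t. bergman_kernel lam z (base_point t)) \<in> borel_measurable haar"
    and "(\<lambda>t. bergman_kernel lam (base_point t) z) \<in> borel_measurable haar"
  unfolding bergman_kernel_def
  by (intro continuous_measurable_haar continuous_on_bergman_kernel_torus assms)+

lemma kernel_integrable:
  assumes lam: "lam > 0" and u: "integrable haar u" and z: "norm z \<le> 1"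
  shows "integrable haar (\<lambda>t. u t * bergman_kernel lam z (base_point t))"
    and "integrable haar (\<lambda>t. u t * bergman_kernel lam (base_point t) z)"
  by (rule integrable_mult_bounded [OF u bergman_kernel_measurable(1) [OF z]], rule norm_bergman_kernel_le(1) [OF lam z],
      simp add: norm_base_point)
     (rule integrable_mult_bounded [OF u bergman_kernel_measurable(2) [OF z]], rule norm_bergman_kernel_le(2) [OF lam z],
      simp add: norm_base_point)

lemma norm_kernel_integral_le:
  assumes lam: "lam > 0" and u: "integrable haar u" and z: "norm z \<le> 1"
  shows "cmod (kernel_integral lam u z) \<le> (LINT t|haar. cmod (u t)) * half_plane_gap powr (- lam)"
proof -
  have "cmod (kernel_integral lam u z) \<le> (LINT t|haar. cmod (u t * bergman_kernel lam z (base_point t)))"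
    unfolding kernel_integral_def by (rule integral_norm_bound)
  also have "\<dots> \<le> (LINT t|haar. cmod (u t) * half_plane_gap powr (- lam))"
  proof (rule Bochner_Integration.integral_mono)
    show "integrable haar (\<lambda>t. cmod (u t * bergman_kernel lam z (base_point t)))"
      by (rule integrable_norm [OF kernel_integrable(1) [OF lam u z]])
    fix t :: "complex^'a" assume "t \<in> space haar"
    then have "cmod (bergman_kernel lam z (base_point t)) \<le> half_plane_gap powr (- lam)"
      by (intro norm_bergman_kernel_le(1) lam z) (simp add: norm_base_point)
    then show "cmod (u t * bergman_kernel lam z (base_point t)) \<le> cmod (u t) * half_plane_gap powr (- lam)"
      by (simp add: norm_mult mult_left_mono)
  qed (use u in simp)
  finally show ?thesis by simp
qed

text \<open>Differentiation under the integral sign. \<open>powr_Taylor\<close> bounds the remainder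
  by a multiple of |y - z|^2 uniformly in t, and this bound integrates directly against |u|.\<close>

lemma kernel_integral_holomorphic:
  fixes u :: "complex^'n \<Rightarrow> complex"
  assumes lam: "lam > 0" and u: "integrable haar u"
  shows "kernel_integral lam u holomorphic_vec_on ball 0 1"
  unfolding holomorphic_vec_on_def
proof
  fix z :: "complex^'n" assume "z \<in> ball 0 1"
  then have z: "norm z < 1" by simp
  define d where "d t = (- of_real lam) * (1 - herm z (base_point t)) powr (- of_real (lam + 1))" for t
  define D where "D v = (LINT t|haar. u t * (d t * (- herm v (base_point t))))" for v
  define C where "C = lam * (lam + 1) * half_plane_gap powr (- (lam + 2))"
  define M where "M = (LINT t|haar. cmod (u t))"
  have C: "C \<ge> 0" using lam by (simp add: C_def)
  have M: "M \<ge> 0" unfolding M_def by (rule Bochner_Integration.integral_nonneg) simp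
  have dm: "(\<lambda>t. d t * (- herm v (base_point t))) \<in> borel_measurable haar" for v
    unfolding d_def using z
    by (intro continuous_measurable_haar continuous_on_mult continuous_on_const continuous_on_bergman_kernel_torus
        continuous_on_minus continuous_on_herm continuous_on_base_point) auto
  have di: "integrable haar (\<lambda>t. u t * (d t * (- herm v (base_point t))))" for v
  proof (rule integrable_mult_bounded [OF u dm])
    fix t :: "complex^'n" assume t: "t \<in> torus"
    have "cmod (d t) \<le> lam * half_plane_gap powr (- (lam + 1))"
      unfolding d_def norm_mult
      using norm_powr_half_plane_le [of "lam + 1"] Re_one_minus_herm(1) [of z "base_point t"] lam z t
      by (intro mult_mono) (auto simp: norm_base_point)
    moreover have "cmod (herm v (base_point t)) \<le> norm v"
      using norm_herm_le [of v "base_point t"] norm_base_point_less [OF t] mult_left_le [of "norm (base_point t)" "norm v"]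
      by simp
    ultimately show "cmod (d t * (- herm v (base_point t))) \<le> (lam * half_plane_gap powr (- (lam + 1))) * norm v"
      unfolding norm_mult norm_minus_cancel using lam by (intro mult_mono) auto
  qed
  have Dadd: "D (v + w) = D v + D w" for v w
  proof -
    have "D (v + w) = (LINT t|haar. u t * (d t * (- herm v (base_point t))) + u t * (d t * (- herm w (base_point t))))"
      by (simp add: D_def herm_simps algebra_simps)
    also have "\<dots> = D v + D w" unfolding D_def by (rule Bochner_Integration.integral_add [OF di di])
    finally show ?thesis .
  qed
  have Dmul: "D (c *s v) = c * D v" for c v
  proof -
    have "D (c *s v) = (LINT t|haar. c * (u t * (d t * (- herm v (base_point t)))))"
      by (simp add: D_def herm_simps algebra_simps)
    then show ?thesis unfolding D_def by simp
  qed
  have "linear D"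
    by (rule linearI) (simp_all add: Dadd scaleR_eq_smult Dmul scaleR_conv_of_real)
  then have bl: "bounded_linear D" by (simp add: linear_conv_bounded_linear)
  have est: "cmod (kernel_integral lam u y - kernel_integral lam u z - D (y - z)) \<le> M * C * (norm (y - z))\<^sup>2"
    if y: "norm y < 1" for y
  proof -
    let ?r = "\<lambda>t. bergman_kernel lam y (base_point t) - bergman_kernel lam z (base_point t) - d t * (- herm (y - z) (base_point t))"
    have r: "cmod (?r t) \<le> C * (norm (y - z))\<^sup>2" if t: "t \<in> torus" for t
    proof -
      let ?b = "base_point t"
      have h: "half_plane_gap \<le> Re (1 - herm z ?b)" "half_plane_gap \<le> Re (1 - herm y ?b)"
        using Re_one_minus_herm(1) [of z ?b] Re_one_minus_herm(1) [of y ?b] y z norm_base_point [OF t] by auto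
      have diff: "(1 - herm y ?b) - (1 - herm z ?b) = - herm (y - z) ?b"
        using herm_simps(3) [of "y - z" z ?b] by simp
      have "cmod (?r t) \<le> C * (cmod (- herm (y - z) ?b))\<^sup>2"
        using powr_Taylor [OF lam h] unfolding diff bergman_kernel_def d_def C_def .
      also have "cmod (- herm (y - z) ?b) \<le> norm (y - z)"
        using norm_herm_le [of "y - z" ?b] norm_base_point_less [OF t] mult_left_le [of "norm ?b" "norm (y - z)"]
        by simp
      then have "C * (cmod (- herm (y - z) ?b))\<^sup>2 \<le> C * (norm (y - z))\<^sup>2"
        by (intro mult_left_mono power_mono C) auto
      finally show ?thesis .
    qed
    have i: "integrable haar (\<lambda>t. u t * ?r t)"
      unfolding right_diff_distrib
      by (intro Bochner_Integration.integrable_diff kernel_integrable(1) di lam u) (use y z in auto)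
    have "kernel_integral lam u y - kernel_integral lam u z - D (y - z) = (LINT t|haar. u t * ?r t)"
      unfolding kernel_integral_def D_def right_diff_distrib
      by (subst Bochner_Integration.integral_diff, intro Bochner_Integration.integrable_diff kernel_integrable(1) lam u,
          use y z in simp, use y z in simp, rule di,
          subst Bochner_Integration.integral_diff, intro kernel_integrable(1) lam u, use y in simp,
          intro kernel_integrable(1) lam u, use z in simp) simp
    then have "cmod (kernel_integral lam u y - kernel_integral lam u z - D (y - z)) \<le> (LINT t|haar. cmod (u t * ?r t))"
      using integral_norm_bound [of haar "\<lambda>t. u t * ?r t"] by simp
    also have "\<dots> \<le> (LINT t|haar. cmod (u t) * (C * (norm (y - z))\<^sup>2))"
    proof (rule Bochner_Integration.integral_mono [OF integrable_norm [OF i]])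
      show "cmod (u t * ?r t) \<le> cmod (u t) * (C * (norm (y - z))\<^sup>2)" if "t \<in> space haar" for t
        unfolding norm_mult using r [of t] that by (intro mult_left_mono) auto
    qed (use u in simp)
    also have "\<dots> = M * C * (norm (y - z))\<^sup>2" by (simp add: M_def)
    finally show ?thesis .
  qed
  have "(kernel_integral lam u has_derivative D) (at z)"
    unfolding has_derivative_at_alt
  proof (intro conjI bl allI impI)
    fix e :: real assume e: "e > 0"
    \<comment> \<open>The first bound keeps y in the ball; the second makes (M C + 1) |y - z| at
      most e, the 1 avoiding a zero denominator.\<close>
    define \<delta> where "\<delta> = min (1 - norm z) (e / (M * C + 1))"
    have MC: "M * C \<ge> 0" using M C by simp
    have "\<delta> > 0" using z e MC by (simp add: \<delta>_def add_nonneg_pos)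
    moreover have "norm (kernel_integral lam u y - kernel_integral lam u z - D (y - z)) \<le> e * norm (y - z)"
      if y: "norm (y - z) < \<delta>" for y
    proof -
      have "norm y < 1" using norm_triangle_ineq [of z "y - z"] y by (simp add: \<delta>_def)
      from est [OF this]
      have "cmod (kernel_integral lam u y - kernel_integral lam u z - D (y - z)) \<le> (M * C * norm (y - z)) * norm (y - z)"
        by (simp add: power2_eq_square mult.assoc)
      also have "M * C * norm (y - z) \<le> (M * C + 1) * norm (y - z)" by (intro mult_right_mono) auto
      then have "(M * C * norm (y - z)) * norm (y - z) \<le> ((M * C + 1) * norm (y - z)) * norm (y - z)"
        by (intro mult_right_mono) auto
      also have "(M * C + 1) * norm (y - z) \<le> e"
        using y MC by (simp add: \<delta>_def less_divide_eq add_nonneg_pos mult.commute less_imp_le)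
      then have "((M * C + 1) * norm (y - z)) * norm (y - z) \<le> e * norm (y - z)"
        by (intro mult_right_mono) auto
      finally show ?thesis .
    qed
    ultimately show "\<exists>\<delta>>0. \<forall>y. norm (y - z) < \<delta> \<longrightarrow>
        norm (kernel_integral lam u y - kernel_integral lam u z - D (y - z)) \<le> e * norm (y - z)" by blast
  qed
  then show "\<exists>D. (kernel_integral lam u has_derivative D) (at z) \<and> (\<forall>c v. D (c *s v) = c * D v)"
    using Dmul by blast
qed

lemma bergman_kernel_holomorphic:
  fixes w :: "complex^'n"
  assumes w: "norm w \<le> sqrt (1 / 2)"
  shows "(\<lambda>z. bergman_kernel lam z w) holomorphic_vec_on ball 0 1"
  unfolding holomorphic_vec_on_def
proof
  fix z :: "complex^'n" assume "z \<in> ball 0 1"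
  then have "half_plane_gap \<le> Re (1 - herm z w)" using w by (intro Re_one_minus_herm) auto
  then have nr: "1 - herm z w \<notin> \<real>\<^sub>\<le>\<^sub>0" using half_plane_gap_pos by (auto simp: complex_nonpos_Reals_iff)
  have "linear (\<lambda>z. herm z w)"
    by (rule linearI) (simp_all add: herm_simps scaleR_eq_smult scaleR_conv_of_real)
  then have "bounded_linear (\<lambda>z. herm z w)" by (simp add: linear_conv_bounded_linear)
  then have "((\<lambda>z. herm z w) has_derivative (\<lambda>v. herm v w)) (at z)"
    by (rule bounded_linear.has_derivative [OF _ has_derivative_ident, simplified])
  then have "((\<lambda>z. 1 - herm z w) has_derivative (\<lambda>v. - herm v w)) (at z)"
    by (auto intro!: derivative_eq_intros)
  moreover define p where "p = - of_real lam * (1 - herm z w) powr (- of_real lam - 1)"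
  have "((\<lambda>x. x powr (- of_real lam)) has_derivative (\<lambda>h. p * h)) (at (1 - herm z w))"
    using has_field_derivative_powr [OF nr, of "- of_real lam"] by (simp only: has_field_derivative_def p_def)
  ultimately have "((\<lambda>z. bergman_kernel lam z w) has_derivative (\<lambda>v. p * (- herm v w))) (at z)"
    unfolding bergman_kernel_def using diff_chain_at by (fastforce simp: o_def)
  then show "\<exists>D. ((\<lambda>z. bergman_kernel lam z w) has_derivative D) (at z) \<and> (\<forall>c v. D (c *s v) = c * D v)"
    by (intro exI [of _ "\<lambda>v. p * (- herm v w)"]) (simp add: herm_simps mult_ac)
qed

text \<open>The principal power is continuous only off the slit, so joint measurability is shown for
  the kernel set to 0 there. For z in the ball and t on the torus the slit is never met, and the
  modified kernel is the kernel.\<close>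

lemma torus_kernel_measurable_pair:
  "(\<lambda>(z, t). if 1 - herm (base_point t) z \<in> \<real>\<^sub>\<le>\<^sub>0 then 0 else bergman_kernel lam (base_point t) z)
    \<in> borel_measurable (borel \<Otimes>\<^sub>M borel)"
proof -
  have "(\<lambda>x::complex. if x \<in> \<real>\<^sub>\<le>\<^sub>0 then 0 else x powr (- of_real lam)) \<in> borel_measurable borel"
  proof (rule borel_measurable_continuous_on_if)
    show "continuous_on (- \<real>\<^sub>\<le>\<^sub>0) (\<lambda>x. x powr (- complex_of_real lam))"
    proof (rule continuous_on_powr_complex)
      show "- \<real>\<^sub>\<le>\<^sub>0 \<subseteq> {z::complex. 0 \<le> Re z \<or> Im z \<noteq> 0}" by (auto simp: complex_nonpos_Reals_iff)
    qed (auto intro!: continuous_intros)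
  qed (auto intro: borel_closed)
  moreover have "continuous_on UNIV (\<lambda>(z::complex^'a, t). 1 - herm (base_point t) z)"
    unfolding case_prod_beta
    by (intro continuous_intros continuous_on_compose2 [OF continuous_on_base_point]) auto
  then have "(\<lambda>(z::complex^'a, t). 1 - herm (base_point t) z) \<in> borel_measurable (borel \<Otimes>\<^sub>M borel)"
    unfolding borel_prod by (rule borel_measurable_continuous_onI)
  ultimately have "(\<lambda>p. (\<lambda>x. if x \<in> \<real>\<^sub>\<le>\<^sub>0 then 0 else x powr (- of_real lam)) ((\<lambda>(z::complex^'a, t). 1 - herm (base_point t) z) p))
      \<in> borel_measurable (borel \<Otimes>\<^sub>M borel)"
    by (rule measurable_compose [rotated])
  then show ?thesis by (simp only: bergman_kernel_def case_prod_beta')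
qed

section \<open>Restriction to the orbit, its adjoint, and the values of the adjoint on the
  orbit\<close>

lemma bergman_vecs:
  "f \<in> vecs (bergman lam) \<longleftrightarrow> f holomorphic_vec_on ball 0 1 \<and> integrable (mu lam) (\<lambda>z. (cmod (f z))\<^sup>2)"
  by (simp add: bergman_def)

lemma ip_bergman: "ip (bergman lam) f g = (LINT z|mu lam. f z * cnj (g z))"
  by (simp add: bergman_def)

lemma holomorphic_measurable_mu:
  "f holomorphic_vec_on ball 0 1 \<Longrightarrow> f \<in> borel_measurable (mu lam)"
  unfolding borel_measurable_mu
  by (rule borel_measurable_continuous_on_restrict [OF holomorphic_vec_on_imp_continuous_on])

lemma multi_coeff_neg: "\<not> (\<forall>i. \<alpha> $ i \<ge> 0) \<Longrightarrow> multi_coeff b \<alpha> = 0"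
  unfolding multi_coeff_def by (rule if_not_P)

context
  fixes lam :: real
  assumes lam: "lam > real CARD('n::finite)"
begin

interpretation mu: finite_measure "mu lam :: (complex^'n) measure"
  by (rule finite_measure_mu [OF lam])

interpretation mu_haar: pair_sigma_finite "mu lam :: (complex^'n) measure" "haar :: (complex^'n) measure"
  by standard

lemma lam_pos: "lam > 0"
  using lam by (rule le_less_trans [OF of_nat_0_le_iff])

lemma bounded_holomorphic_in_bergman:
  fixes f :: "complex^'n \<Rightarrow> complex"
  assumes f: "f holomorphic_vec_on ball 0 1" and B: "\<And>z. norm z < 1 \<Longrightarrow> cmod (f z) \<le> B"
  shows "f \<in> vecs (bergman lam)"
  unfolding bergman_vecs
proof
  have [measurable]: "f \<in> borel_measurable (mu lam)" by (rule holomorphic_measurable_mu [OF f])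
  show "integrable (mu lam) (\<lambda>z. (cmod (f z))\<^sup>2)"
    by (rule mu.integrable_const_bound [of _ "B\<^sup>2"]) (use B in \<open>auto intro!: AE_I2 power_mono\<close>)
qed fact

lemma bergman_integrable:
  fixes f :: "complex^'n \<Rightarrow> complex"
  assumes f: "f \<in> vecs (bergman lam)"
  shows "integrable (mu lam) f"
proof (rule Bochner_Integration.integrable_bound)
  show "integrable (mu lam) (\<lambda>z. 1 + (cmod (f z))\<^sup>2)" using f by (simp add: bergman_vecs)
  show "f \<in> borel_measurable (mu lam)" using f by (auto simp: bergman_vecs intro: holomorphic_measurable_mu)
  have "x \<le> 1 + x\<^sup>2" for x :: real using zero_le_power2 [of "x - 1 / 2"] by (simp add: power2_diff power_divide)
  then show "AE z in mu lam. norm (f z) \<le> norm (1 + (cmod (f z))\<^sup>2)" by (intro AE_I2) simp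
qed

lemma integral_norm_bergman_le:
  fixes f :: "complex^'n \<Rightarrow> complex"
  assumes f: "f \<in> vecs (bergman lam)"
  shows "(LINT z|mu lam. cmod (f z)) \<le> nrm (bergman lam) f"
proof -
  have "ip (bergman lam) f f = (LINT z|mu lam. complex_of_real ((cmod (f z))\<^sup>2))"
    unfolding ip_bergman by (simp only: complex_norm_square)
  also have "\<dots> = of_real (LINT z|mu lam. (cmod (f z))\<^sup>2)" by (rule integral_complex_of_real)
  finally have "nrm (bergman lam) f = sqrt (LINT z|mu lam. (cmod (f z))\<^sup>2)" by (simp add: nrm_def)
  then show ?thesis
    using integral_norm_le_sqrt [OF finite_measure_mu [OF lam] _ bergman_integrable [OF f]] f
    by (simp add: measure_mu [OF lam] bergman_vecs)
qed

lemma bergman_reproducing: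
  fixes f :: "complex^'n \<Rightarrow> complex"
  assumes f: "f \<in> vecs (bergman lam)" and w: "norm w < 1"
  shows "f w = (LINT z|mu lam. f z * bergman_kernel lam w z)"
  unfolding bergman_kernel_def
  by (rule reproducing_formula [OF lam _ bergman_integrable [OF f] w, symmetric]) (use f in \<open>simp add: bergman_vecs\<close>)

text \<open>The kernel is bounded along the orbit, so point evaluation there is bounded by the L^1
  norm and hence by the Bergman norm, uniformly in t. As Haar measure has mass 1, this is the
  boundedness of R.\<close>

lemma norm_base_point_eval_le:
  fixes f :: "complex^'n \<Rightarrow> complex"
  assumes f: "f \<in> vecs (bergman lam)" and t: "t \<in> torus"
  shows "cmod (f (base_point t)) \<le> half_plane_gap powr (- lam) * nrm (bergman lam) f"
proof -
  let ?K = "half_plane_gap powr (- lam)"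
  have k: "cmod (bergman_kernel lam (base_point t) z) \<le> ?K" if "z \<in> space (mu lam)" for z :: "complex^'n"
    using that by (intro norm_bergman_kernel_le(2) lam_pos) (auto simp: norm_base_point [OF t])
  have "cmod (f (base_point t)) \<le> (LINT z|mu lam. cmod (f z) * ?K)"
  proof (cases "integrable (mu lam) (\<lambda>z. f z * bergman_kernel lam (base_point t) z)")
    case True
    have "cmod (f (base_point t)) \<le> (LINT z|mu lam. cmod (f z * bergman_kernel lam (base_point t) z))"
      unfolding bergman_reproducing [OF f norm_base_point_less [OF t]] by (rule integral_norm_bound)
    also have "\<dots> \<le> (LINT z|mu lam. cmod (f z) * ?K)"
      by (rule Bochner_Integration.integral_mono [OF integrable_norm [OF True]
            integrable_mult_left [OF integrable_norm [OF bergman_integrable [OF f]]]])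
         (simp add: norm_mult mult_left_mono k)
    finally show ?thesis .
  next
    case False
    \<comment> \<open>If the product is not integrable, its integral is 0 by convention, and the
      reproducing formula then gives the value 0.\<close>
    have "f (base_point t) = 0"
      using bergman_reproducing [OF f norm_base_point_less [OF t]] not_integrable_integral_eq [OF False] by simp
    then show ?thesis by (simp add: Bochner_Integration.integral_nonneg)
  qed
  also have "\<dots> = ?K * (LINT z|mu lam. cmod (f z))" by simp
  also have "\<dots> \<le> ?K * nrm (bergman lam) f" by (intro mult_left_mono integral_norm_bergman_le f) simp
  finally show ?thesis .
qed

lemma sq_integrable_base_point:
  fixes f :: "complex^'n \<Rightarrow> complex"
  assumes f: "f holomorphic_vec_on ball 0 1"
  shows "sq_integrable (\<lambda>t. f (base_point t))"
  by (intro sq_integrable_continuous continuous_on_compose2 [OF holomorphic_vec_on_imp_continuous_on [OF f] continuous_on_base_point])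
     (auto simp: norm_base_point)

lemma restr_in_L2chi:
  fixes f :: "complex^'n \<Rightarrow> complex"
  assumes f: "f \<in> vecs (bergman lam)"
  shows "restr lam f \<in> vecs (L2chi lam)"
  unfolding restr_eq_lift_base_point
  by (intro lift_in_L2chi sq_integrable_base_point) (use f in \<open>simp add: bergman_vecs\<close>)

lemma tilde_restr: "t \<in> torus \<Longrightarrow> tilde lam (restr lam f) t = f (base_point t)"
  unfolding restr_eq_lift_base_point by (rule tilde_lift)

lemma bounded_restr:
  "bounded_op (bergman lam :: (complex^'n) ip_space) (L2chi lam) (restr lam)"
  unfolding bounded_op_def
proof (intro conjI ballI allI)
  fix f g :: "complex^'n \<Rightarrow> complex" and a b
  assume f: "f \<in> vecs (bergman lam)"
  show "restr lam f \<in> vecs (L2chi lam)" by (rule restr_in_L2chi [OF f])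
  assume g: "g \<in> vecs (bergman lam)"
  have "restr lam (\<lambda>p. a * f p + b * g p) = (\<lambda>q. a * restr lam f q + b * restr lam g q)"
    by (auto simp: restr_def algebra_simps)
  then show "same_in (L2chi lam) (restr lam (\<lambda>p. a * f p + b * g p)) (\<lambda>q. a * restr lam f q + b * restr lam g q)"
    using L2chi_lincomb [OF restr_in_L2chi [OF f] restr_in_L2chi [OF g], of a b]
    by (simp only:) (intro same_in_L2chi, auto)
next
  let ?K = "half_plane_gap powr (- lam)"
  have "nrm (L2chi lam) (restr lam f) \<le> ?K * nrm (bergman lam) f" if f: "f \<in> vecs (bergman lam)"
    for f :: "complex^'n \<Rightarrow> complex"
  proof -
    have n0: "0 \<le> nrm (bergman lam) f"
      by (rule order.trans [OF _ integral_norm_bergman_le [OF f]]) (simp add: Bochner_Integration.integral_nonneg)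
    have "(LINT t|haar. (cmod (tilde lam (restr lam f) t))\<^sup>2) \<le> (LINT t::complex^'n|haar. (?K * nrm (bergman lam) f)\<^sup>2)"
    proof (rule Bochner_Integration.integral_mono)
      show "integrable haar (\<lambda>t. (cmod (tilde lam (restr lam f) t))\<^sup>2)"
        using sq_integrable_tilde [OF restr_in_L2chi [OF f]] by (simp add: sq_integrable_def)
      show "(cmod (tilde lam (restr lam f) t))\<^sup>2 \<le> (?K * nrm (bergman lam) f)\<^sup>2" if "t \<in> space haar" for t
        using that norm_base_point_eval_le [OF f, of t] by (intro power_mono) (simp_all add: tilde_restr)
    qed simp
    then show ?thesis unfolding nrm_L2chi [OF restr_in_L2chi [OF f]] using n0 by (simp add: real_le_lsqrt)
  qed
  then show "\<exists>C. \<forall>f\<in>vecs (bergman lam). nrm (L2chi lam) (restr lam f) \<le> C * nrm (bergman lam) (f :: complex^'n \<Rightarrow> complex)"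
    by blast
qed

text \<open>The reproducing formula under an integral over the torus; Fubini applies because the
  kernel is bounded on ball times orbit. With \<open>u\<close> the conjugate of
  \<open>tilde lam g\<close> this gives the adjoint, with \<open>u\<close> a conjugate monomial the
  Fourier coefficients of a restriction.\<close>

lemma bergman_Fubini:
  fixes f u :: "complex^'n \<Rightarrow> complex"
  assumes f: "f \<in> vecs (bergman lam)" and u: "integrable haar u"
  shows "(LINT t|haar. f (base_point t) * u t) =
    (LINT z|mu lam. f z * (LINT t|haar. u t * bergman_kernel lam (base_point t) z))"
proof -
  let ?K = "half_plane_gap powr (- lam)"
  let ?k = "\<lambda>z t::complex^'n. if 1 - herm (base_point t) z \<in> \<real>\<^sub>\<le>\<^sub>0 then 0 else bergman_kernel lam (base_point t) z"
  let ?F = "\<lambda>z t. f z * (u t * ?k z t)"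
  have k: "?k z t = bergman_kernel lam (base_point t) z" if "z \<in> space (mu lam)" "t \<in> space haar" for z t
  proof -
    have "half_plane_gap \<le> Re (1 - herm (base_point t) z)"
      using that by (intro Re_one_minus_herm(2)) (auto simp: norm_base_point)
    then have "1 - herm (base_point t) z \<notin> \<real>\<^sub>\<le>\<^sub>0"
      using half_plane_gap_pos by (auto simp: complex_nonpos_Reals_iff)
    then show ?thesis by simp
  qed
  have kb: "cmod (?k z t) \<le> ?K" if "z \<in> space (mu lam)" "t \<in> space haar" for z t
    unfolding k [OF that] using that by (intro norm_bergman_kernel_le(2) lam_pos) (auto simp: norm_base_point)
  have fm [measurable]: "f \<in> borel_measurable (mu lam)" using bergman_integrable [OF f] by simp
  have um [measurable]: "u \<in> borel_measurable haar" using u by simp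
  have id1: "(\<lambda>z. z) \<in> (mu lam :: (complex^'n) measure) \<rightarrow>\<^sub>M borel"
    unfolding borel_measurable_mu by (rule measurable_restrict_space1) simp
  have id2: "(\<lambda>t. t) \<in> (haar :: (complex^'n) measure) \<rightarrow>\<^sub>M borel"
    unfolding borel_measurable_haar by (rule measurable_restrict_space1) simp
  have "(\<lambda>p. (fst p, snd p)) \<in> (mu lam :: (complex^'n) measure) \<Otimes>\<^sub>M (haar :: (complex^'n) measure) \<rightarrow>\<^sub>M borel \<Otimes>\<^sub>M borel"
    by (intro measurable_Pair measurable_compose [OF measurable_fst id1] measurable_compose [OF measurable_snd id2])
  from measurable_compose [OF this torus_kernel_measurable_pair [of lam]]
  have km: "(\<lambda>(z, t). ?k z t) \<in> borel_measurable (mu lam \<Otimes>\<^sub>M haar)"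
    by (simp add: case_prod_beta')
  have "(\<lambda>p. f (fst p) * (u (snd p) * (case p of (z, t) \<Rightarrow> ?k z t))) \<in> borel_measurable (mu lam \<Otimes>\<^sub>M haar)"
    by (intro borel_measurable_times km measurable_compose [OF measurable_fst fm] measurable_compose [OF measurable_snd um])
  then have Fm: "(\<lambda>(z, t). ?F z t) \<in> borel_measurable (mu lam \<Otimes>\<^sub>M haar)"
    by (simp add: case_prod_beta')
  define M where "M = (LINT t|haar. cmod (u t))"
  have inner: "integrable haar (\<lambda>t. ?F z t)" and inner_le: "(LINT t|haar. cmod (?F z t)) \<le> cmod (f z) * (M * ?K)"
    if z: "z \<in> space (mu lam)" for z
  proof -
    have z1: "norm z \<le> 1" using z by simp
    have "integrable haar (\<lambda>t. f z * (u t * bergman_kernel lam (base_point t) z))"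
      by (intro integrable_mult_right kernel_integrable(2) lam_pos u z1)
    then show i: "integrable haar (\<lambda>t. ?F z t)"
      by (subst Bochner_Integration.integrable_cong [OF refl, where g = "\<lambda>t. f z * (u t * bergman_kernel lam (base_point t) z)"])
         (use k [OF z] in auto)
    have "(LINT t|haar. cmod (?F z t)) \<le> (LINT t|haar. cmod (f z) * (cmod (u t) * ?K))"
    proof (rule Bochner_Integration.integral_mono [OF integrable_norm [OF i]])
      show "cmod (?F z t) \<le> cmod (f z) * (cmod (u t) * ?K)" if "t \<in> space haar" for t
        unfolding norm_mult by (intro mult_left_mono kb z that) auto
    qed (use u in simp)
    also have "\<dots> = cmod (f z) * (M * ?K)" by (simp add: M_def)
    finally show "(LINT t|haar. cmod (?F z t)) \<le> cmod (f z) * (M * ?K)" .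
  qed
  have "integrable (mu lam \<Otimes>\<^sub>M haar) (\<lambda>(z, t). ?F z t)"
  proof (rule mu_haar.Fubini_integrable [OF Fm])
    show "AE z in mu lam. integrable haar (\<lambda>t. case (z, t) of (z, t) \<Rightarrow> ?F z t)"
      using inner by (intro AE_I2) simp
    show "integrable (mu lam) (\<lambda>z. LINT t|haar. norm (case (z, t) of (z, t) \<Rightarrow> ?F z t))"
    proof (rule Bochner_Integration.integrable_bound)
      show "integrable (mu lam) (\<lambda>z. cmod (f z) * (M * ?K))"
        using bergman_integrable [OF f] by simp
      have "(\<lambda>(z, t). norm (?F z t)) \<in> borel_measurable (mu lam \<Otimes>\<^sub>M haar)"
        using measurable_compose [OF Fm, of norm borel] by (simp add: case_prod_beta')
      then have "(\<lambda>z. LINT t|haar. norm (?F z t)) \<in> borel_measurable (mu lam)"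
        by (rule haar.borel_measurable_lebesgue_integral)
      then show "(\<lambda>z. LINT t|haar. norm (case (z, t) of (z, t) \<Rightarrow> ?F z t)) \<in> borel_measurable (mu lam)" by simp
      show "AE z in mu lam. norm (LINT t|haar. norm (case (z, t) of (z, t) \<Rightarrow> ?F z t)) \<le> norm (cmod (f z) * (M * ?K))"
      proof (rule AE_I2)
        fix z :: "complex^'n" assume "z \<in> space (mu lam)"
        from inner_le [OF this]
        have "\<bar>LINT t|haar. cmod (?F z t)\<bar> \<le> \<bar>cmod (f z) * (M * ?K)\<bar>"
          using Bochner_Integration.integral_nonneg [of haar "\<lambda>t. cmod (?F z t)"] by (smt (verit) norm_ge_zero)
        then show "norm (LINT t|haar. norm (case (z, t) of (z, t) \<Rightarrow> ?F z t)) \<le> norm (cmod (f z) * (M * ?K))"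
          by (simp only: real_norm_def prod.case)
      qed
    qed
  qed
  from mu_haar.Fubini_integral [OF this]
  have swap: "(LINT t|haar. LINT z|mu lam. ?F z t) = (LINT z|mu lam. LINT t|haar. ?F z t)" .
  have "(LINT z|mu lam. ?F z t) = f (base_point t) * u t" if t: "t \<in> space haar" for t
  proof -
    have "(LINT z|mu lam. ?F z t) = (LINT z|mu lam. (f z * bergman_kernel lam (base_point t) z) * u t)"
      by (rule Bochner_Integration.integral_cong) (simp_all only: k [OF _ t] mult_ac)
    also have "\<dots> = (LINT z|mu lam. f z * bergman_kernel lam (base_point t) z) * u t"
      by (rule integral_mult_left_zero)
    also have "(LINT z|mu lam. f z * bergman_kernel lam (base_point t) z) = f (base_point t)"
      by (rule bergman_reproducing [OF f norm_base_point_less, symmetric]) (use t in simp)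
    finally show ?thesis .
  qed
  then have "(LINT t|haar. f (base_point t) * u t) = (LINT t|haar. LINT z|mu lam. ?F z t)"
    by (intro Bochner_Integration.integral_cong) simp_all
  also note swap
  also have "(LINT z|mu lam. LINT t|haar. ?F z t) = (LINT z|mu lam. f z * (LINT t|haar. u t * bergman_kernel lam (base_point t) z))"
  proof (rule Bochner_Integration.integral_cong)
    fix z :: "complex^'n" assume z: "z \<in> space (mu lam)"
    have "(LINT t|haar. ?F z t) = (LINT t|haar. f z * (u t * bergman_kernel lam (base_point t) z))"
      by (rule Bochner_Integration.integral_cong) (simp_all only: k [OF z])
    then show "(LINT t|haar. ?F z t) = f z * (LINT t|haar. u t * bergman_kernel lam (base_point t) z)" by simp
  qed simp
  finally show ?thesis .
qed

text \<open>Supplies an operator that meets the specification of \<open>hilbert_adjoint\<close>, so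
  that the choice behind \<open>restr_adj\<close> satisfies it as well.\<close>

lemma restr_adj_exists:
  "\<exists>S. \<forall>g\<in>vecs (L2chi lam :: ((complex^'n) \<times> real) ip_space). S g \<in> vecs (bergman lam) \<and>
    (\<forall>f\<in>vecs (bergman lam). ip (L2chi lam) (restr lam f) g = ip (bergman lam) f (S g))"
proof (intro exI [of _ "\<lambda>g. kernel_integral lam (tilde lam g)"] ballI conjI)
  fix g :: "(complex^'n) \<times> real \<Rightarrow> complex" assume g: "g \<in> vecs (L2chi lam)"
  have gi: "integrable haar (tilde lam g)" by (rule sq_integrable_imp_integrable [OF sq_integrable_tilde [OF g]])
  show "kernel_integral lam (tilde lam g) \<in> vecs (bergman lam)"
    by (rule bounded_holomorphic_in_bergman [OF kernel_integral_holomorphic [OF lam_pos gi]],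
        rule norm_kernel_integral_le [OF lam_pos gi]) simp
  fix f :: "complex^'n \<Rightarrow> complex" assume f: "f \<in> vecs (bergman lam)"
  have "ip (L2chi lam) (restr lam f) g = (LINT t|haar. f (base_point t) * cnj (tilde lam g t))"
    unfolding ip_L2chi [OF restr_in_L2chi [OF f] g]
    by (intro Bochner_Integration.integral_cong) (simp_all add: tilde_restr)
  also have "\<dots> = (LINT z|mu lam. f z * (LINT t|haar. cnj (tilde lam g t) * bergman_kernel lam (base_point t) z))"
    by (rule bergman_Fubini [OF f]) (use gi in simp)
  also have "\<dots> = (LINT z|mu lam. f z * cnj (kernel_integral lam (tilde lam g) z))"
  proof (rule Bochner_Integration.integral_cong)
    fix z :: "complex^'n" assume "z \<in> space (mu lam)"
    then have z: "norm z \<le> 1" by simp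
    have "cnj (kernel_integral lam (tilde lam g) z) = (LINT t|haar. cnj (tilde lam g t * bergman_kernel lam z (base_point t)))"
      unfolding kernel_integral_def by (rule Bochner_Integration.integral_cnj [symmetric])
    also have "\<dots> = (LINT t|haar. cnj (tilde lam g t) * bergman_kernel lam (base_point t) z)"
      by (rule Bochner_Integration.integral_cong)
         (simp_all add: cnj_bergman_kernel(1) [OF z] norm_base_point)
    finally show "f z * (LINT t|haar. cnj (tilde lam g t) * bergman_kernel lam (base_point t) z) =
        f z * cnj (kernel_integral lam (tilde lam g) z)" by simp
  qed simp
  finally show "ip (L2chi lam) (restr lam f) g = ip (bergman lam) f (kernel_integral lam (tilde lam g))"
    by (simp add: ip_bergman)
qed

lemma
  fixes g :: "(complex^'n) \<times> real \<Rightarrow> complex"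
  assumes g: "g \<in> vecs (L2chi lam)"
  shows restr_adj_in_bergman: "restr_adj lam g \<in> vecs (bergman lam)"
    and ip_restr_adj: "f \<in> vecs (bergman lam) \<Longrightarrow>
      ip (L2chi lam) (restr lam f) g = ip (bergman lam) f (restr_adj lam g)"
proof -
  have "\<forall>g\<in>vecs (L2chi lam :: ((complex^'n) \<times> real) ip_space). restr_adj lam g \<in> vecs (bergman lam) \<and>
    (\<forall>f\<in>vecs (bergman lam). ip (L2chi lam) (restr lam f) g = ip (bergman lam) f (restr_adj lam g))"
    unfolding restr_adj_def hilbert_adjoint_def by (rule someI_ex [OF restr_adj_exists])
  then show "restr_adj lam g \<in> vecs (bergman lam)"
    and "f \<in> vecs (bergman lam) \<Longrightarrow> ip (L2chi lam) (restr lam f) g = ip (bergman lam) f (restr_adj lam g)"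
    using g by blast+
qed

text \<open>The value at w = t z_0 is the inner product with the kernel at w; moving the adjoint
  across makes it an integral over the torus against the kernel restricted to the orbit, which is
  \<phi>(t/s). This uses only the adjoint property and holomorphy, so it holds for every t and for
  any choice of adjoint.\<close>

lemma restr_adj_base_point:
  fixes g :: "(complex^'n) \<times> real \<Rightarrow> complex"
  assumes g: "g \<in> vecs (L2chi lam)" and t: "t \<in> torus"
  shows "restr_adj lam g (base_point t) = conv (tilde lam g) (phi lam) t"
proof -
  let ?w = "base_point t" and ?S = "restr_adj lam g"
  have w: "norm ?w \<le> sqrt (1 / 2)" using norm_base_point [OF t] by simp
  let ?k = "\<lambda>z. bergman_kernel lam z ?w"
  have k: "?k \<in> vecs (bergman lam)"
    by (rule bounded_holomorphic_in_bergman [OF bergman_kernel_holomorphic [OF w]],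
        rule norm_bergman_kernel_le(1) [OF lam_pos _ w]) simp
  have "?S ?w = (LINT z|mu lam. ?S z * cnj (?k z))"
    unfolding bergman_reproducing [OF restr_adj_in_bergman [OF g] norm_base_point_less [OF t]]
    by (rule Bochner_Integration.integral_cong) (simp_all add: cnj_bergman_kernel(1) [OF _ w])
  also have "\<dots> = cnj (ip (bergman lam) ?k ?S)"
    unfolding ip_bergman by (rule integral_cnj_mult_swap [symmetric])
  also have "\<dots> = cnj (ip (L2chi lam) (restr lam ?k) g)"
    by (simp only: ip_restr_adj [OF g k])
  also have "\<dots> = (LINT s|haar. tilde lam g s * cnj (tilde lam (restr lam ?k) s))"
    unfolding ip_L2chi [OF restr_in_L2chi [OF k] g] by (rule integral_cnj_mult_swap)
  also have "\<dots> = conv (tilde lam g) (phi lam) t"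
    unfolding conv_def
  proof (rule Bochner_Integration.integral_cong)
    fix s :: "complex^'n" assume "s \<in> space haar"
    then have s: "s \<in> torus" by simp
    define r where "r = complex_of_real (sqrt (2 * real CARD('n)))"
    have rr: "r * r = of_real (2 * real CARD('n))"
      unfolding r_def of_real_mult [symmetric] by simp
    have "base_point s $ i * cnj (?w $ i) = (of_real (1 / (2 * real CARD('n))) * cnj (t $ i)) * s $ i" for i
    proof -
      have "cnj r = r" by (simp add: r_def)
      then have "base_point s $ i * cnj (?w $ i) = (s $ i * cnj (t $ i)) / (r * r)"
        unfolding base_point_def r_def [symmetric] by simp
      then show ?thesis unfolding rr by simp
    qed
    then have "herm (base_point s) ?w = (\<Sum>i\<in>UNIV. (of_real (1 / (2 * real CARD('n))) * cnj (t $ i)) * s $ i)"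
      unfolding herm_def by (simp only:)
    then have "cnj (phi lam (\<chi> i. t $ i / s $ i)) = ?k (base_point s)"
      unfolding cnj_phi_divide [OF t s] bergman_kernel_def by simp
    then have "cnj (?k (base_point s)) = phi lam (\<chi> i. t $ i / s $ i)"
      by (metis complex_cnj_cnj)
    then show "tilde lam g s * cnj (tilde lam (restr lam ?k) s) = tilde lam g s * phi lam (\<chi> i. t $ i / s $ i)"
      by (simp add: tilde_restr [OF s])
  qed simp
  finally show ?thesis .
qed

text \<open>As a function of t the kernel is a power of 1 minus a linear form, so it has frequencies
  in the cone only; \<open>bergman_Fubini\<close> transfers this to every restriction.\<close>

lemma fourier_restr_eq_0:
  fixes f :: "complex^'n \<Rightarrow> complex"
  assumes f: "f \<in> vecs (bergman lam)" and \<alpha>: "\<not> (\<forall>i. \<alpha> $ i \<ge> 0)"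
  shows "fourier (\<lambda>t. f (base_point t)) \<alpha> = 0"
proof -
  have mi: "integrable haar (\<lambda>t. cnj (monomial \<alpha> t))"
    using sq_integrable_imp_integrable [OF sq_integrable_monomial] by simp
  have "fourier (\<lambda>t. f (base_point t)) \<alpha> =
      (LINT z|mu lam. f z * (LINT t|haar. cnj (monomial \<alpha> t) * bergman_kernel lam (base_point t) z))"
    unfolding fourier_def by (rule bergman_Fubini [OF f mi])
  also have "\<dots> = (LINT z::complex^'n|mu lam. 0)"
  proof (rule Bochner_Integration.integral_cong)
    fix z :: "complex^'n" assume "z \<in> space (mu lam)"
    then have z: "norm z < 1" by simp
    \<comment> \<open>By Cauchy-Schwarz the moduli of the b_i add up to at most |z| sqrt (n / (2n)),
      which is below 1.\<close>
    define b where "b = (\<chi> i. cnj (z $ i) / of_real (sqrt (2 * real CARD('n))))"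
    have "(\<Sum>i\<in>UNIV. cmod (b $ i)) = (\<Sum>i\<in>UNIV. \<bar>cmod (z $ i)\<bar> * \<bar>1 / sqrt (2 * real CARD('n))\<bar>)"
      by (intro sum.cong) (simp_all add: b_def norm_divide)
    also have "\<dots> \<le> L2_set (\<lambda>i. cmod (z $ i)) UNIV * L2_set (\<lambda>i::'n. 1 / sqrt (2 * real CARD('n))) UNIV"
      by (rule L2_set_mult_ineq)
    also have "L2_set (\<lambda>i. cmod (z $ i)) UNIV = norm z" by (simp add: norm_vec_def)
    also have "L2_set (\<lambda>i::'n. 1 / sqrt (2 * real CARD('n))) UNIV = sqrt (1 / 2)"
      by (simp add: L2_set_def power_divide)
    also have "norm z * sqrt (1 / 2) \<le> norm z * 1" by (intro mult_left_mono) auto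
    finally have b: "(\<Sum>i\<in>UNIV. cmod (b $ i)) < 1" using z by simp
    have eq: "cnj (monomial \<alpha> t) * bergman_kernel lam (base_point t) z =
        (1 - (\<Sum>i\<in>UNIV. b $ i * t $ i)) powr (- of_real lam) * cnj (monomial \<alpha> t)" for t
      by (simp add: bergman_kernel_def herm_def base_point_def b_def mult_ac)
    have "(LINT t|haar. cnj (monomial \<alpha> t) * bergman_kernel lam (base_point t) z) =
        of_real (Gamma (lam + of_int (\<Sum>i\<in>UNIV. \<alpha> $ i)) / Gamma lam) * multi_coeff b \<alpha>"
      using integral_torus_kernel [OF lam_pos b, of \<alpha>] by (simp only: eq)
    then show "f z * (LINT t|haar. cnj (monomial \<alpha> t) * bergman_kernel lam (base_point t) z) = 0"
      by (simp add: multi_coeff_neg [OF \<alpha>])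
  qed simp
  finally show ?thesis by simp
qed

end

section \<open>Holomorphic monomials and the analytic part of a trigonometric polynomial\<close>

lemma holomorphic_vec_on_const: "(\<lambda>z. c) holomorphic_vec_on S"
  unfolding holomorphic_vec_on_def by (auto intro!: exI [of _ "\<lambda>v. 0"])

lemma holomorphic_vec_on_nth: "(\<lambda>z. z $ i) holomorphic_vec_on S"
  unfolding holomorphic_vec_on_def
proof
  fix z :: "complex^'a" assume "z \<in> S"
  have "((\<lambda>z. z $ i) has_derivative (\<lambda>v. v $ i)) (at z)"
    by (rule bounded_linear.has_derivative [OF bounded_linear_vec_nth has_derivative_ident])
  then show "\<exists>D. ((\<lambda>z. z $ i) has_derivative D) (at z) \<and> (\<forall>c v. D (c *s v) = c * D v)"
    by (intro exI [of _ "\<lambda>v. v $ i"]) simp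
qed

lemma holomorphic_vec_on_add:
  assumes "f holomorphic_vec_on S" "g holomorphic_vec_on S"
  shows "(\<lambda>z. f z + g z) holomorphic_vec_on S"
  unfolding holomorphic_vec_on_def
proof
  fix z assume "z \<in> S"
  then obtain D E where "(f has_derivative D) (at z)" "\<forall>c v. D (c *s v) = c * D v"
      "(g has_derivative E) (at z)" "\<forall>c v. E (c *s v) = c * E v"
    using assms unfolding holomorphic_vec_on_def by metis
  then show "\<exists>D. ((\<lambda>z. f z + g z) has_derivative D) (at z) \<and> (\<forall>c v. D (c *s v) = c * D v)"
    by (intro exI [of _ "\<lambda>v. D v + E v"]) (auto intro: has_derivative_add simp: distrib_left)
qed

lemma holomorphic_vec_on_mult:
  assumes "f holomorphic_vec_on S" "g holomorphic_vec_on S"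
  shows "(\<lambda>z. f z * g z) holomorphic_vec_on S"
  unfolding holomorphic_vec_on_def
proof
  fix z assume "z \<in> S"
  then obtain D E where "(f has_derivative D) (at z)" "\<forall>c v. D (c *s v) = c * D v"
      "(g has_derivative E) (at z)" "\<forall>c v. E (c *s v) = c * E v"
    using assms unfolding holomorphic_vec_on_def by metis
  moreover from this have "((\<lambda>z. f z * g z) has_derivative (\<lambda>v. f z * E v + D v * g z)) (at z)"
    by (intro has_derivative_mult)
  ultimately show "\<exists>D. ((\<lambda>z. f z * g z) has_derivative D) (at z) \<and> (\<forall>c v. D (c *s v) = c * D v)"
    by (intro exI [of _ "\<lambda>v. f z * E v + D v * g z"]) (simp add: distrib_left mult_ac)
qed

lemma holomorphic_vec_on_power: "f holomorphic_vec_on S \<Longrightarrow> (\<lambda>z. f z ^ k) holomorphic_vec_on S"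
  by (induction k) (auto intro: holomorphic_vec_on_const holomorphic_vec_on_mult)

lemma holomorphic_vec_on_prod:
  "finite I \<Longrightarrow> (\<And>i. i \<in> I \<Longrightarrow> f i holomorphic_vec_on S) \<Longrightarrow> (\<lambda>z. \<Prod>i\<in>I. f i z) holomorphic_vec_on S"
  by (induction rule: finite_induct) (auto intro: holomorphic_vec_on_const holomorphic_vec_on_mult)

text \<open>Monomials from the cone are restrictions of bounded holomorphic functions and go into
  \<open>F\<close>; the others go into \<open>q\<close>. The last clause says that \<open>q\<close>
  is orthogonal to everything with frequencies in the cone, in the form in which the closure
  argument uses it.\<close>

lemma trig_polys_split:
  fixes p :: "complex^'n \<Rightarrow> complex"
  assumes "p \<in> trig_polys"
  shows "\<exists>F q. F holomorphic_vec_on ball 0 1 \<and> (\<exists>B. \<forall>z. norm z < 1 \<longrightarrow> cmod (F z) \<le> B) \<and> q \<in> trig_polys \<and>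
    (\<forall>t\<in>torus. p t = F (base_point t) + q t) \<and>
    (\<forall>h. sq_integrable h \<and> (\<forall>\<alpha>. \<not> (\<forall>i. \<alpha> $ i \<ge> 0) \<longrightarrow> fourier h \<alpha> = 0) \<longrightarrow>
      (LINT t|haar. h t * cnj (q t)) = 0)"
  using assms
proof (induction rule: trig_polys.induct)
  case (monomial c \<alpha>)
  show ?case
  proof (cases "\<forall>i. \<alpha> $ i \<ge> 0")
    case True
    define r where "r = complex_of_real (sqrt (2 * real CARD('n)))"
    \<comment> \<open>Compensates for the division of each coordinate by sqrt (2n) in
      \<open>base_point\<close>.\<close>
    define C where "C = c * (\<Prod>i\<in>UNIV. r ^ nat (\<alpha> $ i))"
    define P where "P z = (\<Prod>i\<in>UNIV. z $ i ^ nat (\<alpha> $ i))" for z :: "complex^'n"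
    have r: "r \<noteq> 0" by (simp add: r_def)
    have m: "c * monomial \<alpha> t = C * P (base_point t)" for t
    proof -
      have "monomial \<alpha> t = (\<Prod>i\<in>UNIV. t $ i ^ nat (\<alpha> $ i))"
        unfolding monomial_def using True by (intro prod.cong) (auto simp: power_int_def)
      also have "\<dots> = (\<Prod>i\<in>UNIV. r ^ nat (\<alpha> $ i) * base_point t $ i ^ nat (\<alpha> $ i))"
        unfolding base_point_def r_def [symmetric] using r by (intro prod.cong) (auto simp: power_divide)
      also have "\<dots> = (\<Prod>i\<in>UNIV. r ^ nat (\<alpha> $ i)) * P (base_point t)"
        unfolding P_def by (rule prod.distrib)
      finally show ?thesis by (simp add: C_def mult.assoc)
    qed
    have "cmod (C * P z) \<le> cmod C" if z: "norm z < 1" for z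
    proof -
      have "cmod (z $ i) ^ k \<le> 1" for i k
        using Finite_Cartesian_Product.norm_nth_le [of z i] z by (intro power_le_one) auto
      then have "cmod (P z) \<le> 1"
        unfolding P_def prod_norm [symmetric] norm_power by (intro prod_le_1) auto
      then show ?thesis by (simp add: norm_mult mult_left_le)
    qed
    moreover have "(\<lambda>z. C * P z) holomorphic_vec_on ball 0 1"
      unfolding P_def
      by (intro holomorphic_vec_on_mult holomorphic_vec_on_const holomorphic_vec_on_prod holomorphic_vec_on_power
          holomorphic_vec_on_nth) simp
    ultimately show ?thesis
      using trig_polys_const [of 0] m by - (rule exI [of _ "\<lambda>z. C * P z"], rule exI [of _ "\<lambda>t. 0"], auto)
  next
    case False
    have "(LINT t|haar. h t * cnj (c * monomial \<alpha> t)) = 0" if "fourier h \<alpha> = 0" for h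
    proof -
      have "(LINT t|haar. h t * cnj (c * monomial \<alpha> t)) = (LINT t|haar. cnj c * (h t * cnj (monomial \<alpha> t)))"
        by (simp add: mult_ac)
      also have "\<dots> = cnj c * fourier h \<alpha>" unfolding fourier_def by (rule integral_mult_right_zero)
      finally show ?thesis using that by simp
    qed
    then show ?thesis using False trig_polys.monomial [of c \<alpha>]
      by (intro exI [of _ "\<lambda>z. 0"] exI [of _ "\<lambda>t. c * monomial \<alpha> t"]) (auto intro: holomorphic_vec_on_const)
  qed
next
  case (add p q)
  obtain F p' B where *: "F holomorphic_vec_on ball 0 1" "\<forall>z. norm z < 1 \<longrightarrow> cmod (F z) \<le> B" "p' \<in> trig_polys"
      "\<forall>t\<in>torus. p t = F (base_point t) + p' t"
      "\<forall>h. sq_integrable h \<and> (\<forall>\<alpha>. \<not> (\<forall>i. \<alpha> $ i \<ge> 0) \<longrightarrow> fourier h \<alpha> = 0) \<longrightarrow> (LINT t|haar. h t * cnj (p' t)) = 0"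
    using add.IH(1) by (elim exE conjE)
  then have p: "F holomorphic_vec_on ball 0 1" "norm z < 1 \<Longrightarrow> cmod (F z) \<le> B" "p' \<in> trig_polys"
      "t \<in> torus \<Longrightarrow> p t = F (base_point t) + p' t" for z t by blast+
  note p_orth = *(5)
  obtain G q' B' where *: "G holomorphic_vec_on ball 0 1" "\<forall>z. norm z < 1 \<longrightarrow> cmod (G z) \<le> B'" "q' \<in> trig_polys"
      "\<forall>t\<in>torus. q t = G (base_point t) + q' t"
      "\<forall>h. sq_integrable h \<and> (\<forall>\<alpha>. \<not> (\<forall>i. \<alpha> $ i \<ge> 0) \<longrightarrow> fourier h \<alpha> = 0) \<longrightarrow> (LINT t|haar. h t * cnj (q' t)) = 0"
    using add.IH(2) by (elim exE conjE)
  then have q: "G holomorphic_vec_on ball 0 1" "norm z < 1 \<Longrightarrow> cmod (G z) \<le> B'" "q' \<in> trig_polys"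
      "t \<in> torus \<Longrightarrow> q t = G (base_point t) + q' t" for z t by blast+
  note q_orth = *(5)
  show ?case
  proof (rule exI [of _ "\<lambda>z. F z + G z"], rule exI [of _ "\<lambda>t. p' t + q' t"], intro conjI allI impI ballI)
    show "(\<lambda>z. F z + G z) holomorphic_vec_on ball 0 1" by (rule holomorphic_vec_on_add [OF p(1) q(1)])
    show "\<exists>B. \<forall>z. norm z < 1 \<longrightarrow> cmod (F z + G z) \<le> B"
      using norm_triangle_mono [OF p(2) q(2)] by blast
    show "(\<lambda>t. p' t + q' t) \<in> trig_polys" by (rule trig_polys.add [OF p(3) q(3)])
    show "p t + q t = F (base_point t) + G (base_point t) + (p' t + q' t)" if "t \<in> torus" for t
      by (simp add: p(4) [OF that] q(4) [OF that])
    fix h :: "complex^'n \<Rightarrow> complex"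
    assume h: "sq_integrable h \<and> (\<forall>\<alpha>. \<not> (\<forall>i. \<alpha> $ i \<ge> 0) \<longrightarrow> fourier h \<alpha> = 0)"
    have "(LINT t|haar. h t * cnj (p' t + q' t)) = (LINT t|haar. h t * cnj (p' t) + h t * cnj (q' t))"
      by (simp add: distrib_left)
    also have "\<dots> = (LINT t|haar. h t * cnj (p' t)) + (LINT t|haar. h t * cnj (q' t))"
      using h by (intro Bochner_Integration.integral_add sq_integrable_mult_cnj sq_integrable_trig [OF p(3)] sq_integrable_trig [OF q(3)]) auto
    finally show "(LINT t|haar. h t * cnj (p' t + q' t)) = 0"
      using mp [OF spec [OF p_orth] h] mp [OF spec [OF q_orth] h] by simp
  qed
qed

section \<open>Regular distributions\<close>

lemma abs_unit_angle_le: "\<bar>unit_angle z\<bar> \<le> 1 / 2"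
  using Arg_bounded [of z] by (auto simp: unit_angle_def abs_le_iff field_simps)

lemma torus_exp_unit_angle:
  "t \<in> torus \<Longrightarrow> torus_exp (\<chi> i. unit_angle (t $ i)) = t"
  by (simp add: torus_exp_def vec_eq_iff cis_unit_angle torus_nth)

lemma test_function_continuous:
  assumes "\<psi> \<in> test_functions"
  shows "continuous_on UNIV (\<lambda>\<theta>. \<psi> (torus_exp \<theta>))"
proof -
  have "torus_deriv [] \<psi> differentiable (at \<theta>)" for \<theta>
    using assms unfolding test_functions_def by blast
  then have "(\<lambda>\<theta>. \<psi> (torus_exp \<theta>)) differentiable (at \<theta>)" for \<theta>
    by (simp add: torus_deriv_def)
  then show ?thesis
    by (intro continuous_at_imp_continuous_on ballI differentiable_imp_continuous_within) simp
qed

text \<open>Smoothness is given for the pullback along \<open>torus_exp\<close> only; composing it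
  with the Borel inverse built from \<open>unit_angle\<close> recovers the function on the
  torus.\<close>

lemma test_function_measurable:
  assumes "\<psi> \<in> test_functions"
  shows "\<psi> \<in> borel_measurable haar"
proof -
  have "(\<lambda>t::complex^'a. \<chi> i. unit_angle (t $ i)) \<in> borel_measurable borel"
  proof (subst borel_measurable_euclidean_space, rule ballI)
    fix b :: "real^'a" assume "b \<in> Basis"
    then obtain j where b: "b = axis j 1" by (auto simp: Basis_vec_def)
    have "(\<lambda>t::complex^'a. t $ j) \<in> borel_measurable borel"
      by (intro borel_measurable_continuous_onI continuous_intros)
    then have "(\<lambda>t::complex^'a. unit_angle (t $ j)) \<in> borel_measurable borel"
      by (rule measurable_compose [OF _ unit_angle_measurable])
    then show "(\<lambda>t::complex^'a. (\<chi> i. unit_angle (t $ i)) \<bullet> b) \<in> borel_measurable borel"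
      by (simp add: b inner_axis)
  qed
  from measurable_compose [OF this borel_measurable_continuous_onI [OF test_function_continuous [OF assms]]]
  have "(\<lambda>t. \<psi> (torus_exp (\<chi> i. unit_angle (t $ i)))) \<in> borel_measurable haar"
    unfolding borel_measurable_haar by (rule measurable_restrict_space1)
  then show ?thesis
    by (subst measurable_cong [where g = "\<lambda>t. \<psi> (torus_exp (\<chi> i. unit_angle (t $ i)))"])
       (simp_all add: torus_exp_unit_angle)
qed

lemma test_function_le_Ck_norm:
  fixes \<psi> :: "complex^'n \<Rightarrow> complex"
  assumes \<psi>: "\<psi> \<in> test_functions" and t: "t \<in> torus"
  shows "cmod (\<psi> t) \<le> Ck_norm 0 \<psi>"
proof -
  \<comment> \<open>A real supremum is informative only once the set is known to be bounded. This
    compact cube already parametrises the whole torus, so the values there bound all values.\<close>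
  let ?K = "cbox (\<chi> i. - 1 / 2) (\<chi> i. 1 / 2) :: (real^'n) set"
  have "bounded ((\<lambda>\<theta>. \<psi> (torus_exp \<theta>)) ` ?K)"
    by (intro compact_imp_bounded compact_continuous_image continuous_on_subset [OF test_function_continuous [OF \<psi>]]) auto
  then obtain B where B: "\<And>\<theta>. \<theta> \<in> ?K \<Longrightarrow> cmod (\<psi> (torus_exp \<theta>)) \<le> B" unfolding bounded_iff by blast
  have torus_B: "cmod (\<psi> s) \<le> B" if s: "s \<in> torus" for s
  proof -
    have "- 1 / 2 \<le> unit_angle z" "unit_angle z \<le> 1 / 2" for z
      using abs_unit_angle_le [of z] by linarith+
    then have "(\<chi> i. unit_angle (s $ i)) \<in> ?K" by (simp add: mem_box_cart del: divide_le_eq_numeral1 le_divide_eq_numeral1)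
    from B [OF this] show ?thesis by (simp add: torus_exp_unit_angle [OF s])
  qed
  let ?F = "\<lambda>(is, \<theta>). cmod (torus_deriv is \<psi> \<theta>)"
  have S: "{is. length is \<le> 0} \<times> UNIV = {[] :: 'n list} \<times> (UNIV :: (real^'n) set)" by auto
  have "?F ([], \<chi> i. unit_angle (t $ i)) \<le> Ck_norm 0 \<psi>"
    unfolding Ck_norm_def S
  proof (rule cSUP_upper)
    show "bdd_above (?F ` ({[]} \<times> UNIV))"
      by (rule bdd_aboveI [of _ B]) (auto simp: torus_deriv_def torus_B)
  qed simp
  then show ?thesis by (simp add: torus_deriv_def torus_exp_unit_angle [OF t])
qed

text \<open>A distribution of order 0, the constant being the L^1 norm of \<open>h\<close>.\<close>

lemma distribution_regular_dist:
  fixes h :: "complex^'n \<Rightarrow> complex"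
  assumes h: "integrable haar h"
  shows "distribution (regular_dist h)"
  unfolding distribution_def
proof (intro conjI ballI allI)
  have i: "integrable haar (\<lambda>t. h t * \<psi> t)" if \<psi>: "\<psi> \<in> test_functions" for \<psi>
    by (rule integrable_mult_bounded [OF h test_function_measurable [OF \<psi>] test_function_le_Ck_norm [OF \<psi>]])
  show "regular_dist h (\<lambda>t. a * \<psi> t + b * \<eta> t) = a * regular_dist h \<psi> + b * regular_dist h \<eta>"
    if "\<psi> \<in> test_functions" "\<eta> \<in> test_functions" for \<psi> \<eta> a b
  proof -
    have "regular_dist h (\<lambda>t. a * \<psi> t + b * \<eta> t) = (LINT t|haar. a * (h t * \<psi> t) + b * (h t * \<eta> t))"
      by (simp add: regular_dist_def algebra_simps)
    also have "\<dots> = (LINT t|haar. a * (h t * \<psi> t)) + (LINT t|haar. b * (h t * \<eta> t))"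
      by (intro Bochner_Integration.integral_add integrable_mult_right i that)
    finally show ?thesis by (simp add: regular_dist_def)
  qed
  have "cmod (regular_dist h \<psi>) \<le> (LINT t|haar. cmod (h t)) * Ck_norm 0 \<psi>" if \<psi>: "\<psi> \<in> test_functions" for \<psi>
  proof -
    have "cmod (regular_dist h \<psi>) \<le> (LINT t|haar. cmod (h t * \<psi> t))"
      unfolding regular_dist_def by (rule integral_norm_bound)
    also have "\<dots> \<le> (LINT t|haar. cmod (h t) * Ck_norm 0 \<psi>)"
    proof (rule Bochner_Integration.integral_mono [OF integrable_norm [OF i [OF \<psi>]]])
      show "cmod (h t * \<psi> t) \<le> cmod (h t) * Ck_norm 0 \<psi>" if "t \<in> space haar" for t
        unfolding norm_mult using that by (intro mult_left_mono test_function_le_Ck_norm [OF \<psi>]) auto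
    qed (use h in simp)
    finally show ?thesis by simp
  qed
  then show "\<exists>C k. \<forall>\<psi>\<in>test_functions. cmod (regular_dist h \<psi>) \<le> C * Ck_norm k \<psi>" by blast
qed

lemma dist_fourier_regular_dist: "dist_fourier (regular_dist h) \<alpha> = fourier h \<alpha>"
  by (simp add: dist_fourier_def regular_dist_def fourier_def)

text \<open>Fourier coefficients are continuous functionals, so those vanishing on the range vanish
  on its closure. Conversely, an approximating trigonometric polynomial can be stripped of its
  frequencies off the cone, after which it is a restriction.\<close>

lemma closure_range_restr:
  fixes lam :: real
  assumes lam: "lam > real CARD('n::finite)"
  shows "closure_in (L2chi lam) (restr lam ` vecs (bergman lam :: (complex^'n) ip_space)) =
    {f \<in> vecs (L2chi lam). \<forall>\<alpha> :: int^'n. \<not> (\<forall>i. \<alpha> $ i \<ge> 0) \<longrightarrow> fourier (tilde lam f) \<alpha> = 0}"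
    (is "?L = ?R")
proof (intro equalityI subsetI)
  interpret semi_inner_product "L2chi lam :: ((complex^'n) \<times> real) ip_space"
    by (rule semi_inner_product_L2chi)
  note R_vecs = restr_in_L2chi [OF lam]
  have FR: "fourier (tilde lam (restr lam F)) \<alpha> = fourier (\<lambda>t. F (base_point t)) \<alpha>"
    for F :: "complex^'n \<Rightarrow> complex" and \<alpha>
    by (rule fourier_cong) (rule tilde_restr [OF lam])
  {
    fix f :: "(complex^'n) \<times> real \<Rightarrow> complex" assume "f \<in> ?L"
    then have f: "f \<in> vecs (L2chi lam)"
      and approx: "\<And>e. e > 0 \<Longrightarrow> \<exists>F\<in>vecs (bergman lam). nrm (L2chi lam) (\<lambda>p. f p - restr lam F p) < e"
      by (auto simp: closure_in_def)
    have "fourier (tilde lam f) \<alpha> = 0" if \<alpha>: "\<not> (\<forall>i. \<alpha> $ i \<ge> 0)" for \<alpha>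
    proof (rule ccontr)
      assume "fourier (tilde lam f) \<alpha> \<noteq> 0"
      \<comment> \<open>The tolerance is the modulus of the coefficient itself: pairing with the
        unit vector \<open>?e\<close> then bounds that modulus strictly by itself.\<close>
      then obtain F where F: "F \<in> vecs (bergman lam)"
          "nrm (L2chi lam) (\<lambda>p. f p - restr lam F p) < cmod (fourier (tilde lam f) \<alpha>)"
        using approx [of "cmod (fourier (tilde lam f) \<alpha>)"] by auto
      let ?e = "lift lam (monomial \<alpha>)"
      have e: "?e \<in> vecs (L2chi lam)" by (rule lift_in_L2chi [OF sq_integrable_monomial])
      have "ip (L2chi lam) (\<lambda>p. f p - restr lam F p) ?e = fourier (tilde lam f) \<alpha>"
        using fourier_restr_eq_0 [OF lam F(1) \<alpha>] FR [of F \<alpha>]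
        by (simp add: ip_diff [OF f R_vecs [OF F(1)] e] ip_lift_monomial f R_vecs [OF F(1)])
      then show False
        using Cauchy_Schwarz [OF vecs_diff [OF f R_vecs [OF F(1)]] e] F(2) by (simp add: nrm_lift_monomial)
    qed
    then show "f \<in> ?R" using f by blast
  next
    fix f :: "(complex^'n) \<times> real \<Rightarrow> complex" assume "f \<in> ?R"
    then have f: "f \<in> vecs (L2chi lam)"
      and zero: "\<And>\<alpha> :: int^'n. \<not> (\<forall>i. \<alpha> $ i \<ge> 0) \<Longrightarrow> fourier (tilde lam f) \<alpha> = 0" by auto
    have "\<exists>g\<in>restr lam ` vecs (bergman lam). nrm (L2chi lam) (\<lambda>p. f p - g p) < e" if e: "e > 0" for e
    proof -
      have fs: "sq_integrable (tilde lam f)" by (rule sq_integrable_tilde [OF f])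
      obtain p where p: "p \<in> trig_polys" "(LINT t|haar. (cmod (tilde lam f t - p t))\<^sup>2) < e\<^sup>2"
        using trig_approx_sq_integrable [OF fs] e unfolding trig_approx_def by (meson zero_less_power)
      obtain F q B where *: "F holomorphic_vec_on ball 0 1" "\<forall>z. norm z < 1 \<longrightarrow> cmod (F z) \<le> B" "q \<in> trig_polys"
          "\<forall>t\<in>torus. p t = F (base_point t) + q t"
          "\<forall>h. sq_integrable h \<and> (\<forall>\<alpha>. \<not> (\<forall>i. \<alpha> $ i \<ge> 0) \<longrightarrow> fourier h \<alpha> = 0) \<longrightarrow> (LINT t|haar. h t * cnj (q t)) = 0"
        using trig_polys_split [OF p(1)] by (elim exE conjE)
      then have F: "F holomorphic_vec_on ball 0 1" "norm z < 1 \<Longrightarrow> cmod (F z) \<le> B"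
          and q: "q \<in> trig_polys" "t \<in> torus \<Longrightarrow> p t = F (base_point t) + q t" for z t by blast+
      have FB: "F \<in> vecs (bergman lam)" by (rule bounded_holomorphic_in_bergman [OF lam F])
      let ?h = "tilde lam (\<lambda>p. f p - restr lam F p)"
      have d: "(\<lambda>p. f p - restr lam F p) \<in> vecs (L2chi lam)" by (rule vecs_diff [OF f R_vecs [OF FB]])
      have h: "sq_integrable ?h" by (rule sq_integrable_tilde [OF d])
      have h_eq: "?h t = tilde lam f t - F (base_point t)" if t: "t \<in> torus" for t
        using tilde_lincomb [OF f R_vecs [OF FB] t, of 1 "- 1"] tilde_restr [OF lam t, of F] by simp
      have "fourier ?h \<alpha> = 0" if \<alpha>: "\<not> (\<forall>i. \<alpha> $ i \<ge> 0)" for \<alpha>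
        using fourier_tilde_lincomb [OF f R_vecs [OF FB], of 1 "- 1" \<alpha>] zero [OF \<alpha>]
          fourier_restr_eq_0 [OF lam FB \<alpha>] FR [of F \<alpha>] by simp
      then have "(LINT t|haar. ?h t * cnj (q t)) = 0" using h *(5) by blast
      \<comment> \<open>\<open>?h\<close> is orthogonal to \<open>q\<close>, so by Pythagoras
        leaving \<open>q\<close> out of the approximation can only reduce the distance.\<close>
      from integral_norm_diff_sq [OF h sq_integrable_trig [OF q(1)] this]
      have "(LINT t|haar. (cmod (?h t))\<^sup>2) \<le> (LINT t|haar. (cmod (?h t - q t))\<^sup>2)"
        by (simp add: Bochner_Integration.integral_nonneg)
      also have "\<dots> = (LINT t|haar. (cmod (tilde lam f t - p t))\<^sup>2)"
        by (rule Bochner_Integration.integral_cong) (simp_all add: h_eq q(2) diff_diff_eq)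
      finally have "(LINT t|haar. (cmod (?h t))\<^sup>2) < e\<^sup>2" using p(2) by simp
      then have "nrm (L2chi lam) (\<lambda>p. f p - restr lam F p) < e"
        unfolding nrm_L2chi [OF d] using e by (intro real_less_lsqrt) (auto simp: Bochner_Integration.integral_nonneg)
      then show ?thesis using FB by blast
    qed
    then show "f \<in> ?L" using f by (simp add: closure_in_def)
  }
qed

theorem mainTheorem4:
  fixes lam :: real
  assumes "lam > real CARD('n::finite)"
  shows
    "bounded_op (bergman lam :: (complex^'n) ip_space) (L2chi lam) (restr lam) \<and>
     integrable haar (phi lam :: complex^'n \<Rightarrow> complex) \<and>
     (\<forall>f \<in> vecs (L2chi lam :: ((complex^'n) \<times> real) ip_space). \<forall>(t, x) \<in> Etilde.
        restr lam (restr_adj lam f) (t, x) =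
        cis (- 2 * pi * lam * x) * conv (tilde lam f) (phi lam) t) \<and>
     (\<forall>\<alpha> :: int^'n. fourier (phi lam) \<alpha> =
        (if \<forall>i. \<alpha> $ i \<ge> 0
         then of_real ((2 * real CARD('n)) powi (- (\<Sum>i\<in>UNIV. \<alpha> $ i))
                * (Gamma (lam + of_int (\<Sum>i\<in>UNIV. \<alpha> $ i)) / Gamma lam)
                * (1 / (\<Prod>i\<in>UNIV. fact (nat (\<alpha> $ i)))))
         else 0)) \<and>
     closure_in (L2chi lam) (restr lam ` vecs (bergman lam :: (complex^'n) ip_space)) =
       {f \<in> vecs (L2chi lam). \<forall>\<alpha> :: int^'n.
          fourier (phi lam) \<alpha> = 0 \<longrightarrow> fourier (tilde lam f) \<alpha> = 0} \<and>
     (\<exists>\<omega> :: (complex^'n \<Rightarrow> complex) \<Rightarrow> complex.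
        distribution \<omega> \<and> (\<forall>\<alpha>. dist_fourier \<omega> \<alpha> = csqrt (fourier (phi lam) \<alpha>))) \<and>
     (\<forall>\<omega> :: (complex^'n \<Rightarrow> complex) \<Rightarrow> complex.
        distribution \<omega> \<and> (\<forall>\<alpha>. dist_fourier \<omega> \<alpha> = csqrt (fourier (phi lam) \<alpha>)) \<longrightarrow>
        (\<forall>f \<in> vecs (L2chi lam).
           \<exists>h. integrable haar h \<and> is_conv_dist (tilde lam f) \<omega> (regular_dist h) \<and>
             (AE t in haar. \<forall>x. (t, x) \<in> Etilde \<longrightarrow>
                op_sqrt (L2chi lam) (\<lambda>g. restr lam (restr_adj lam g)) f (t, x) =
                cis (- 2 * pi * lam * x) * h t)))"
proof -
  have lam0: "lam > 0" by (rule lam_pos [OF assms])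
  let ?T = "\<lambda>g :: (complex^'n) \<times> real \<Rightarrow> complex. restr lam (restr_adj lam g)"
  have T_vecs: "?T g \<in> vecs (L2chi lam)" if "g \<in> vecs (L2chi lam)" for g
    by (rule restr_in_L2chi [OF assms restr_adj_in_bergman [OF assms that]])
  have T_tilde: "tilde lam (?T g) t = conv (tilde lam g) (phi lam) t"
    if "g \<in> vecs (L2chi lam)" "t \<in> torus" for g t
    unfolding tilde_restr [OF assms that(2)] by (rule restr_adj_base_point [OF assms that])
  have T_eq: "\<forall>f \<in> vecs (L2chi lam :: ((complex^'n) \<times> real) ip_space). \<forall>(t, x) \<in> Etilde.
      ?T f (t, x) = cis (- 2 * pi * lam * x) * conv (tilde lam f) (phi lam) t"
  proof (intro ballI, clarify)
    fix f :: "(complex^'n) \<times> real \<Rightarrow> complex" and t :: "complex^'n" and x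
    assume f: "f \<in> vecs (L2chi lam)" and tx: "(t, x) \<in> Etilde"
    show "?T f (t, x) = cis (- 2 * pi * lam * x) * conv (tilde lam f) (phi lam) t"
      unfolding L2chi_eq_tilde [OF T_vecs [OF f] tx] T_tilde [OF f Etilde_torus [OF tx]] ..
  qed
  have phi_fourier: "fourier (phi lam) \<alpha> = of_real (phi_coeff lam \<alpha>)" for \<alpha> :: "int^'n"
    by (rule fourier_phi [OF lam0])
  have coeff: "\<forall>\<alpha> :: int^'n. fourier (phi lam) \<alpha> =
        (if \<forall>i. \<alpha> $ i \<ge> 0
         then of_real ((2 * real CARD('n)) powi (- (\<Sum>i\<in>UNIV. \<alpha> $ i))
                * (Gamma (lam + of_int (\<Sum>i\<in>UNIV. \<alpha> $ i)) / Gamma lam)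
                * (1 / (\<Prod>i\<in>UNIV. fact (nat (\<alpha> $ i)))))
         else 0)"
    unfolding phi_fourier phi_coeff_def if_distrib [of of_real] of_real_0 by blast
  \<comment> \<open>The coefficients are strictly positive on the whole cone, so the condition
    describing the closure just means that \<alpha> lies off the cone.\<close>
  have vanish: "fourier (phi lam) \<alpha> = 0 \<longleftrightarrow> \<not> (\<forall>i. \<alpha> $ i \<ge> 0)" for \<alpha> :: "int^'n"
    unfolding phi_fourier using phi_coeff_pos [OF lam0, of \<alpha>] phi_coeff_eq_0 [of \<alpha> lam]
    by (metis less_irrefl of_real_eq_0_iff)
  have root: "csqrt (fourier (phi lam) \<alpha>) = of_real (sqrt (phi_coeff lam \<alpha>))" for \<alpha> :: "int^'n"
    unfolding phi_fourier
    using csqrt_of_real_nonneg [of "of_real (phi_coeff lam \<alpha>)"] phi_coeff_nonneg [OF lam0, of \<alpha>] by simp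
  have closure: "closure_in (L2chi lam) (restr lam ` vecs (bergman lam :: (complex^'n) ip_space)) =
       {f \<in> vecs (L2chi lam). \<forall>\<alpha> :: int^'n.
          fourier (phi lam) \<alpha> = 0 \<longrightarrow> fourier (tilde lam f) \<alpha> = 0}"
    unfolding vanish by (rule closure_range_restr [OF assms])
  \<comment> \<open>The square roots are summable, so a distribution with these coefficients can be
    taken regular.\<close>
  let ?\<omega> = "fourier_series (\<lambda>\<alpha> :: int^'n. of_real (sqrt (phi_coeff lam \<alpha>)))"
  note summ = freq_summable_phi_coeff(2) [OF lam0, where 'n = 'n]
  have dist: "\<exists>\<omega> :: (complex^'n \<Rightarrow> complex) \<Rightarrow> complex.
        distribution \<omega> \<and> (\<forall>\<alpha>. dist_fourier \<omega> \<alpha> = csqrt (fourier (phi lam) \<alpha>))"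
    by (intro exI [of _ "regular_dist ?\<omega>"] conjI allI distribution_regular_dist
        sq_integrable_imp_integrable sq_integrable_fourier_series summ)
       (simp only: dist_fourier_regular_dist fourier_fourier_series [OF summ] root)
  have sqrt: "\<exists>h. integrable haar h \<and> is_conv_dist (tilde lam f) \<omega> (regular_dist h) \<and>
      (AE t in haar. \<forall>x. (t, x) \<in> Etilde \<longrightarrow>
        op_sqrt (L2chi lam) ?T f (t, x) = cis (- 2 * pi * lam * x) * h t)"
    if \<omega>: "\<forall>\<alpha>. dist_fourier \<omega> \<alpha> = csqrt (fourier (phi lam) \<alpha>)" and f: "f \<in> vecs (L2chi lam)"
    for \<omega> :: "(complex^'n \<Rightarrow> complex) \<Rightarrow> complex" and f
  proof (intro exI conjI)
    \<comment> \<open>With \<open>h\<close> the torus function of the square root itself, the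
      pointwise identity holds at every t; the content lies in its Fourier coefficients, which are
      those of the convolution.\<close>
    let ?h = "tilde lam (op_sqrt (L2chi lam) ?T f)"
    note S = fourier_op_sqrt [OF lam0, of ?T f, OF T_vecs T_tilde f]
    show h: "integrable haar ?h" by (rule sq_integrable_imp_integrable [OF sq_integrable_tilde [OF S(1)]])
    show "is_conv_dist (tilde lam f) \<omega> (regular_dist ?h)"
      unfolding is_conv_dist_def
      using \<omega> distribution_regular_dist [OF h] by (simp add: dist_fourier_regular_dist S(2) root mult.commute)
    show "AE t in haar. \<forall>x. (t, x) \<in> Etilde \<longrightarrow>
        op_sqrt (L2chi lam) ?T f (t, x) = cis (- 2 * pi * lam * x) * ?h t"
      using L2chi_eq_tilde [OF S(1)] by (intro AE_I2) blast
  qed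
  show ?thesis
    using bounded_restr [OF assms] integrable_phi [of lam, where 'n = 'n] T_eq coeff closure dist sqrt by blast
qed

end
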